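(* Let $a\ge0$, $b\in\mathbb{R}$, $\sigma>0$, let $m,L\in\mathbb{N}$ with $L\ge m$, and let $T>0$. There exists a constant $C_{\mathrm{cir}}(m,L,T)\in\mathbb{R}_+$ such that for every $f\in\mathcal{C}^{m,L}_{\mathbf{pol}}(\mathbb{R}_+)$ and every $t\in(0,T]$, the function $\mathbb{E}[f(Y^\cdot_t)]:y\mapsto\mathbb{E}[f(Y^y_t)]$ belongs to $\mathcal{C}^{m,L}_{\mathbf{pol}}(\mathbb{R}_+)$ and $$\big\|\mathbb{E}[f(Y^{\cdot}_t)]\big\|_{m,L}\le C_{\mathrm{cir}}(m,L,T)\,\|f\|_{m,L}.$$
   Context: $\mathbb{R}_+=[0,\infty)$. $Y^y$ is the CIR process: $dY^y_t=(a-bY^y_t)dt+\sigma\sqrt{Y^y_t}\,dW_t$, $Y^y_0=y\ge0$, $W$ a standard Brownian motion. For $m,L\in\mathbb{N}$, $\mathcal{C}^{m,L}_{\mathbf{pol}}(\mathbb{R}_+)$ is the space of $\mathcal{C}^m$ functions $f:\mathbb{R}_+\to\mathbb{R}$ with $\|f\|_{m,L}:=\max_{0\le j\le m}\sup_{y\ge0}\frac{|f^{(j)}(y)|}{1+y^L}<\infty$. *)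

theory Defs
  imports "HOL-Probability.Probability"
begin

section \<open>The spaces of smooth functions of polynomial growth on the half-line\<close>

text \<open>Functions on $[0,\infty)$ are modelled by total functions of type \<open>real \<Rightarrow> real\<close>, of which
  only the restriction to \<open>{0..}\<close> is ever used. Derivatives are taken within \<open>{0..}\<close>, so that
  they are one-sided at \<open>0\<close>.\<close>

definition deriv_Rplus :: "(real \<Rightarrow> real) \<Rightarrow> real \<Rightarrow> real" where
  "deriv_Rplus f y = vector_derivative f (at y within {0..})"

definition C_Rplus :: "nat \<Rightarrow> (real \<Rightarrow> real) set" where
  "C_Rplus m = {f.
     (\<forall>j<m. \<forall>y\<ge>0. ((deriv_Rplus ^^ j) f) differentiable (at y within {0..})) \<and>
     (\<forall>j\<le>m. continuous_on {0..} ((deriv_Rplus ^^ j) f))}"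

definition C_pol :: "nat \<Rightarrow> nat \<Rightarrow> (real \<Rightarrow> real) set" where
  "C_pol m L = {f \<in> C_Rplus m.
     \<forall>j\<le>m. bdd_above ((\<lambda>y. \<bar>(deriv_Rplus ^^ j) f y\<bar> / (1 + y ^ L)) ` {0..})}"

text \<open>The suprema below are real-valued, so the norm is meaningful only for members of \<open>C_pol m L\<close>.\<close>

definition pol_norm :: "nat \<Rightarrow> nat \<Rightarrow> (real \<Rightarrow> real) \<Rightarrow> real" where
  "pol_norm m L f = (MAX j\<in>{..m}. SUP y\<in>{0..}. \<bar>(deriv_Rplus ^^ j) f y\<bar> / (1 + y ^ L))"


section \<open>Brownian motion\<close>

text \<open>A standard Brownian motion \<open>W\<close> relative to a filtration \<open>F\<close> on the probability space \<open>M\<close>.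
  Time has type \<open>real\<close>, but only times \<open>t \<ge> 0\<close> are used; a filtration indexed by $[0,\infty)$
  is extended by \<open>F t = F 0\<close> for \<open>t < 0\<close>. The filtration need not satisfy the usual conditions.\<close>

definition brownian_motion ::
    "'w measure \<Rightarrow> (real \<Rightarrow> 'w measure) \<Rightarrow> (real \<Rightarrow> 'w \<Rightarrow> real) \<Rightarrow> bool" where
  "brownian_motion M F W \<longleftrightarrow>
     prob_space M \<and> filtration (space M) F \<and> (\<forall>t. subalgebra M (F t)) \<and>
     (\<forall>t\<ge>0. W t \<in> borel_measurable (F t)) \<and>
     (\<forall>\<omega>\<in>space M. W 0 \<omega> = 0) \<and>
     (\<forall>\<omega>\<in>space M. continuous_on {0..} (\<lambda>t. W t \<omega>)) \<and>
     (\<forall>s t. 0 \<le> s \<and> s < t \<longrightarrow>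
        distributed M lborel (\<lambda>\<omega>. W t \<omega> - W s \<omega>) (normal_density 0 (sqrt (t - s))) \<and>
        prob_space.indep_set M (sets (F s))
          (sets (vimage_algebra (space M) (\<lambda>\<omega>. W t \<omega> - W s \<omega>) borel)))"


section \<open>The Ito integral\<close>

text \<open>A simple process is
  $\sum_{i<n} \xi_i 1_{(\tau_i,\tau_{i+1}]}$ with deterministic times
  $0 \le \tau_0 < \dots < \tau_n$ and bounded $F_{\tau_i}$-measurable $\xi_i$.\<close>

definition simple_process ::
    "(real \<Rightarrow> 'w measure) \<Rightarrow> nat \<Rightarrow> (nat \<Rightarrow> real) \<Rightarrow> (nat \<Rightarrow> 'w \<Rightarrow> real) \<Rightarrow> bool" where
  "simple_process F n \<tau> \<xi> \<longleftrightarrow>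
     0 \<le> \<tau> 0 \<and> (\<forall>i<n. \<tau> i < \<tau> (Suc i)) \<and>
     (\<forall>i<n. \<xi> i \<in> borel_measurable (F (\<tau> i)) \<and> bounded (\<xi> i ` space (F (\<tau> i))))"

definition simple_val ::
    "nat \<Rightarrow> (nat \<Rightarrow> real) \<Rightarrow> (nat \<Rightarrow> 'w \<Rightarrow> real) \<Rightarrow> real \<Rightarrow> 'w \<Rightarrow> real" where
  "simple_val n \<tau> \<xi> s \<omega> = (\<Sum>i<n. \<xi> i \<omega> * indicator {\<tau> i<..\<tau> (Suc i)} s)"

definition simple_integral ::
    "(real \<Rightarrow> 'w \<Rightarrow> real) \<Rightarrow> nat \<Rightarrow> (nat \<Rightarrow> real) \<Rightarrow> (nat \<Rightarrow> 'w \<Rightarrow> real) \<Rightarrow> real \<Rightarrow> 'w \<Rightarrow> real" where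
  "simple_integral W n \<tau> \<xi> t \<omega> =
     (\<Sum>i<n. \<xi> i \<omega> * (W (min (\<tau> (Suc i)) t) \<omega> - W (min (\<tau> i) t) \<omega>))"

text \<open>Measurability is demanded because \<open>measure\<close> vanishes on non-measurable sets.\<close>

definition to_zero_in_prob :: "'w measure \<Rightarrow> (nat \<Rightarrow> 'w \<Rightarrow> ennreal) \<Rightarrow> bool" where
  "to_zero_in_prob M U \<longleftrightarrow>
     (\<forall>k. U k \<in> borel_measurable M) \<and>
     (\<forall>\<epsilon>>0. (\<lambda>k. measure M {\<omega>\<in>space M. ennreal \<epsilon> < U k \<omega>}) \<longlonglongrightarrow> 0)"

definition progressive :: "(real \<Rightarrow> 'w measure) \<Rightarrow> (real \<Rightarrow> 'w \<Rightarrow> real) \<Rightarrow> bool" where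
  "progressive F H \<longleftrightarrow>
     (\<forall>t\<ge>0. (\<lambda>(s, \<omega>). H s \<omega>) \<in> borel_measurable (restrict_space borel {0..t} \<Otimes>\<^sub>M F t))"

text \<open>\<open>has_ito_integral M F W H t Z\<close>: the random variable \<open>Z\<close> is (a version of)
  $\int_0^t H_s\,dW_s$, that is, the limit in probability of the integrals of simple processes
  $H^k$ with $\int_0^t |H^k_s - H_s|^2\,ds \to 0$ in probability. Since the latter integral is
  taken in $[0,\infty]$, this includes $\int_0^t H_s^2\,ds < \infty$ almost surely.\<close>

definition has_ito_integral ::
    "'w measure \<Rightarrow> (real \<Rightarrow> 'w measure) \<Rightarrow> (real \<Rightarrow> 'w \<Rightarrow> real) \<Rightarrow> (real \<Rightarrow> 'w \<Rightarrow> real) \<Rightarrow>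
     real \<Rightarrow> ('w \<Rightarrow> real) \<Rightarrow> bool" where
  "has_ito_integral M F W H t Z \<longleftrightarrow>
     progressive F H \<and> Z \<in> borel_measurable M \<and>
     (\<exists>n \<tau> \<xi>. (\<forall>k. simple_process F (n k) (\<tau> k) (\<xi> k)) \<and>
        to_zero_in_prob M (\<lambda>k \<omega>.
          \<integral>\<^sup>+ s\<in>{0..t}. ennreal ((simple_val (n k) (\<tau> k) (\<xi> k) s \<omega> - H s \<omega>)\<^sup>2) \<partial>lborel) \<and>
        to_zero_in_prob M (\<lambda>k \<omega>.
          ennreal \<bar>simple_integral W (n k) (\<tau> k) (\<xi> k) t \<omega> - Z \<omega>\<bar>))"


section \<open>The CIR process\<close>

text \<open>\<open>Y\<close> is a continuous adapted process with values in $[0,\infty)$ solving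
  $dY_t = (a - b Y_t)\,dt + \sigma \sqrt{Y_t}\,dW_t$, $Y_0 = y$. The equation is read in
  integral form, almost surely for each \<open>t \<ge> 0\<close>, with \<open>Z\<close> being the stochastic integral
  up to time \<open>t\<close>; by path continuity the exceptional null set may be chosen
  independently of \<open>t\<close>.\<close>

definition cir_process ::
    "'w measure \<Rightarrow> (real \<Rightarrow> 'w measure) \<Rightarrow> (real \<Rightarrow> 'w \<Rightarrow> real) \<Rightarrow> real \<Rightarrow> real \<Rightarrow> real \<Rightarrow> real \<Rightarrow>
     (real \<Rightarrow> 'w \<Rightarrow> real) \<Rightarrow> bool" where
  "cir_process M F W a b \<sigma> y Y \<longleftrightarrow>
     (\<forall>t\<ge>0. Y t \<in> borel_measurable (F t)) \<and>
     (\<forall>\<omega>\<in>space M. \<forall>t\<ge>0. 0 \<le> Y t \<omega>) \<and>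
     (\<forall>\<omega>\<in>space M. continuous_on {0..} (\<lambda>t. Y t \<omega>)) \<and>
     (\<forall>t\<ge>0. \<exists>Z. has_ito_integral M F W (\<lambda>s \<omega>. \<sigma> * sqrt (Y s \<omega>)) t Z \<and>
        (AE \<omega> in M. Y t \<omega> = y + (LINT s:{0..t}|lborel. a - b * Y s \<omega>) + Z \<omega>))"

end

theory Submission
  imports Defs "HOL-Complex_Analysis.Complex_Analysis" "HOL-Real_Asymp.Real_Asymp"
begin


text \<open>
  The transition law is identified through its Laplace transform near \<open>0\<close>. If \<open>\<psi>\<close> solves the
  Riccati equation \<open>\<psi>' = b \<psi> + \<sigma>\<^sup>2 \<psi>\<^sup>2 / 2\<close>, then \<open>exp (- \<psi>(t) Y\<^sub>t + \<psi>(0) y + a \<integral>\<psi>)\<close> is the stochastic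
  exponential of \<open>- \<integral> \<psi> \<sigma> \<surd>Y dW\<close>. It is the limit in probability of the exponentials of simple
  integrals, which have mean \<open>1\<close>. Fatou's lemma bounds its mean by \<open>1\<close> for either sign of \<open>\<psi>\<close>;
  negative \<open>\<psi>\<close> give exponential moments of \<open>Y\<close>, and these make the approximating exponentials
  bounded in \<open>L\<^sup>2\<close> for small \<open>\<psi>\<close>, so that the mean equals \<open>1\<close>. By analytic continuation
  \<open>Y\<^sub>t\<close> is a Poisson mixture, with parameter \<open>y d\<close>, of \<open>c\<close> times Gamma laws of shape \<open>\<alpha> + n\<close>,
  where \<open>\<alpha> = 2 a / \<sigma>\<^sup>2\<close> and \<open>c d = exp (- b t)\<close>.

  Differentiating the mixture in \<open>y\<close> and integrating the Gamma densities by parts moves the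
  derivative to \<open>f\<close>: the derivative of the mean of \<open>f\<close> is \<open>exp (- b t)\<close> times the mean of \<open>f'\<close> for
  shape \<open>\<alpha> + 1\<close>. Hence the \<open>j\<close>-th derivative is bounded by moments that are uniform in \<open>t \<le> T\<close>.
\<close>

section \<open>Exponentials of simple integrals\<close>

text \<open>The diffusion coefficient is not Lipschitz at 0, so the solution cannot simply be
  differentiated in its starting point; all regularity in y is read off an explicit law instead. The
  Ito integral is known only as a limit in probability along unspecified simple processes,
  separately for each time. Ito's formula is avoided: summation by parts turns the integral of
  \<psi> against the martingale part of Y into a pathwise limit, and freezing the integrand on a
  uniform grid costs an Ito integral of a uniformly small integrand, which an exponential inequality
  controls. The second moments are bounded only for small Laplace parameters, where exponential
  moments of Y dominate those of the bracket. This is why the transform is computed near 0 only. The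
  same exponential moments make it holomorphic on a strip around the imaginary axis, so a short
  interval of parameters determines the law. Raising the shape by one stays within the same family
  of laws, so each derivative in y uses up exactly one derivative of f.\<close>

lemma nn_integral_normal_exp:
  fixes z d :: real
  assumes "d > 0"
  shows "(\<integral>\<^sup>+x. ennreal (exp (z * x - z\<^sup>2 * d / 2)) \<partial>density lborel (normal_density 0 (sqrt d))) = 1"
proof -
  have "(\<integral>\<^sup>+x. ennreal (exp (z * x - z\<^sup>2 * d / 2)) \<partial>density lborel (normal_density 0 (sqrt d)))
      = (\<integral>\<^sup>+x. ennreal (normal_density 0 (sqrt d) x * exp (z * x - z\<^sup>2 * d / 2)) \<partial>lborel)"
    by (subst nn_integral_density) (simp_all add: ennreal_mult)
  also have "\<dots> = (\<integral>\<^sup>+x. ennreal (normal_density (z * d) (sqrt d) x) \<partial>lborel)"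
  proof (intro nn_integral_cong arg_cong[where f=ennreal])
    \<comment> \<open>Completing the square: the exponential tilt turns the centred normal law of
      variance d into the one with mean z d.\<close>
    fix x
    have "- (x\<^sup>2) / (2 * d) + (z * x - z\<^sup>2 * d / 2) = - ((x - z * d)\<^sup>2) / (2 * d)"
      using assms by (simp add: field_simps power2_eq_square)
    then show "normal_density 0 (sqrt d) x * exp (z * x - z\<^sup>2 * d / 2) = normal_density (z * d) (sqrt d) x"
      using assms by (simp add: normal_density_def mult_exp_exp)
  qed
  also have "\<dots> = 1"
    using prob_space.emeasure_space_1[OF prob_space_normal_density[of "sqrt d" "z * d"]] assms
    by (simp add: emeasure_density)
  finally show ?thesis .
qed

locale brownian = prob_space M for M :: "'w measure" +
  fixes F :: "real \<Rightarrow> 'w measure" and W :: "real \<Rightarrow> 'w \<Rightarrow> real"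
  assumes bm: "brownian_motion M F W"
begin

lemma subalg: "subalgebra M (F t)"
  using bm by (auto simp: brownian_motion_def)

lemma space_F [simp]: "space (F t) = space M"
  using subalg by (auto simp: subalgebra_def)

lemma F_measurable: "f \<in> F t \<rightarrow>\<^sub>M N \<Longrightarrow> f \<in> M \<rightarrow>\<^sub>M N"
  using measurable_from_subalg[OF subalg] .

lemma F_mono: "s \<le> t \<Longrightarrow> f \<in> F s \<rightarrow>\<^sub>M N \<Longrightarrow> f \<in> F t \<rightarrow>\<^sub>M N"
  using filtration.sets_F_mono[of "space M" F s t] bm
  by (auto simp: brownian_motion_def measurable_def)

lemma W_adapted: "0 \<le> t \<Longrightarrow> W t \<in> borel_measurable (F t)"
  using bm by (auto simp: brownian_motion_def)

lemma W_measurable: "0 \<le> t \<Longrightarrow> W t \<in> borel_measurable M"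
  using F_measurable W_adapted by blast

text \<open>The pair of V and z is measurable for F s, hence independent of the increment: the joint
  law is a product, and Tonelli allows integrating the Gaussian factor first with z fixed. Values in
  \<open>ennreal\<close> spare any integrability assumption on V.\<close>

lemma gauss_step:
  fixes V :: "'w \<Rightarrow> ennreal" and z :: "'w \<Rightarrow> real"
  assumes V: "V \<in> borel_measurable (F s)" and z: "z \<in> borel_measurable (F s)"
    and sr: "0 \<le> s" "s < r"
  shows "(\<integral>\<^sup>+w. V w * ennreal (exp (z w * (W r w - W s w) - (z w)\<^sup>2 * (r - s) / 2)) \<partial>M)
       = (\<integral>\<^sup>+w. V w \<partial>M)"
proof -
  define D where "D = (\<lambda>w. W r w - W s w)"
  define X where "X = (\<lambda>w. (V w, z w))"
  have dist: "distributed M lborel D (normal_density 0 (sqrt (r - s)))"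
    and ind: "indep_set (sets (F s)) (sets (vimage_algebra (space M) D borel))"
    using bm sr by (auto simp: brownian_motion_def D_def)
  have [measurable]: "D \<in> borel_measurable M"
    using W_measurable sr by (auto simp: D_def)
  have XF: "X \<in> F s \<rightarrow>\<^sub>M borel \<Otimes>\<^sub>M borel"
    using V z by (auto simp: X_def)
  then have [measurable]: "X \<in> M \<rightarrow>\<^sub>M borel \<Otimes>\<^sub>M borel"
    by (rule F_measurable)
  have prod: "distr M (borel \<Otimes>\<^sub>M borel) X \<Otimes>\<^sub>M distr M borel D
      = distr M ((borel \<Otimes>\<^sub>M borel) \<Otimes>\<^sub>M borel) (\<lambda>w. (X w, D w))"
  proof (rule pair_measure_eqI)
    fix A :: "(ennreal \<times> real) set" and B :: "real set"
    assume "A \<in> sets (distr M (borel \<Otimes>\<^sub>M borel) X)" "B \<in> sets (distr M borel D)"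
    then have [measurable]: "A \<in> sets (borel \<Otimes>\<^sub>M borel)" "B \<in> sets borel" by auto
    have "prob ((X -` A \<inter> space M) \<inter> (D -` B \<inter> space M)) = prob (X -` A \<inter> space M) * prob (D -` B \<inter> space M)"
    proof (rule indep_setD[OF ind])
      show "X -` A \<inter> space M \<in> sets (F s)" using measurable_sets[OF XF, of A] by simp
      show "D -` B \<inter> space M \<in> sets (vimage_algebra (space M) D borel)"
        by (rule in_vimage_algebra) simp
    qed
    then show "emeasure (distr M (borel \<Otimes>\<^sub>M borel) X) A * emeasure (distr M borel D) B
       = emeasure (distr M ((borel \<Otimes>\<^sub>M borel) \<Otimes>\<^sub>M borel) (\<lambda>w. (X w, D w))) (A \<times> B)"
      by (simp add: emeasure_distr emeasure_eq_measure ennreal_mult[symmetric] vimage_def Int_def conj_ac)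
  qed (auto intro!: prob_space_imp_sigma_finite prob_space_distr)
  have dD: "distr M borel D = density lborel (normal_density 0 (sqrt (r - s)))"
    using dist by (simp add: distributed_def cong: distr_cong)
  interpret D: prob_space "distr M borel D" by (rule prob_space_distr) measurable
  define h where "h = (\<lambda>p::(ennreal \<times> real) \<times> real.
    fst (fst p) * ennreal (exp (snd (fst p) * snd p - (snd (fst p))\<^sup>2 * (r - s) / 2)))"
  have [measurable]: "h \<in> borel_measurable ((borel \<Otimes>\<^sub>M borel) \<Otimes>\<^sub>M borel)"
    unfolding h_def by measurable
  have "(\<integral>\<^sup>+w. V w * ennreal (exp (z w * (W r w - W s w) - (z w)\<^sup>2 * (r - s) / 2)) \<partial>M)
     = (\<integral>\<^sup>+w. h (X w, D w) \<partial>M)"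
    by (simp add: h_def X_def D_def)
  also have "\<dots> = (\<integral>\<^sup>+p. h p \<partial>(distr M (borel \<Otimes>\<^sub>M borel) X \<Otimes>\<^sub>M distr M borel D))"
    unfolding prod by (subst nn_integral_distr) auto
  also have "\<dots> = (\<integral>\<^sup>+p. (\<integral>\<^sup>+d. h (p, d) \<partial>distr M borel D) \<partial>distr M (borel \<Otimes>\<^sub>M borel) X)"
    by (subst D.nn_integral_fst[symmetric]) auto
  also have "\<dots> = (\<integral>\<^sup>+p. fst p \<partial>distr M (borel \<Otimes>\<^sub>M borel) X)"
  proof (rule nn_integral_cong)
    fix p :: "ennreal \<times> real"
    obtain v x where p: "p = (v, x)" by (cases p)
    have "(\<integral>\<^sup>+d. h (p, d) \<partial>distr M borel D) = v * (\<integral>\<^sup>+d. ennreal (exp (x * d - x\<^sup>2 * (r - s) / 2)) \<partial>distr M borel D)"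
      unfolding h_def p by (subst nn_integral_cmult[symmetric]) auto
    also have "\<dots> = v" unfolding dD using sr by (subst nn_integral_normal_exp) auto
    finally show "(\<integral>\<^sup>+d. h (p, d) \<partial>distr M borel D) = fst p" by (simp add: p)
  qed
  also have "\<dots> = (\<integral>\<^sup>+w. V w \<partial>M)"
    using F_measurable[OF V] F_measurable[OF z] by (subst nn_integral_distr) (auto simp: X_def)
  finally show ?thesis .
qed

text \<open>Induction peels off the last cell: the earlier factors are measurable at its left end,
  so \<open>gauss_step\<close> removes the last factor.\<close>

lemma grid_exp:
  fixes z :: "nat \<Rightarrow> 'w \<Rightarrow> real"
  assumes \<tau>: "0 \<le> \<tau> 0" "\<And>l. l < n \<Longrightarrow> \<tau> l < \<tau> (Suc l)"
    and z: "\<And>l. l < n \<Longrightarrow> z l \<in> borel_measurable (F (\<tau> l))"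
  shows "(\<integral>\<^sup>+w. ennreal (exp ((\<Sum>l<n. z l w * (W (\<tau> (Suc l)) w - W (\<tau> l) w))
      - (\<Sum>l<n. (z l w)\<^sup>2 * (\<tau> (Suc l) - \<tau> l)) / 2)) \<partial>M) = 1"
  using \<tau> z
proof (induction n)
  case 0
  then show ?case by (simp add: emeasure_space_1)
next
  case (Suc n)
  have mono: "l \<le> k \<Longrightarrow> k \<le> Suc n \<Longrightarrow> \<tau> l \<le> \<tau> k" for l k
  proof (induction rule: dec_induct)
    case (step k)
    then show ?case using Suc.prems(2)[of k] by auto
  qed simp
  have pos: "0 \<le> \<tau> l" if "l \<le> Suc n" for l
    using mono[of 0 l] that Suc.prems(1) by simp
  have zF: "z l \<in> borel_measurable (F (\<tau> n))" if "l \<le> n" for l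
    using Suc.prems(3)[of l] mono[of l n] that by (auto intro: F_mono)
  have WF: "W (\<tau> l) \<in> borel_measurable (F (\<tau> n))" if "l \<le> n" for l
    using W_adapted[of "\<tau> l"] mono[of l n] pos[of l] that by (auto intro: F_mono)
  define E where "E = (\<lambda>w. (\<Sum>l<n. z l w * (W (\<tau> (Suc l)) w - W (\<tau> l) w))
      - (\<Sum>l<n. (z l w)\<^sup>2 * (\<tau> (Suc l) - \<tau> l)) / 2)"
  have EF: "E \<in> borel_measurable (F (\<tau> n))"
    unfolding E_def
    by (intro borel_measurable_diff borel_measurable_sum borel_measurable_times borel_measurable_divide
        borel_measurable_power borel_measurable_const zF WF) auto
  have "(\<integral>\<^sup>+w. ennreal (exp ((\<Sum>l<Suc n. z l w * (W (\<tau> (Suc l)) w - W (\<tau> l) w))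
      - (\<Sum>l<Suc n. (z l w)\<^sup>2 * (\<tau> (Suc l) - \<tau> l)) / 2)) \<partial>M)
      = (\<integral>\<^sup>+w. ennreal (exp (E w)) * ennreal (exp (z n w * (W (\<tau> (Suc n)) w - W (\<tau> n) w) - (z n w)\<^sup>2 * (\<tau> (Suc n) - \<tau> n) / 2)) \<partial>M)"
    by (intro nn_integral_cong)
      (simp add: E_def ennreal_mult[symmetric] mult_exp_exp add_divide_distrib)
  also have "\<dots> = (\<integral>\<^sup>+w. ennreal (exp (E w)) \<partial>M)"
  proof (rule gauss_step)
    show "(\<lambda>w. ennreal (exp (E w))) \<in> borel_measurable (F (\<tau> n))"
      using EF by (intro measurable_compose[OF _ measurable_ennreal] measurable_compose[OF EF borel_measurable_exp])
  qed (use zF Suc.prems(2)[of n] pos in simp_all)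
  also have "\<dots> = 1"
    unfolding E_def by (rule Suc.IH) (use Suc.prems in simp_all)
  finally show ?case .
qed

end


abbreviation sq_int :: "real \<Rightarrow> (real \<Rightarrow> real) \<Rightarrow> ennreal" where
  "sq_int t h \<equiv> \<integral>\<^sup>+s\<in>{0..t}. ennreal ((h s)\<^sup>2) \<partial>lborel"

lemma grid_mono:
  fixes \<tau> :: "nat \<Rightarrow> real"
  assumes "\<And>l. l < n \<Longrightarrow> \<tau> l < \<tau> (Suc l)" and "p \<le> q" and "q \<le> n"
  shows "\<tau> p \<le> \<tau> q"
  using assms(2,3)
proof (induction rule: dec_induct)
  case (step k)
  then show ?case using assms(1)[of k] by auto
qed simp

text \<open>Telescoping over the cells p to q - 1. \<open>elem_grid\<close> uses it for increments
  of W and, through indicators of half-lines, for the step function in time.\<close>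

lemma sum_increments_if:
  fixes f :: "nat \<Rightarrow> real"
  assumes "p \<le> q" and "q \<le> n"
  shows "(\<Sum>l<n. (if p \<le> l \<and> l < q then x else 0) * (f (Suc l) - f l)) = x * (f q - f p)"
proof -
  have "(\<Sum>l<n. (if p \<le> l \<and> l < q then x else 0) * (f (Suc l) - f l)) = (\<Sum>l\<in>{p..<q}. x * (f (Suc l) - f l))"
    by (rule sum.mono_neutral_cong_right) (use assms in auto)
  also have "\<dots> = x * (f q - f p)"
    by (simp add: sum_distrib_left[symmetric] sum_Suc_diff'[OF assms(1)])
  finally show ?thesis .
qed

text \<open>The cells are disjoint, so all cross terms vanish.\<close>

lemma step_function_square:
  fixes \<tau> z :: "nat \<Rightarrow> real"
  assumes "\<And>l. l < n \<Longrightarrow> \<tau> l < \<tau> (Suc l)"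
  shows "(\<Sum>l<n. z l * indicator {\<tau> l<..\<tau> (Suc l)} s)\<^sup>2 = (\<Sum>l<n. (z l)\<^sup>2 * indicator {\<tau> l<..\<tau> (Suc l)} s)"
  using assms
proof (induction n)
  case (Suc n)
  have "(\<Sum>l<n. z l * indicator {\<tau> l<..\<tau> (Suc l)} s) * indicator {\<tau> n<..\<tau> (Suc n)} s = (0::real)"
    unfolding sum_distrib_right
  proof (rule sum.neutral, safe)
    fix l assume "l < n"
    then have "\<tau> (Suc l) \<le> \<tau> n"
      using grid_mono[of "Suc n" \<tau> "Suc l" n] Suc.prems by auto
    then show "z l * indicator {\<tau> l<..\<tau> (Suc l)} s * indicator {\<tau> n<..\<tau> (Suc n)} s = 0"
      by (auto simp: indicator_def)
  qed
  moreover have "(indicator {\<tau> n<..\<tau> (Suc n)} s :: real)\<^sup>2 = indicator {\<tau> n<..\<tau> (Suc n)} s"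
    by (auto simp: indicator_def)
  ultimately show ?case
    using Suc by (simp add: power2_sum power_mult_distrib mult_ac)
qed simp

text \<open>Turns the indicator of a cell into an increment, ready for telescoping.\<close>

lemma indicator_Ioc_diff:
  fixes u v s :: real
  assumes "u \<le> v"
  shows "indicator {u<..v} s = (indicator {..v} s - indicator {..u} s :: real)"
  using assms by (auto simp: indicator_def)

context brownian
begin

text \<open>The pair of a simple process on \<open>[0,t]\<close> and its stochastic integral. As a relation between
  the two it is closed under linear combinations without any common refinement of time grids.\<close>

inductive elem :: "real \<Rightarrow> (real \<Rightarrow> 'w \<Rightarrow> real) \<Rightarrow> ('w \<Rightarrow> real) \<Rightarrow> bool" for t where
  elem_zero: "elem t (\<lambda>s w. 0) (\<lambda>w. 0)"
| elem_add: "elem t G I \<Longrightarrow> 0 \<le> u \<Longrightarrow> u \<le> v \<Longrightarrow> v \<le> t \<Longrightarrow> \<xi> \<in> borel_measurable (F u) \<Longrightarrow>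
    elem t (\<lambda>s w. G s w + \<xi> w * indicator {u<..v} s) (\<lambda>w. I w + \<xi> w * (W v w - W u w))"

lemma elem_single:
  "0 \<le> u \<Longrightarrow> u \<le> v \<Longrightarrow> v \<le> t \<Longrightarrow> \<xi> \<in> borel_measurable (F u) \<Longrightarrow>
    elem t (\<lambda>s w. \<xi> w * indicator {u<..v} s) (\<lambda>w. \<xi> w * (W v w - W u w))"
  using elem_add[OF elem_zero, of u v t \<xi>] by simp

lemma elem_plus:
  assumes "elem t G I" and "elem t G' I'"
  shows "elem t (\<lambda>s w. G s w + G' s w) (\<lambda>w. I w + I' w)"
  using assms(2)
proof induction
  case elem_zero
  then show ?case using assms(1) by simp
next
  case (elem_add G' I' u v \<xi>)
  show ?case
    using elem.elem_add[OF elem_add.IH elem_add.hyps(2-5)] by (simp add: add.assoc)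
qed

lemma elem_scale:
  assumes "elem t G I"
  shows "elem t (\<lambda>s w. c * G s w) (\<lambda>w. c * I w)"
  using assms
proof induction
  case elem_zero
  then show ?case using elem.elem_zero by simp
next
  case (elem_add G I u v \<xi>)
  have "(\<lambda>w. c * \<xi> w) \<in> borel_measurable (F u)"
    using elem_add.hyps(5) by simp
  from elem.elem_add[OF elem_add.IH elem_add.hyps(2-4) this]
  show ?case by (simp add: algebra_simps)
qed

lemma elem_sum:
  assumes "\<And>i. i < n \<Longrightarrow> elem t (G i) (I i)"
  shows "elem t (\<lambda>s w. \<Sum>i<n. G i s w) (\<lambda>w. \<Sum>i<(n::nat). I i w)"
  using assms by (induction n) (auto intro: elem_zero elem_plus)

lemma elem_measurable_time:
  assumes "elem t G I"
  shows "(\<lambda>s. G s w) \<in> borel_measurable borel"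
  using assms by induction auto

definition on_grid :: "nat \<Rightarrow> (nat \<Rightarrow> real) \<Rightarrow> (real \<Rightarrow> 'w \<Rightarrow> real) \<Rightarrow> ('w \<Rightarrow> real) \<Rightarrow> bool" where
  "on_grid n \<tau> G I \<longleftrightarrow> (\<exists>z. (\<forall>l<n. z l \<in> borel_measurable (F (\<tau> l))) \<and>
      (\<forall>w. I w = (\<Sum>l<n. z l w * (W (\<tau> (Suc l)) w - W (\<tau> l) w))) \<and>
      (\<forall>w s. G s w = (\<Sum>l<n. z l w * indicator {\<tau> l<..\<tau> (Suc l)} s)))"

text \<open>Asking for every grid that contains D, rather than for one grid, makes the induction
  work: a further interval only adds its two end points to D.\<close>

lemma elem_grid:
  assumes "elem t G I"
  shows "\<exists>D. finite D \<and> D \<subseteq> {0..t} \<and> (\<forall>n \<tau>. (\<forall>l<n. \<tau> l < \<tau> (Suc l)) \<longrightarrow> D \<subseteq> \<tau> ` {..n} \<longrightarrow>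
    on_grid n \<tau> G I)"
  using assms
proof induction
  case elem_zero
  show ?case by (rule exI[of _ "{}"]) (auto simp: on_grid_def intro!: exI[of _ "\<lambda>_ _. 0"])
next
  case (elem_add G I u v \<xi>)
  from elem_add.IH obtain D where D: "finite D" "D \<subseteq> {0..t}" and
    H: "\<And>n \<tau>. (\<forall>l<n. \<tau> l < \<tau> (Suc l)) \<Longrightarrow> D \<subseteq> \<tau> ` {..n} \<Longrightarrow>
    on_grid n \<tau> G I"
    by blast
  show ?case
  proof (intro exI[of _ "insert u (insert v D)"] conjI allI impI)
    show "finite (insert u (insert v D))" "insert u (insert v D) \<subseteq> {0..t}"
      using D elem_add.hyps by auto
    fix n \<tau> assume \<tau>: "\<forall>l<n. \<tau> l < \<tau> (Suc l)" and sub: "insert u (insert v D) \<subseteq> \<tau> ` {..n}"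
    from H[OF \<tau>] sub obtain z where z: "\<And>l. l < n \<Longrightarrow> z l \<in> borel_measurable (F (\<tau> l))"
      "\<And>w. I w = (\<Sum>l<n. z l w * (W (\<tau> (Suc l)) w - W (\<tau> l) w))"
      "\<And>w s. G s w = (\<Sum>l<n. z l w * indicator {\<tau> l<..\<tau> (Suc l)} s)"
      unfolding on_grid_def by auto
    from sub obtain p q where p: "u = \<tau> p" "p \<le> n" and q: "v = \<tau> q" "q \<le> n" by auto
    \<comment> \<open>The indices were chosen by their times alone; if q < p, monotonicity forces
      equal times and p serves for both ends.\<close>
    have "\<exists>q'. v = \<tau> q' \<and> q' \<le> n \<and> p \<le> q'"
    proof (cases "p \<le> q")
      case False
      then have "\<tau> q \<le> \<tau> p" using grid_mono[of n \<tau> q p] \<tau> p by auto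
      then have "v = \<tau> p" using elem_add.hyps p q by auto
      then show ?thesis using p by blast
    qed (use q in auto)
    then obtain q where q: "v = \<tau> q" "q \<le> n" "p \<le> q" by blast
    let ?z = "\<lambda>l w. z l w + (if p \<le> l \<and> l < q then \<xi> w else 0)"
    show "on_grid n \<tau> (\<lambda>s w. G s w + \<xi> w * indicator {u<..v} s) (\<lambda>w. I w + \<xi> w * (W v w - W u w))"
      unfolding on_grid_def
    proof (intro exI[of _ ?z] conjI allI impI)
      fix l assume l: "l < n"
      show "?z l \<in> borel_measurable (F (\<tau> l))"
      proof (cases "p \<le> l \<and> l < q")
        case True
        then have "\<tau> p \<le> \<tau> l" using grid_mono[of n \<tau> p l] \<tau> l by auto
        then have "\<xi> \<in> borel_measurable (F (\<tau> l))" using elem_add.hyps(5) p by (auto intro: F_mono)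
        then show ?thesis using z(1)[OF l] True by simp
      next
        case False
        then show ?thesis using z(1)[OF l] by auto
      qed
    next
      fix w
      show "I w + \<xi> w * (W v w - W u w) = (\<Sum>l<n. ?z l w * (W (\<tau> (Suc l)) w - W (\<tau> l) w))"
        unfolding z(2)[of w] distrib_right sum.distrib p(1) q(1)
        using sum_increments_if[OF q(3,2), where x="\<xi> w" and f="\<lambda>l. W (\<tau> l) w"] by simp
      fix s
      have "(\<Sum>l<n. (if p \<le> l \<and> l < q then \<xi> w else 0) * indicator {\<tau> l<..\<tau> (Suc l)} s)
          = (\<Sum>l<n. (if p \<le> l \<and> l < q then \<xi> w else 0) * (indicator {..\<tau> (Suc l)} s - indicator {..\<tau> l} s :: real))"
        by (intro sum.cong refl, subst indicator_Ioc_diff) (use \<tau> in \<open>auto intro: less_imp_le\<close>)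
      also have "\<dots> = \<xi> w * (indicator {..v} s - indicator {..u} s)"
        unfolding p(1) q(1)
        using sum_increments_if[OF q(3,2), where x="\<xi> w" and f="\<lambda>l. indicator {..\<tau> l} s"] .
      also have "\<dots> = \<xi> w * indicator {u<..v} s"
        using indicator_Ioc_diff[OF elem_add.hyps(3), of s] by simp
      finally show "G s w + \<xi> w * indicator {u<..v} s = (\<Sum>l<n. ?z l w * indicator {\<tau> l<..\<tau> (Suc l)} s)"
        unfolding z(3)[of s w] distrib_right sum.distrib by simp
    qed
  qed
qed

text \<open>Q is the bracket of the integral. A grid through all break points represents G with
  disjoint cells; there the time integral of the square is the sum Q, and \<open>grid_exp\<close>
  applies to the coefficients scaled by \<theta>.\<close>

lemma elem_exp:
  assumes "elem t G I" and "0 \<le> t"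
  obtains Q where "I \<in> borel_measurable M" "Q \<in> borel_measurable M" "\<And>w. 0 \<le> Q w"
    "\<And>w. sq_int t (\<lambda>s. G s w) = ennreal (Q w)"
    "\<And>\<theta>. (\<integral>\<^sup>+w. ennreal (exp (\<theta> * I w - \<theta>\<^sup>2 * Q w / 2)) \<partial>M) = 1"
proof -
  from elem_grid[OF assms(1)] obtain D where D: "finite D" "D \<subseteq> {0..t}" and
    H: "\<And>n \<tau>. (\<forall>l<n. \<tau> l < \<tau> (Suc l)) \<Longrightarrow> D \<subseteq> \<tau> ` {..n} \<Longrightarrow>
    on_grid n \<tau> G I"
    by blast
  \<comment> \<open>Inserting 0 keeps the list nonempty, so that its length is n + 1 also for empty
    D.\<close>
  define xs where "xs = sorted_list_of_set (insert 0 D)"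
  define \<tau> where "\<tau> = (\<lambda>i. xs ! i)"
  define n where "n = length xs - 1"
  have set: "set xs = insert 0 D" and ss: "sorted_wrt (<) xs"
    unfolding xs_def using D(1) set_sorted_list_of_set[of "insert 0 D"]
      strict_sorted_list_of_set[of "insert 0 D"] by blast+
  then have len: "length xs = Suc n" by (cases xs) (auto simp: n_def)
  have \<tau>: "\<And>l. l < n \<Longrightarrow> \<tau> l < \<tau> (Suc l)"
    using sorted_wrt_nth_less[OF ss] len by (auto simp: \<tau>_def)
  have im: "\<tau> ` {..n} = insert 0 D"
    unfolding set[symmetric] \<tau>_def using len by (auto simp: set_conv_nth less_Suc_eq_le)
  have rng: "0 \<le> \<tau> l \<and> \<tau> l \<le> t" if "l \<le> n" for l
  proof -
    have "\<tau> l \<in> insert 0 D" using im that by blast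
    then show ?thesis using D(2) assms(2) by auto
  qed
  have "on_grid n \<tau> G I"
    by (rule H) (use \<tau> im in auto)
  then obtain z where z: "\<And>l. l < n \<Longrightarrow> z l \<in> borel_measurable (F (\<tau> l))"
      "\<And>w. I w = (\<Sum>l<n. z l w * (W (\<tau> (Suc l)) w - W (\<tau> l) w))"
      "\<And>w s. G s w = (\<Sum>l<n. z l w * indicator {\<tau> l<..\<tau> (Suc l)} s)"
    unfolding on_grid_def by blast
  have zM: "l < n \<Longrightarrow> z l \<in> borel_measurable M" for l
    using z(1) F_measurable by blast
  have WM: "l \<le> n \<Longrightarrow> W (\<tau> l) \<in> borel_measurable M" for l
    using W_measurable rng by blast
  define Q where "Q = (\<lambda>w. \<Sum>l<n. (z l w)\<^sup>2 * (\<tau> (Suc l) - \<tau> l))"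
  show thesis
  proof (rule that[of Q])
    have "(\<lambda>w. \<Sum>l<n. z l w * (W (\<tau> (Suc l)) w - W (\<tau> l) w)) \<in> borel_measurable M"
      by (intro borel_measurable_sum borel_measurable_times borel_measurable_diff zM WM) auto
    then show "I \<in> borel_measurable M" using z(2) by presburger
    show "Q \<in> borel_measurable M"
      unfolding Q_def by (intro borel_measurable_sum borel_measurable_times borel_measurable_power zM) auto
    show "0 \<le> Q w" for w
      unfolding Q_def using \<tau> by (intro sum_nonneg mult_nonneg_nonneg) (auto intro: less_imp_le)
    show "sq_int t (\<lambda>s. G s w) = ennreal (Q w)" for w
    proof -
      have "sq_int t (\<lambda>s. G s w)
         = (\<integral>\<^sup>+s. (\<Sum>l<n. ennreal ((z l w)\<^sup>2) * indicator {\<tau> l<..\<tau> (Suc l)} s) \<partial>lborel)"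
      proof (rule nn_integral_cong)
        fix s
        have "(G s w)\<^sup>2 = (\<Sum>l<n. (z l w)\<^sup>2 * indicator {\<tau> l<..\<tau> (Suc l)} s)"
          unfolding z(3) by (rule step_function_square) (rule \<tau>)
        also have "ennreal \<dots> = (\<Sum>l<n. ennreal ((z l w)\<^sup>2 * indicator {\<tau> l<..\<tau> (Suc l)} s))"
          by (rule sum_ennreal[symmetric]) auto
        also have "\<dots> = (\<Sum>l<n. ennreal ((z l w)\<^sup>2) * indicator {\<tau> l<..\<tau> (Suc l)} s)"
          by (intro sum.cong refl) (auto simp: indicator_def)
        finally have e: "ennreal ((G s w)\<^sup>2) = \<dots>" .
        show "ennreal ((G s w)\<^sup>2) * indicator {0..t} s = (\<Sum>l<n. ennreal ((z l w)\<^sup>2) * indicator {\<tau> l<..\<tau> (Suc l)} s)"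
          unfolding e sum_distrib_right
        proof (intro sum.cong refl)
          fix l assume "l \<in> {..<n}"
          then have "0 \<le> \<tau> l" "\<tau> (Suc l) \<le> t" using rng[of l] rng[of "Suc l"] by auto
          then show "ennreal ((z l w)\<^sup>2) * indicator {\<tau> l<..\<tau> (Suc l)} s * indicator {0..t} s =
            ennreal ((z l w)\<^sup>2) * indicator {\<tau> l<..\<tau> (Suc l)} s"
            by (auto simp: indicator_def)
        qed
      qed
      also have "\<dots> = (\<Sum>l<n. ennreal ((z l w)\<^sup>2) * ennreal (\<tau> (Suc l) - \<tau> l))"
        by (subst nn_integral_sum) (auto intro!: sum.cong simp: nn_integral_cmult_indicator less_imp_le[OF \<tau>])
      also have "\<dots> = ennreal (Q w)"
        unfolding Q_def using \<tau>
        by (subst sum_ennreal[symmetric]) (auto simp: ennreal_mult less_imp_le intro!: mult_nonneg_nonneg)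
      finally show ?thesis .
    qed
    show "(\<integral>\<^sup>+w. ennreal (exp (\<theta> * I w - \<theta>\<^sup>2 * Q w / 2)) \<partial>M) = 1" for \<theta>
    proof -
      have "(\<integral>\<^sup>+w. ennreal (exp ((\<Sum>l<n. (\<theta> * z l w) * (W (\<tau> (Suc l)) w - W (\<tau> l) w))
        - (\<Sum>l<n. (\<theta> * z l w)\<^sup>2 * (\<tau> (Suc l) - \<tau> l)) / 2)) \<partial>M) = 1"
        by (rule grid_exp) (use \<tau> rng z(1) in auto)
      then show ?thesis
        unfolding z(2) Q_def by (simp add: sum_distrib_left power_mult_distrib mult.assoc)
    qed
  qed
qed

lemma markov_exp:
  assumes [measurable]: "f \<in> borel_measurable M" and f: "(\<integral>\<^sup>+w. ennreal (exp (f w)) \<partial>M) \<le> 1"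
  shows "prob {w\<in>space M. c \<le> f w} \<le> exp (- c)"
proof -
  have "ennreal (exp c) * emeasure M {w\<in>space M. c \<le> f w} = (\<integral>\<^sup>+w. ennreal (exp c) * indicator {w\<in>space M. c \<le> f w} w \<partial>M)"
    by (subst nn_integral_cmult_indicator) auto
  also have "\<dots> \<le> (\<integral>\<^sup>+w. ennreal (exp (f w)) \<partial>M)"
    by (intro nn_integral_mono) (auto simp: indicator_def)
  finally have "ennreal (exp c * prob {w\<in>space M. c \<le> f w}) \<le> ennreal 1"
    using f by (simp add: emeasure_eq_measure ennreal_mult)
  then have "exp c * prob {w\<in>space M. c \<le> f w} \<le> 1" by (subst (asm) ennreal_le_iff) auto
  then show ?thesis by (simp add: exp_minus field_simps)
qed

text \<open>The choice \<open>\<theta> = \<epsilon> / \<delta>\<close> in the exponential identity. This inequality replaces the Ito isometry.\<close>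

lemma elem_exp_inequality:
  assumes el: "elem t G I" and t: "0 \<le> t" and e: "\<epsilon> > 0" and d: "\<delta> > 0"
  obtains A where "A \<in> sets M" "prob A \<le> 2 * exp (- \<epsilon>\<^sup>2 / (2 * \<delta>))"
    "\<And>w. w \<in> space M - A \<Longrightarrow> sq_int t (\<lambda>s. G s w) \<le> ennreal \<delta> \<Longrightarrow> \<bar>I w\<bar> \<le> \<epsilon>"
proof -
  from elem_exp[OF el t] obtain Q where [measurable]: "I \<in> borel_measurable M" "Q \<in> borel_measurable M"
    and Q: "\<And>w. 0 \<le> Q w" "\<And>w. sq_int t (\<lambda>s. G s w) = ennreal (Q w)"
    "\<And>\<theta>. (\<integral>\<^sup>+w. ennreal (exp (\<theta> * I w - \<theta>\<^sup>2 * Q w / 2)) \<partial>M) = 1"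
    by blast
  define A where "A \<theta> = {w\<in>space M. \<epsilon>\<^sup>2 / (2 * \<delta>) \<le> \<theta> * I w - \<theta>\<^sup>2 * Q w / 2}" for \<theta>
  have P: "prob (A \<theta>) \<le> exp (- (\<epsilon>\<^sup>2 / (2 * \<delta>)))" for \<theta>
    unfolding A_def by (rule markov_exp) (use Q(3) in auto)
  have [measurable]: "A \<theta> \<in> sets M" for \<theta> unfolding A_def by measurable
  have *: "\<theta> * I w \<le> \<epsilon>\<^sup>2 / \<delta>"
    if "w \<in> space M" "w \<notin> A \<theta>" "Q w \<le> \<delta>" "\<bar>\<theta>\<bar> = \<epsilon> / \<delta>" for w \<theta>
  proof -
    have "\<theta>\<^sup>2 = (\<epsilon> / \<delta>)\<^sup>2" using that(4) by (metis power2_abs)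
    then have "\<theta>\<^sup>2 * Q w / 2 \<le> (\<epsilon> / \<delta>)\<^sup>2 * \<delta> / 2" using that(3) by (simp add: mult_left_mono)
    also have "\<dots> = \<epsilon>\<^sup>2 / (2 * \<delta>)" using d by (simp add: field_simps power2_eq_square)
    finally have "\<theta>\<^sup>2 * Q w / 2 \<le> \<epsilon>\<^sup>2 / (2 * \<delta>)" .
    moreover have "\<theta> * I w - \<theta>\<^sup>2 * Q w / 2 < \<epsilon>\<^sup>2 / (2 * \<delta>)" using that by (auto simp: A_def)
    moreover have "\<epsilon>\<^sup>2 / (2 * \<delta>) + \<epsilon>\<^sup>2 / (2 * \<delta>) = \<epsilon>\<^sup>2 / \<delta>" by (simp add: field_simps)
    ultimately show ?thesis by linarith
  qed
  show thesis
  \<comment> \<open>The two signs of \<theta> bound I from above and from below.\<close>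
  proof (rule that[of "A (\<epsilon> / \<delta>) \<union> A (- \<epsilon> / \<delta>)"])
    have "prob (A (\<epsilon> / \<delta>) \<union> A (- \<epsilon> / \<delta>)) \<le> prob (A (\<epsilon> / \<delta>)) + prob (A (- \<epsilon> / \<delta>))"
      by (rule measure_Un_le) auto
    then show "prob (A (\<epsilon> / \<delta>) \<union> A (- \<epsilon> / \<delta>)) \<le> 2 * exp (- \<epsilon>\<^sup>2 / (2 * \<delta>))"
      using P[of "\<epsilon> / \<delta>"] P[of "- \<epsilon> / \<delta>"] by simp
  next
    fix w assume w: "w \<in> space M - (A (\<epsilon> / \<delta>) \<union> A (- \<epsilon> / \<delta>))"
      and "sq_int t (\<lambda>s. G s w) \<le> ennreal \<delta>"
    then have q: "Q w \<le> \<delta>" using Q d by simp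
    have "\<epsilon> / \<delta> * I w \<le> \<epsilon>\<^sup>2 / \<delta>" "- \<epsilon> / \<delta> * I w \<le> \<epsilon>\<^sup>2 / \<delta>"
      by (rule *; use w q e d in simp)+
    then have "\<epsilon> * I w \<le> \<epsilon> * \<epsilon>" "\<epsilon> * (- I w) \<le> \<epsilon> * \<epsilon>"
      using d by (simp_all add: field_simps power2_eq_square)
    then show "\<bar>I w\<bar> \<le> \<epsilon>" using e by (simp only: mult_le_cancel_left_pos)
  qed auto
qed

end


section \<open>The Ito integral\<close>

lemma nn_integral_square_add:
  fixes f g :: "real \<Rightarrow> real" and c :: real
  assumes [measurable]: "f \<in> borel_measurable borel" "g \<in> borel_measurable borel"
  shows "sq_int t (\<lambda>s. c * f s + g s) \<le> ennreal (2 * c\<^sup>2) * sq_int t f + 2 * sq_int t g"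
proof -
  have "sq_int t (\<lambda>s. c * f s + g s) \<le> (\<integral>\<^sup>+s. ennreal (2 * c\<^sup>2) * (ennreal ((f s)\<^sup>2) * indicator {0..t} s)
      + 2 * (ennreal ((g s)\<^sup>2) * indicator {0..t} s) \<partial>lborel)"
  proof (rule nn_integral_mono)
    fix s
    have "(c * f s + g s)\<^sup>2 \<le> 2 * c\<^sup>2 * (f s)\<^sup>2 + 2 * (g s)\<^sup>2"
      using zero_le_power2[of "c * f s - g s"] by (simp add: power2_eq_square algebra_simps)
    then have "ennreal ((c * f s + g s)\<^sup>2) \<le> ennreal (2 * c\<^sup>2 * (f s)\<^sup>2 + 2 * (g s)\<^sup>2)"
      by (rule ennreal_leI)
    also have "\<dots> = ennreal (2 * c\<^sup>2) * ennreal ((f s)\<^sup>2) + 2 * ennreal ((g s)\<^sup>2)"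
      by (simp add: ennreal_mult)
    finally show "ennreal ((c * f s + g s)\<^sup>2) * indicator {0..t} s
      \<le> ennreal (2 * c\<^sup>2) * (ennreal ((f s)\<^sup>2) * indicator {0..t} s) + 2 * (ennreal ((g s)\<^sup>2) * indicator {0..t} s)"
      by (auto simp: indicator_def)
  qed
  also have "\<dots> = ennreal (2 * c\<^sup>2) * sq_int t f + 2 * sq_int t g"
    by (simp add: nn_integral_add nn_integral_cmult)
  finally show ?thesis .
qed

text \<open>The same \<epsilon> bounds the exceptional probability and the deviation, in the manner
  of the Ky Fan metric; for all \<epsilon> together this is convergence to 0 in probability.\<close>

abbreviation (in prob_space) small_in_prob :: "(nat \<Rightarrow> 'a \<Rightarrow> real) \<Rightarrow> real \<Rightarrow> bool" where
  "small_in_prob f \<epsilon> \<equiv> \<forall>\<^sub>F k in sequentially. \<exists>B\<in>events. prob B \<le> \<epsilon> \<and> (\<forall>w\<in>space M - B. \<bar>f k w\<bar> \<le> \<epsilon>)"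

lemma (in prob_space) tendsto_prob_ennreal:
  fixes f :: "nat \<Rightarrow> 'a \<Rightarrow> ennreal"
  assumes [measurable]: "\<And>k. f k \<in> borel_measurable M"
    and lim: "\<And>w. w \<in> space M \<Longrightarrow> (\<lambda>k. f k w) \<longlonglongrightarrow> 0" and d: "0 < \<delta>"
  shows "(\<lambda>k. prob {w\<in>space M. \<delta> < f k w}) \<longlonglongrightarrow> 0"
proof -
  have "(\<lambda>k. (\<integral>w. indicator {w\<in>space M. \<delta> < f k w} w \<partial>M) :: real) \<longlonglongrightarrow> (\<integral>w. 0 \<partial>M)"
  proof (rule integral_dominated_convergence[where w="\<lambda>_. 1"])
    show "AE w in M. (\<lambda>k. indicator {w\<in>space M. \<delta> < f k w} w :: real) \<longlonglongrightarrow> 0"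
    proof (rule AE_I2)
      fix w assume "w \<in> space M"
      then have "\<forall>\<^sub>F k in sequentially. f k w < \<delta>"
        using lim d by (intro order_tendstoD(2)) auto
      then have "\<forall>\<^sub>F k in sequentially. indicator {w\<in>space M. \<delta> < f k w} w = (0::real)"
        by eventually_elim (auto simp: indicator_def)
      then show "(\<lambda>k. indicator {w\<in>space M. \<delta> < f k w} w :: real) \<longlonglongrightarrow> 0"
        by (rule tendsto_eventually)
    qed
  qed (auto simp: indicator_def)
  then show ?thesis by simp
qed

context brownian
begin

text \<open>\<open>Z\<close> is the Ito integral of \<open>H\<close> over \<open>[0,t]\<close>. Exceptional events replace convergence in
  probability, so that no measurability of the quantities involved has to be carried along.\<close>

definition itl :: "real \<Rightarrow> (real \<Rightarrow> 'w \<Rightarrow> real) \<Rightarrow> ('w \<Rightarrow> real) \<Rightarrow> bool" where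
  "itl t H Z \<longleftrightarrow> (\<forall>w\<in>space M. (\<lambda>s. H s w) \<in> borel_measurable borel) \<and>
    (\<forall>\<epsilon>>0. \<exists>G I A. elem t G I \<and> A \<in> sets M \<and> prob A \<le> \<epsilon> \<and>
      (\<forall>w\<in>space M - A. sq_int t (\<lambda>s. G s w - H s w) \<le> ennreal \<epsilon> \<and>
        \<bar>I w - Z w\<bar> \<le> \<epsilon>))"

lemma itlE:
  assumes "itl t H Z" and "\<epsilon> > 0"
  obtains G I A where "elem t G I" "A \<in> sets M" "prob A \<le> \<epsilon>"
    "\<And>w. w \<in> space M - A \<Longrightarrow> sq_int t (\<lambda>s. G s w - H s w) \<le> ennreal \<epsilon>"
    "\<And>w. w \<in> space M - A \<Longrightarrow> \<bar>I w - Z w\<bar> \<le> \<epsilon>"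
  using assms unfolding itl_def by blast

lemma itl_measurable: "itl t H Z \<Longrightarrow> w \<in> space M \<Longrightarrow> (\<lambda>s. H s w) \<in> borel_measurable borel"
  by (auto simp: itl_def)

lemma itl_elem:
  assumes "elem t G I"
  shows "itl t G I"
  unfolding itl_def using assms elem_measurable_time[OF assms]
  by (auto intro!: exI[of _ G] exI[of _ I] exI[of _ "{}"])

lemma itl_linear:
  assumes 1: "itl t H Z" and 2: "itl t H' Z'"
  shows "itl t (\<lambda>s w. c * H s w + H' s w) (\<lambda>w. c * Z w + Z' w)"
  unfolding itl_def
proof (intro conjI allI impI ballI)
  show "w \<in> space M \<Longrightarrow> (\<lambda>s. c * H s w + H' s w) \<in> borel_measurable borel" for w
    using itl_measurable[OF 1] itl_measurable[OF 2] by auto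
  fix \<epsilon> :: real assume \<epsilon>: "\<epsilon> > 0"
  \<comment> \<open>One e must serve three estimates: 2 c^2 e + 2 e for the integrands, |c| e + e
    for the integrals and 2 e for the exceptional events, all at most \<epsilon>.\<close>
  define e where "e = \<epsilon> / (2 * (1 + c\<^sup>2))"
  have pos: "1 + c\<^sup>2 > 0" by (simp add: add_pos_nonneg)
  then have e: "e > 0" and "\<epsilon> = 2 * (1 + c\<^sup>2) * e"
    using \<epsilon> by (simp_all add: e_def)
  then have e\<epsilon>: "2 * c\<^sup>2 * e + 2 * e = \<epsilon>" by (simp add: algebra_simps)
  have "\<bar>c\<bar> \<le> 1 + c\<^sup>2"
    using zero_le_power2[of "\<bar>c\<bar> - 1"] zero_le_power2[of c] by (simp add: power2_diff)
  then have "\<bar>c\<bar> * e \<le> (1 + c\<^sup>2) * e" using e by (intro mult_right_mono) auto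
  moreover have "0 \<le> c\<^sup>2 * e" using e by simp
  ultimately have ce: "\<bar>c\<bar> * e + e \<le> \<epsilon>" "2 * e \<le> \<epsilon>" using e\<epsilon> by (auto simp: distrib_right)
  from itlE[OF 1 e] obtain G I A where A: "elem t G I" "A \<in> sets M" "prob A \<le> e"
    "\<And>w. w \<in> space M - A \<Longrightarrow> sq_int t (\<lambda>s. G s w - H s w) \<le> ennreal e"
    "\<And>w. w \<in> space M - A \<Longrightarrow> \<bar>I w - Z w\<bar> \<le> e" by blast
  from itlE[OF 2 e] obtain G' I' A' where A': "elem t G' I'" "A' \<in> sets M" "prob A' \<le> e"
    "\<And>w. w \<in> space M - A' \<Longrightarrow> sq_int t (\<lambda>s. G' s w - H' s w) \<le> ennreal e"
    "\<And>w. w \<in> space M - A' \<Longrightarrow> \<bar>I' w - Z' w\<bar> \<le> e" by blast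
  show "\<exists>G I A. elem t G I \<and> A \<in> sets M \<and> prob A \<le> \<epsilon> \<and>
      (\<forall>w\<in>space M - A. sq_int t (\<lambda>s. G s w - (c * H s w + H' s w)) \<le> ennreal \<epsilon> \<and>
        \<bar>I w - (c * Z w + Z' w)\<bar> \<le> \<epsilon>)"
  proof (intro exI conjI ballI)
    show "elem t (\<lambda>s w. c * G s w + G' s w) (\<lambda>w. c * I w + I' w)"
      using A(1) A'(1) by (intro elem_plus elem_scale)
    show "A \<union> A' \<in> sets M" using A A' by auto
    have "prob (A \<union> A') \<le> prob A + prob A'" using A A' by (intro measure_Un_le)
    then show "prob (A \<union> A') \<le> \<epsilon>" using A A' ce by linarith
    fix w assume w: "w \<in> space M - (A \<union> A')"
    have m: "(\<lambda>s. G s w - H s w) \<in> borel_measurable borel" "(\<lambda>s. G' s w - H' s w) \<in> borel_measurable borel"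
      using w itl_measurable[OF 1] itl_measurable[OF 2] elem_measurable_time[OF A(1)] elem_measurable_time[OF A'(1)]
      by auto
    have "sq_int t (\<lambda>s. c * G s w + G' s w - (c * H s w + H' s w))
        = sq_int t (\<lambda>s. c * (G s w - H s w) + (G' s w - H' s w))"
      by (simp add: algebra_simps)
    also have "\<dots> \<le> ennreal (2 * c\<^sup>2) * sq_int t (\<lambda>s. G s w - H s w) + 2 * sq_int t (\<lambda>s. G' s w - H' s w)"
      by (rule nn_integral_square_add[OF m])
    also have "\<dots> \<le> ennreal (2 * c\<^sup>2) * ennreal e + ennreal 2 * ennreal e"
      using A(4)[of w] A'(4)[of w] w by (auto intro!: add_mono mult_left_mono)
    also have "\<dots> = ennreal \<epsilon>"
      using e by (simp only: ennreal_mult[symmetric] ennreal_plus[symmetric] e\<epsilon>) (simp add: e\<epsilon> ennreal_mult[symmetric] ennreal_plus[symmetric] del: ennreal_plus)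
    finally show "sq_int t (\<lambda>s. c * G s w + G' s w - (c * H s w + H' s w)) \<le> ennreal \<epsilon>" .
    have "\<bar>c * I w + I' w - (c * Z w + Z' w)\<bar> = \<bar>c * (I w - Z w) + (I' w - Z' w)\<bar>"
      by (simp add: algebra_simps)
    also have "\<dots> \<le> \<bar>c\<bar> * \<bar>I w - Z w\<bar> + \<bar>I' w - Z' w\<bar>"
      by (metis abs_mult abs_triangle_ineq)
    also have "\<dots> \<le> \<bar>c\<bar> * e + e"
      using A(5)[of w] A'(5)[of w] w by (intro add_mono mult_left_mono) auto
    finally show "\<bar>c * I w + I' w - (c * Z w + Z' w)\<bar> \<le> \<epsilon>" using ce by linarith
  qed
qed

lemma itl_scale: "itl t H Z \<Longrightarrow> itl t (\<lambda>s w. c * H s w) (\<lambda>w. c * Z w)"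
  using itl_linear[OF _ itl_elem[OF elem_zero], of t H Z c] by simp

lemma itl_minus:
  assumes "itl t H Z" and "itl t H' Z'"
  shows "itl t (\<lambda>s w. H s w - H' s w) (\<lambda>w. Z w - Z' w)"
  using itl_linear[OF assms(2,1), of "- 1"] by simp

lemma itl_sum:
  assumes "\<And>i. i < n \<Longrightarrow> itl t (H i) (Z i)"
  shows "itl t (\<lambda>s w. \<Sum>i<n. H i s w) (\<lambda>w. \<Sum>i<(n::nat). Z i w)"
  using assms
proof (induction n)
  case 0
  then show ?case using itl_elem[OF elem_zero] by simp
next
  case (Suc n)
  then show ?case using itl_linear[of t "H n" "Z n" "\<lambda>s w. \<Sum>i<n. H i s w" "\<lambda>w. \<Sum>i<n. Z i w" 1] by (simp add: add.commute)
qed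

text \<open>Passes from the defining approximation on [0,r] to a common horizon t, on which
  integrals up to different times can be combined linearly. The simple processes are cut at r, and
  the null set where the two versions differ joins the exceptional event.\<close>

lemma itl_of_ito:
  assumes ito: "has_ito_integral M F W H r Z0" and ae: "AE w in M. Z0 w = Z w"
    and r: "0 \<le> r" "r \<le> t"
    and meas: "\<And>w. w \<in> space M \<Longrightarrow> (\<lambda>s. H s w * indicator {0<..r} s) \<in> borel_measurable borel"
  shows "itl t (\<lambda>s w. H s w * indicator {0<..r} s) Z"
  unfolding itl_def
proof (intro conjI allI impI ballI)
  fix \<epsilon> :: real assume e: "\<epsilon> > 0"
  from ito obtain n \<tau> \<xi> where sp: "\<And>k. simple_process F (n k) (\<tau> k) (\<xi> k)"
    and z1: "to_zero_in_prob M (\<lambda>k w.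
          \<integral>\<^sup>+ s\<in>{0..r}. ennreal ((simple_val (n k) (\<tau> k) (\<xi> k) s w - H s w)\<^sup>2) \<partial>lborel)"
    and z2: "to_zero_in_prob M (\<lambda>k w. ennreal \<bar>simple_integral W (n k) (\<tau> k) (\<xi> k) r w - Z0 w\<bar>)"
    unfolding has_ito_integral_def by blast
  define U where "U = (\<lambda>k w. \<integral>\<^sup>+ s\<in>{0..r}. ennreal ((simple_val (n k) (\<tau> k) (\<xi> k) s w - H s w)\<^sup>2) \<partial>lborel)"
  define V where "V = (\<lambda>k w. ennreal \<bar>simple_integral W (n k) (\<tau> k) (\<xi> k) r w - Z0 w\<bar>)"
  have [measurable]: "U k \<in> borel_measurable M" "V k \<in> borel_measurable M" for k
    using z1 z2 by (auto simp: to_zero_in_prob_def U_def V_def)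
  have "(\<lambda>k. prob {w\<in>space M. ennreal \<epsilon> < U k w}) \<longlonglongrightarrow> 0" "(\<lambda>k. prob {w\<in>space M. ennreal \<epsilon> < V k w}) \<longlonglongrightarrow> 0"
    using z1 z2 e by (auto simp: to_zero_in_prob_def U_def V_def)
  then have "\<forall>\<^sub>F k in sequentially. prob {w\<in>space M. ennreal \<epsilon> < U k w} < \<epsilon> / 2"
    "\<forall>\<^sub>F k in sequentially. prob {w\<in>space M. ennreal \<epsilon> < V k w} < \<epsilon> / 2"
    using e order_tendstoD(2)[of _ 0 sequentially "\<epsilon> / 2"] by simp_all
  then have "\<forall>\<^sub>F k in sequentially. prob {w\<in>space M. ennreal \<epsilon> < U k w} < \<epsilon> / 2 \<and>
      prob {w\<in>space M. ennreal \<epsilon> < V k w} < \<epsilon> / 2"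
    by eventually_elim simp
  then obtain k where k: "prob {w\<in>space M. ennreal \<epsilon> < U k w} < \<epsilon> / 2"
      "prob {w\<in>space M. ennreal \<epsilon> < V k w} < \<epsilon> / 2"
    by (auto dest: eventually_happens)
  from AE_E[OF ae] obtain N where N: "{w\<in>space M. Z0 w \<noteq> Z w} \<subseteq> N" "emeasure M N = 0" "N \<in> sets M" by blast
  define A where "A = {w\<in>space M. ennreal \<epsilon> < U k w} \<union> {w\<in>space M. ennreal \<epsilon> < V k w} \<union> N"
  have \<tau>: "0 \<le> \<tau> k 0" "\<And>i. i < n k \<Longrightarrow> \<tau> k i < \<tau> k (Suc i)"
    and \<xi>: "\<And>i. i < n k \<Longrightarrow> \<xi> k i \<in> borel_measurable (F (\<tau> k i))"
    using sp[of k] by (auto simp: simple_process_def)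
  have pos: "i \<le> n k \<Longrightarrow> 0 \<le> \<tau> k i" for i
    using grid_mono[of "n k" "\<tau> k" 0 i] \<tau> by auto
  \<comment> \<open>Cells beginning at or after r drop out, since \<open>elem\<close> admits only
    intervals with ordered ends; a cell containing r is cut there.\<close>
  let ?g = "\<lambda>i s w. if \<tau> k i < r then \<xi> k i w * indicator {\<tau> k i<..min (\<tau> k (Suc i)) r} s else 0"
  let ?i = "\<lambda>i w. if \<tau> k i < r then \<xi> k i w * (W (min (\<tau> k (Suc i)) r) w - W (\<tau> k i) w) else 0"
  have el: "elem t (\<lambda>s w. \<Sum>i<n k. ?g i s w) (\<lambda>w. \<Sum>i<n k. ?i i w)"
  proof (rule elem_sum)
    fix i assume i: "i < n k"
    show "elem t (?g i) (?i i)"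
    proof (cases "\<tau> k i < r")
      case True
      then show ?thesis
        using elem_single[of "\<tau> k i" "min (\<tau> k (Suc i)) r" t "\<xi> k i"] \<xi>[OF i] \<tau>(2)[OF i] pos[of i] i r by auto
    qed (use elem_zero in simp)
  qed
  have G: "(\<Sum>i<n k. ?g i s w) = simple_val (n k) (\<tau> k) (\<xi> k) s w * indicator {0<..r} s" for s w
    unfolding simple_val_def sum_distrib_right
  proof (intro sum.cong refl)
    fix i assume "i \<in> {..<n k}"
    then show "?g i s w = \<xi> k i w * indicator {\<tau> k i<..\<tau> k (Suc i)} s * indicator {0<..r} s"
      using pos[of i] by (auto simp: indicator_def)
  qed
  have I: "(\<Sum>i<n k. ?i i w) = simple_integral W (n k) (\<tau> k) (\<xi> k) r w" for w
    unfolding simple_integral_def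
  proof (intro sum.cong refl)
    fix i assume "i \<in> {..<n k}"
    then have "\<tau> k i < \<tau> k (Suc i)" using \<tau> by auto
    then show "?i i w = \<xi> k i w * (W (min (\<tau> k (Suc i)) r) w - W (min (\<tau> k i) r) w)"
      by (auto simp: min_def)
  qed
  show "\<exists>G I A. elem t G I \<and> A \<in> sets M \<and> prob A \<le> \<epsilon> \<and>
      (\<forall>w\<in>space M - A. sq_int t (\<lambda>s. G s w - H s w * indicator {0<..r} s) \<le> ennreal \<epsilon> \<and>
        \<bar>I w - Z w\<bar> \<le> \<epsilon>)"
  proof (intro exI conjI ballI)
    show "elem t (\<lambda>s w. \<Sum>i<n k. ?g i s w) (\<lambda>w. \<Sum>i<n k. ?i i w)" by (rule el)
    show "A \<in> sets M" unfolding A_def using N by measurable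
    have "prob A \<le> prob {w\<in>space M. ennreal \<epsilon> < U k w} + prob {w\<in>space M. ennreal \<epsilon> < V k w} + prob N"
      unfolding A_def using N by (intro order_trans[OF measure_Un_le] add_right_mono measure_Un_le) auto
    then show "prob A \<le> \<epsilon>" using k N by (simp add: measure_def)
    fix w assume w: "w \<in> space M - A"
    have "sq_int t (\<lambda>s. (\<Sum>i<n k. ?g i s w) - H s w * indicator {0<..r} s) \<le> U k w"
      unfolding U_def G by (intro nn_integral_mono) (auto simp: indicator_def)
    also have "\<dots> \<le> ennreal \<epsilon>" using w by (auto simp: A_def)
    finally show "sq_int t (\<lambda>s. (\<Sum>i<n k. ?g i s w) - H s w * indicator {0<..r} s) \<le> ennreal \<epsilon>" .
    have "V k w \<le> ennreal \<epsilon>" "Z0 w = Z w" using w N by (auto simp: A_def)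
    then show "\<bar>(\<Sum>i<n k. ?i i w) - Z w\<bar> \<le> \<epsilon>" unfolding I V_def using e by simp
  qed
qed (use meas in auto)

text \<open>The exponential inequality passes from an approximating simple process to the limit: an
  integrand small off A gives an integral small off a slightly larger event.\<close>

lemma itl_bound:
  assumes it: "itl t H Z" and t: "0 \<le> t" and e: "\<epsilon> > 0" and d: "\<delta> > 0"
    and A: "A \<in> sets M" "\<And>w. w \<in> space M - A \<Longrightarrow> sq_int t (\<lambda>s. H s w) \<le> ennreal \<delta>"
  obtains B where "B \<in> sets M" "prob B \<le> prob A + \<delta> + 2 * exp (- \<epsilon>\<^sup>2 / (8 * \<delta>))"
    "\<And>w. w \<in> space M - B \<Longrightarrow> \<bar>Z w\<bar> \<le> \<epsilon> + \<delta>"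
proof -
  from itlE[OF it d] obtain G I A' where A': "elem t G I" "A' \<in> sets M" "prob A' \<le> \<delta>"
    "\<And>w. w \<in> space M - A' \<Longrightarrow> sq_int t (\<lambda>s. G s w - H s w) \<le> ennreal \<delta>"
    "\<And>w. w \<in> space M - A' \<Longrightarrow> \<bar>I w - Z w\<bar> \<le> \<delta>" by blast
  \<comment> \<open>\<open>G\<^sup>2\<close> is at most
    \<open>2 * (G - H)\<^sup>2 + 2 * H\<^sup>2\<close>, and both time integrals are at most
    \<delta>; hence 4 \<delta> here and 8 \<delta> in the exponent.\<close>
  have d4: "0 < 4 * \<delta>" using d by simp
  from elem_exp_inequality[OF A'(1) t e d4] obtain C where C: "C \<in> sets M" "prob C \<le> 2 * exp (- \<epsilon>\<^sup>2 / (8 * \<delta>))"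
    "\<And>w. w \<in> space M - C \<Longrightarrow> sq_int t (\<lambda>s. G s w) \<le> ennreal (4 * \<delta>) \<Longrightarrow> \<bar>I w\<bar> \<le> \<epsilon>"
    by auto
  show thesis
  proof (rule that[of "A \<union> A' \<union> C"])
    show "A \<union> A' \<union> C \<in> sets M" using A A' C by auto
    have "prob (A \<union> A' \<union> C) \<le> prob A + prob A' + prob C"
      using A A' C by (intro order_trans[OF measure_Un_le] add_right_mono measure_Un_le) auto
    then show "prob (A \<union> A' \<union> C) \<le> prob A + \<delta> + 2 * exp (- \<epsilon>\<^sup>2 / (8 * \<delta>))" using A' C by simp
    fix w assume w: "w \<in> space M - (A \<union> A' \<union> C)"
    then have m: "(\<lambda>s. G s w - H s w) \<in> borel_measurable borel" "(\<lambda>s. H s w) \<in> borel_measurable borel"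
      using itl_measurable[OF it] elem_measurable_time[OF A'(1)] by auto
    have "sq_int t (\<lambda>s. G s w) \<le> 2 * sq_int t (\<lambda>s. G s w - H s w) + 2 * sq_int t (\<lambda>s. H s w)"
      using nn_integral_square_add[OF m, where c=1 and t=t] by simp
    also have "\<dots> \<le> ennreal 2 * ennreal \<delta> + ennreal 2 * ennreal \<delta>"
      using A(2)[of w] A'(4)[of w] w by (auto intro!: add_mono mult_left_mono)
    also have "\<dots> = ennreal (4 * \<delta>)"
      using d by (simp only: ennreal_mult[symmetric] ennreal_plus[symmetric]) simp
    finally have "\<bar>I w\<bar> \<le> \<epsilon>" using C(3) w by auto
    then show "\<bar>Z w\<bar> \<le> \<epsilon> + \<delta>" using A'(5)[of w] w by auto
  qed
qed

lemma itl_tendsto_0: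
  assumes it: "\<And>k. itl t (H k) (Z k)" and t: "0 \<le> t"
    and [measurable]: "\<And>k. (\<lambda>w. sq_int t (\<lambda>s. H k s w)) \<in> borel_measurable M"
    and lim: "\<And>w. w \<in> space M \<Longrightarrow> (\<lambda>k. sq_int t (\<lambda>s. H k s w)) \<longlonglongrightarrow> 0"
    and e: "\<epsilon> > 0"
  shows "small_in_prob Z \<epsilon>"
proof -
  \<comment> \<open>Order of choice: first \<delta>, making the exponential error small for the
    given \<epsilon>, and only then k, making the event \<open>A k\<close> unlikely.\<close>
  have "((\<lambda>\<delta>. \<delta> + 2 * exp (- (\<epsilon> / 2)\<^sup>2 / (8 * \<delta>))) \<longlongrightarrow> 0) (at_right 0)"
    using e by real_asymp
  then have "\<forall>\<^sub>F \<delta> in at_right 0. \<delta> + 2 * exp (- (\<epsilon> / 2)\<^sup>2 / (8 * \<delta>)) < \<epsilon> / 2"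
    using e by (intro order_tendstoD(2)) auto
  moreover have "\<forall>\<^sub>F \<delta> in at_right 0. 0 < \<delta> \<and> \<delta> < \<epsilon> / 2"
    using e by (auto simp: eventually_at_right[of 0 "\<epsilon>/2"] intro!: exI[of _ "\<epsilon> / 2"])
  ultimately have "\<forall>\<^sub>F \<delta> in at_right 0. \<delta> + 2 * exp (- (\<epsilon> / 2)\<^sup>2 / (8 * \<delta>)) < \<epsilon> / 2 \<and> 0 < \<delta> \<and> \<delta> < \<epsilon> / 2"
    by eventually_elim simp
  then obtain \<delta> where d: "\<delta> + 2 * exp (- (\<epsilon> / 2)\<^sup>2 / (8 * \<delta>)) < \<epsilon> / 2" "0 < \<delta>" "\<delta> < \<epsilon> / 2"
    by (auto dest: eventually_happens)
  define A where "A k = {w\<in>space M. ennreal \<delta> < sq_int t (\<lambda>s. H k s w)}" for k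
  have [measurable]: "A k \<in> sets M" for k unfolding A_def by measurable
  have "(\<lambda>k. prob (A k)) \<longlonglongrightarrow> 0"
    unfolding A_def by (rule tendsto_prob_ennreal) (use lim d in auto)
  then have "\<forall>\<^sub>F k in sequentially. prob (A k) < \<epsilon> / 2"
    using e by (intro order_tendstoD(2)) auto
  then show ?thesis
  proof eventually_elim
    case (elim k)
    have "0 < \<epsilon> / 2" using e by simp
    have "w \<in> space M - A k \<Longrightarrow> sq_int t (\<lambda>s. H k s w) \<le> ennreal \<delta>" for w
      by (simp add: A_def not_less)
    from itl_bound[OF it[of k] t \<open>0 < \<epsilon> / 2\<close> d(2) _ this] obtain B where B: "B \<in> sets M"
      "prob B \<le> prob (A k) + \<delta> + 2 * exp (- (\<epsilon> / 2)\<^sup>2 / (8 * \<delta>))"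
      "\<And>w. w \<in> space M - B \<Longrightarrow> \<bar>Z k w\<bar> \<le> \<epsilon> / 2 + \<delta>"
      using \<open>A k \<in> sets M\<close> by blast
    have "\<bar>Z k w\<bar> \<le> \<epsilon>" if "w \<in> space M - B" for w
      using B(3)[OF that] d by linarith
    then show ?case using elim d B(1,2) by (intro bexI[of _ B] conjI ballI) auto
  qed
qed

end


section \<open>Uniform grids\<close>

text \<open>There are k + 1 cells, so the mesh is meaningful at k = 0 too.\<close>

definition upt_grid :: "real \<Rightarrow> nat \<Rightarrow> nat \<Rightarrow> real" where
  "upt_grid t k i = t * real i / real (Suc k)"

lemma upt_grid_0 [simp]: "upt_grid t k 0 = 0"
  by (simp add: upt_grid_def)

lemma upt_grid_last [simp]: "upt_grid t k (Suc k) = t"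
  by (simp add: upt_grid_def)

lemma upt_grid_step: "upt_grid t k (Suc i) - upt_grid t k i = t / real (Suc k)"
proof -
  have "t * real (Suc i) - t * real i = t" by (simp add: algebra_simps)
  then show ?thesis unfolding upt_grid_def diff_divide_distrib[symmetric] by simp
qed

lemma upt_grid_less: "0 < t \<Longrightarrow> upt_grid t k i < upt_grid t k (Suc i)"
  using upt_grid_step[of t k i] by (smt (verit) divide_pos_pos of_nat_0_less_iff zero_less_Suc)

lemma upt_grid_mono: "0 < t \<Longrightarrow> i \<le> j \<Longrightarrow> upt_grid t k i \<le> upt_grid t k j"
  by (auto simp: upt_grid_def intro!: divide_right_mono mult_left_mono)

lemma upt_grid_range: "0 < t \<Longrightarrow> i \<le> Suc k \<Longrightarrow> 0 \<le> upt_grid t k i \<and> upt_grid t k i \<le> t"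
  using upt_grid_mono[of t 0 i k] upt_grid_mono[of t i "Suc k" k] by simp

text \<open>Both ends of a cell are compared because summation by parts samples at right ends and
  the bracket at left ends.\<close>

lemma upt_grid_uniform:
  fixes g :: "real \<Rightarrow> real"
  assumes g: "continuous_on {0..t} g" and t: "0 < t" and e: "\<epsilon> > 0"
  shows "\<forall>\<^sub>F k in sequentially. \<forall>i\<le>k. \<forall>s\<in>{upt_grid t k i..upt_grid t k (Suc i)}.
    \<bar>g (upt_grid t k i) - g s\<bar> \<le> \<epsilon> \<and> \<bar>g (upt_grid t k (Suc i)) - g s\<bar> \<le> \<epsilon>"
proof -
  have "uniformly_continuous_on {0..t} g"
    using g by (rule compact_uniformly_continuous) simp
  from uniformly_continuous_onE[OF this e] obtain d where d: "d > 0"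
    "\<And>x x'. x \<in> {0..t} \<Longrightarrow> x' \<in> {0..t} \<Longrightarrow> dist x' x < d \<Longrightarrow> dist (g x') (g x) < \<epsilon>"
    by metis
  have "(\<lambda>k. t / real (Suc k)) \<longlonglongrightarrow> 0" by real_asymp
  then have "\<forall>\<^sub>F k in sequentially. t / real (Suc k) < d"
    using d(1) by (rule order_tendstoD(2))
  then show ?thesis
  proof eventually_elim
    case (elim k)
    show ?case
    proof (intro allI impI ballI)
      fix i s assume i: "i \<le> k" and s: "s \<in> {upt_grid t k i..upt_grid t k (Suc i)}"
      have r: "upt_grid t k i \<in> {0..t}" "upt_grid t k (Suc i) \<in> {0..t}"
        using upt_grid_range[of t i k] upt_grid_range[of t "Suc i" k] t i by auto
      then have "s \<in> {0..t}" using s by auto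
      moreover have "dist (upt_grid t k i) s < d" "dist (upt_grid t k (Suc i)) s < d"
        using s elim upt_grid_step[of t k i] by (auto simp: dist_real_def)
      ultimately show "\<bar>g (upt_grid t k i) - g s\<bar> \<le> \<epsilon> \<and> \<bar>g (upt_grid t k (Suc i)) - g s\<bar> \<le> \<epsilon>"
        using d(2)[of s "upt_grid t k i"] d(2)[of s "upt_grid t k (Suc i)"] r
        by (auto simp: dist_real_def)
    qed
  qed
qed

lemma integral_upt_grid:
  fixes h :: "real \<Rightarrow> real"
  assumes h: "continuous_on {0..t} h" and t: "0 < t" and n: "n \<le> Suc k"
  shows "(\<Sum>i<n. integral {upt_grid t k i..upt_grid t k (Suc i)} h) = integral {0..upt_grid t k n} h"
  using n
proof (induction n)
  case (Suc n)
  have r: "0 \<le> upt_grid t k n" "upt_grid t k n \<le> upt_grid t k (Suc n)" "upt_grid t k (Suc n) \<le> t"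
    using upt_grid_range[OF t, of n k] upt_grid_range[OF t, of "Suc n" k] upt_grid_mono[OF t, of n "Suc n" k] Suc.prems
    by auto
  have "h integrable_on {0..upt_grid t k (Suc n)}"
    using r by (intro integrable_continuous_interval continuous_on_subset[OF h]) auto
  from Henstock_Kurzweil_Integration.integral_combine[OF r(1,2) this]
  show ?case using Suc by simp
qed simp

text \<open>The values c k i may be any uniform approximation of g on the cells, with integrals of h
  as weights; this covers the sums behind both \<open>Sk_lim\<close> and
  \<open>Qk_lim\<close>.\<close>

lemma Riemann_sum_tendsto:
  fixes g h :: "real \<Rightarrow> real"
  assumes g: "continuous_on {0..t} g" and h: "continuous_on {0..t} h" and t: "0 < t"
    and c: "\<And>\<epsilon>. \<epsilon> > 0 \<Longrightarrow> \<forall>\<^sub>F k in sequentially.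
      \<forall>i\<le>k. \<forall>s\<in>{upt_grid t k i..upt_grid t k (Suc i)}. \<bar>c k i - g s\<bar> \<le> \<epsilon>"
  shows "(\<lambda>k. \<Sum>i<Suc k. c k i * integral {upt_grid t k i..upt_grid t k (Suc i)} h)
    \<longlonglongrightarrow> integral {0..t} (\<lambda>s. g s * h s)"
proof -
  have "bounded (h ` {0..t})" using h by (intro compact_imp_bounded compact_continuous_image) auto
  then obtain B where B: "B > 0" "\<And>s. s \<in> {0..t} \<Longrightarrow> \<bar>h s\<bar> \<le> B"
    by (auto simp: bounded_pos)
  have gh: "continuous_on {0..t} (\<lambda>s. g s * h s)" using g h by (intro continuous_intros)
  show ?thesis
    unfolding tendsto_iff
  proof (intro allI impI)
    fix e :: real assume e: "e > 0"
    \<comment> \<open>Makes the total error e' B t equal to e / 2.\<close>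
    define e' where "e' = e / (2 * B * t)"
    have e': "e' > 0" using e B t by (simp add: e'_def)
    from c[OF e'] show "\<forall>\<^sub>F k in sequentially. dist (\<Sum>i<Suc k. c k i * integral {upt_grid t k i..upt_grid t k (Suc i)} h)
       (integral {0..t} (\<lambda>s. g s * h s)) < e"
    proof eventually_elim
      case (elim k)
      let ?I = "\<lambda>i. {upt_grid t k i..upt_grid t k (Suc i)}"
      have sub: "?I i \<subseteq> {0..t}" if "i \<le> k" for i
        using upt_grid_range[OF t, of i k] upt_grid_range[OF t, of "Suc i" k] that by auto
      have piece: "\<bar>c k i * integral (?I i) h - integral (?I i) (\<lambda>s. g s * h s)\<bar> \<le> e' * B * (t / real (Suc k))"
        if i: "i \<le> k" for i
      proof -
        have hi: "h integrable_on ?I i" and ghi: "(\<lambda>s. g s * h s) integrable_on ?I i"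
          using sub[OF i] h gh by (auto intro!: integrable_continuous_interval intro: continuous_on_subset)
        have "c k i * integral (?I i) h - integral (?I i) (\<lambda>s. g s * h s)
          = integral (?I i) (\<lambda>s. c k i * h s - g s * h s)"
          using hi ghi by (subst Henstock_Kurzweil_Integration.integral_diff) (auto intro: integrable_on_mult_right)
        also have "norm \<dots> \<le> e' * B * (upt_grid t k (Suc i) - upt_grid t k i)"
        proof (rule integral_bound)
          show "upt_grid t k i \<le> upt_grid t k (Suc i)" using upt_grid_mono[OF t] by simp
          show "continuous_on (?I i) (\<lambda>s. c k i * h s - g s * h s)"
            by (intro continuous_on_diff continuous_on_mult_left continuous_on_subset[OF h sub[OF i]]
                continuous_on_subset[OF gh sub[OF i]])
          fix s assume s: "s \<in> ?I i"
          have "norm (c k i * h s - g s * h s) = \<bar>c k i - g s\<bar> * \<bar>h s\<bar>"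
            by (simp add: left_diff_distrib[symmetric] abs_mult)
          also have "\<dots> \<le> e' * B"
            using elim i s sub[OF i] B(2)[of s] e' by (intro mult_mono) auto
          finally show "norm (c k i * h s - g s * h s) \<le> e' * B" .
        qed
        finally show ?thesis by (simp add: upt_grid_step del: of_nat_Suc)
      qed
      have "(\<Sum>i<Suc k. integral (?I i) (\<lambda>s. g s * h s)) = integral {0..t} (\<lambda>s. g s * h s)"
        using integral_upt_grid[OF gh t, of "Suc k" k] by simp
      then have "dist (\<Sum>i<Suc k. c k i * integral (?I i) h) (integral {0..t} (\<lambda>s. g s * h s))
        = \<bar>\<Sum>i<Suc k. c k i * integral (?I i) h - integral (?I i) (\<lambda>s. g s * h s)\<bar>"
        by (simp add: dist_real_def sum_subtractf del: sum.lessThan_Suc)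
      also have "\<dots> \<le> (\<Sum>i<Suc k. \<bar>c k i * integral (?I i) h - integral (?I i) (\<lambda>s. g s * h s)\<bar>)"
        by (rule sum_abs)
      also have "\<dots> \<le> (\<Sum>i<Suc k. e' * B * (t / real (Suc k)))"
        by (intro sum_mono piece) auto
      also have "\<dots> = e' * B * t" by (simp del: of_nat_Suc sum.lessThan_Suc)
      also have "\<dots> < e" using e B t by (simp add: e'_def)
      finally show ?case .
    qed
  qed
qed

lemma (in prob_space) eventually_prob_le:
  fixes f :: "nat \<Rightarrow> 'a \<Rightarrow> real"
  assumes f: "\<And>k. f k \<in> borel_measurable M"
    and lim: "\<And>w. w \<in> space M \<Longrightarrow> (\<lambda>k. f k w) \<longlonglongrightarrow> g w" and e: "0 < \<epsilon>"
  shows "small_in_prob (\<lambda>k w. f k w - g w) \<epsilon>"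
proof -
  note [measurable] = f
  have [measurable]: "g \<in> borel_measurable M"
    using lim f by (rule borel_measurable_LIMSEQ_real)
  define A where "A k = {w\<in>space M. ennreal \<epsilon> < ennreal \<bar>f k w - g w\<bar>}" for k
  have [measurable]: "A k \<in> sets M" for k unfolding A_def by measurable
  have "(\<lambda>k. prob (A k)) \<longlonglongrightarrow> 0"
    unfolding A_def
  proof (rule tendsto_prob_ennreal)
    fix w assume "w \<in> space M"
    then have "(\<lambda>k. \<bar>f k w - g w\<bar>) \<longlonglongrightarrow> 0"
      using LIM_zero[OF lim] by (intro tendsto_rabs_zero)
    then show "(\<lambda>k. ennreal \<bar>f k w - g w\<bar>) \<longlonglongrightarrow> 0"
      by (metis ennreal_0 tendsto_ennrealI)
  qed (use e in auto)
  then have "\<forall>\<^sub>F k in sequentially. prob (A k) < \<epsilon>"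
    using e by (rule order_tendstoD(2))
  then show ?thesis
  proof eventually_elim
    case (elim k)
    then show ?case using e
      by (intro bexI[of _ "A k"]) (auto simp: A_def ennreal_less_iff not_less)
  qed
qed

lemma (in prob_space) eventually_prob_add:
  assumes 1: "\<And>\<epsilon>. 0 < \<epsilon> \<Longrightarrow> small_in_prob f \<epsilon>"
    and 2: "\<And>\<epsilon>. 0 < \<epsilon> \<Longrightarrow> small_in_prob g \<epsilon>"
    and e: "0 < \<epsilon>"
  shows "small_in_prob (\<lambda>k w. f k w + g k w :: real) \<epsilon>"
proof -
  have e2: "0 < \<epsilon> / 2" using e by simp
  from 1[OF e2] 2[OF e2] show ?thesis
  proof eventually_elim
    case (elim k)
    then obtain B B' where B: "B \<in> sets M" "prob B \<le> \<epsilon> / 2" "\<And>w. w \<in> space M - B \<Longrightarrow> \<bar>f k w\<bar> \<le> \<epsilon> / 2"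
      and B': "B' \<in> sets M" "prob B' \<le> \<epsilon> / 2" "\<And>w. w \<in> space M - B' \<Longrightarrow> \<bar>g k w\<bar> \<le> \<epsilon> / 2" by blast
    show ?case
    proof (intro bexI[of _ "B \<union> B'"] conjI ballI)
      show "prob (B \<union> B') \<le> \<epsilon>" using measure_Un_le[OF B(1) B'(1)] B B' by simp
      show "\<bar>f k w + g k w\<bar> \<le> \<epsilon>" if "w \<in> space M - (B \<union> B')" for w
        using B(3)[of w] B'(3)[of w] that abs_triangle_ineq[of "f k w" "g k w"] by auto
    qed (use B B' in auto)
  qed
qed


section \<open>The CIR process along solutions of the Riccati equation\<close>

locale cir = brownian M F W for M :: "'w measure" and F W +
  fixes a b \<sigma> y :: real and Y :: "real \<Rightarrow> 'w \<Rightarrow> real"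
  assumes process: "cir_process M F W a b \<sigma> y Y"
begin

text \<open>Freezing the path at negative times makes it continuous on the whole line, which the
  proof of joint measurability exploits.\<close>

definition X :: "real \<Rightarrow> 'w \<Rightarrow> real" where
  "X s w = Y (max 0 s) w"

lemma X_eq: "0 \<le> s \<Longrightarrow> X s = Y s"
  by (simp add: X_def fun_eq_iff)

lemma X_nonneg: "w \<in> space M \<Longrightarrow> 0 \<le> X s w"
  using process by (auto simp: cir_process_def X_def)

lemma X_adapted: "0 \<le> s \<Longrightarrow> X s \<in> borel_measurable (F s)"
  using process by (auto simp: cir_process_def X_eq)

lemma X_measurable_space [measurable]: "X s \<in> borel_measurable M"
proof -
  have "X s = X (max 0 s)" by (simp add: X_def fun_eq_iff)
  then show ?thesis using F_measurable[OF X_adapted[of "max 0 s"]] by simp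
qed

lemma X_continuous: "w \<in> space M \<Longrightarrow> continuous_on S (\<lambda>s. X s w)"
proof -
  assume "w \<in> space M"
  then have "continuous_on {0..} (\<lambda>t. Y t w)" using process by (auto simp: cir_process_def)
  then have "continuous_on S (\<lambda>s. Y (max 0 s) w)"
    by (rule continuous_on_compose2) (auto intro!: continuous_intros)
  then show ?thesis by (simp add: X_def)
qed

text \<open>Continuity in time makes X the limit of processes sampled at multiples of 1 / (n + 1);
  each of these uses countably many sampling times, at all of which X is measurable.\<close>

lemma X_measurable_pair: "(\<lambda>p. X (fst p) (snd p)) \<in> borel_measurable (borel \<Otimes>\<^sub>M M)"
proof (rule borel_measurable_LIMSEQ_real)
  fix n :: nat
  have "(\<lambda>p. X (real_of_int i / real (Suc n)) (snd p)) \<in> borel_measurable (borel \<Otimes>\<^sub>M M)" for i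
    by measurable
  moreover have "(\<lambda>p::real \<times> 'w. \<lfloor>fst p * real (Suc n)\<rfloor>) \<in> (borel \<Otimes>\<^sub>M M) \<rightarrow>\<^sub>M count_space UNIV"
    by measurable
  ultimately show "(\<lambda>p. X (real_of_int \<lfloor>fst p * real (Suc n)\<rfloor> / real (Suc n)) (snd p))
    \<in> borel_measurable (borel \<Otimes>\<^sub>M M)"
    by (rule measurable_compose_countable)
next
  fix p :: "real \<times> 'w" assume "p \<in> space (borel \<Otimes>\<^sub>M M)"
  then have "snd p \<in> space M" by (auto simp: space_pair_measure)
  then have "isCont (\<lambda>s. X s (snd p)) (fst p)"
    using X_continuous[of "snd p" UNIV] by (auto simp: continuous_on_eq_continuous_at)
  moreover have "(\<lambda>n. real_of_int \<lfloor>fst p * real (Suc n)\<rfloor> / real (Suc n)) \<longlonglongrightarrow> fst p"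
    by real_asymp
  ultimately show "(\<lambda>n. X (real_of_int \<lfloor>fst p * real (Suc n)\<rfloor> / real (Suc n)) (snd p)) \<longlonglongrightarrow> X (fst p) (snd p)"
    by (rule isCont_tendsto_compose)
qed

lemma X_measurable [measurable (raw)]:
  assumes "f \<in> N \<rightarrow>\<^sub>M borel" and "g \<in> N \<rightarrow>\<^sub>M M"
  shows "(\<lambda>x. X (f x) (g x)) \<in> borel_measurable N"
  using measurable_compose[OF measurable_Pair[OF assms] X_measurable_pair] by simp

definition drift_int :: "real \<Rightarrow> 'w \<Rightarrow> real" where
  "drift_int s w = integral {0..s} (\<lambda>r. a - b * X r w)"

text \<open>A pathwise version of the stochastic integral \<open>\<integral> \<sigma> \<surd>Y dW\<close> over \<open>[0,s]\<close>.\<close>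

definition Zt :: "real \<Rightarrow> 'w \<Rightarrow> real" where
  "Zt s w = X s w - y - drift_int s w"

lemma drift_int_deriv:
  assumes "w \<in> space M" and "s \<in> {0..t}"
  shows "((\<lambda>s. drift_int s w) has_real_derivative a - b * X s w) (at s within {0..t})"
  unfolding drift_int_def
  using assms by (intro integral_has_real_derivative continuous_intros X_continuous) auto

lemma drift_int_continuous: "w \<in> space M \<Longrightarrow> continuous_on {0..t} (\<lambda>s. drift_int s w)"
  using drift_int_deriv by (intro DERIV_continuous_on) auto

lemma Zt_continuous: "w \<in> space M \<Longrightarrow> continuous_on {0..t} (\<lambda>s. Zt s w)"
  unfolding Zt_def by (intro continuous_intros drift_int_continuous X_continuous)

text \<open>The null set depends on r. That is harmless, since each approximation involves only
  finitely many times and \<open>itl\<close> absorbs null sets.\<close>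

lemma Zt_ito:
  assumes "0 \<le> r"
  obtains Z where "has_ito_integral M F W (\<lambda>s w. \<sigma> * sqrt (Y s w)) r Z" "AE w in M. Z w = Zt r w"
proof -
  from process assms obtain Z where Z: "has_ito_integral M F W (\<lambda>s w. \<sigma> * sqrt (Y s w)) r Z"
    "AE w in M. Y r w = y + (LINT s:{0..r}|lborel. a - b * Y s w) + Z w"
    unfolding cir_process_def by blast
  have "AE w in M. Z w = Zt r w"
    using Z(2) AE_space
  proof eventually_elim
    case (elim w)
    have "(LINT s:{0..r}|lborel. a - b * Y s w) = (LINT s:{0..r}|lborel. a - b * X s w)"
      by (intro set_lebesgue_integral_cong) (auto simp: X_eq)
    also have "\<dots> = drift_int r w"
      unfolding drift_int_def
      by (intro set_borel_integral_eq_integral borel_integrable_atLeastAtMost' continuous_intros X_continuous elim)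
    finally show ?case using elim assms by (simp add: Zt_def X_eq)
  qed
  with Z(1) show thesis by (rule that)
qed

lemma Zt_itl:
  assumes "0 \<le> r" "r \<le> t"
  shows "itl t (\<lambda>s w. \<sigma> * sqrt (X s w) * indicator {0<..r} s) (Zt r)"
proof -
  from Zt_ito[OF assms(1)] obtain Z where Z: "has_ito_integral M F W (\<lambda>s w. \<sigma> * sqrt (Y s w)) r Z"
    "AE w in M. Z w = Zt r w" .
  have eq: "\<sigma> * sqrt (Y s w) * indicator {0<..r} s = \<sigma> * sqrt (X s w) * indicator {0<..r} s" for s w
    by (auto simp: indicator_def X_eq)
  have "w \<in> space M \<Longrightarrow> (\<lambda>s. \<sigma> * sqrt (X s w) * indicator {0<..r} s) \<in> borel_measurable borel" for w
    by measurable
  with itl_of_ito[OF Z assms] show ?thesis unfolding eq by blast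
qed

text \<open>The initial value is encoded only in the equation at time 0: there the simple integrals
  vanish identically, so their limit Z is 0 almost surely.\<close>

lemma X_0: "AE w in M. X 0 w = y"
proof -
  from Zt_ito[of 0] obtain Z where Z: "has_ito_integral M F W (\<lambda>s w. \<sigma> * sqrt (Y s w)) 0 Z"
    "AE w in M. Z w = Zt 0 w" by auto
  from Z(1) obtain n \<tau> \<xi> where sp: "\<And>k. simple_process F (n k) (\<tau> k) (\<xi> k)"
    and z: "to_zero_in_prob M (\<lambda>k w. ennreal \<bar>simple_integral W (n k) (\<tau> k) (\<xi> k) 0 w - Z w\<bar>)"
    and [measurable]: "Z \<in> borel_measurable M"
    unfolding has_ito_integral_def by blast
  have "simple_integral W (n k) (\<tau> k) (\<xi> k) 0 w = 0" for k w
    unfolding simple_integral_def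
  proof (rule sum.neutral, rule ballI)
    fix i assume i: "i \<in> {..<n k}"
    have "\<And>i. i < n k \<Longrightarrow> \<tau> k i < \<tau> k (Suc i)" "0 \<le> \<tau> k 0" using sp[of k] by (auto simp: simple_process_def)
    then have "0 \<le> \<tau> k i" "\<tau> k i < \<tau> k (Suc i)"
      using grid_mono[of "n k" "\<tau> k" 0 i] i by auto
    then show "\<xi> k i w * (W (min (\<tau> k (Suc i)) 0) w - W (min (\<tau> k i) 0) w) = 0" by simp
  qed
  with z have "(\<lambda>k::nat. prob {w\<in>space M. ennreal \<epsilon> < ennreal \<bar>Z w\<bar>}) \<longlonglongrightarrow> 0" if "\<epsilon> > 0" for \<epsilon>
    using that by (auto simp: to_zero_in_prob_def)
  \<comment> \<open>A constant sequence that tends to 0 is 0.\<close>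
  then have "prob {w\<in>space M. ennreal \<epsilon> < ennreal \<bar>Z w\<bar>} = 0" if "\<epsilon> > 0" for \<epsilon>
    using that by (simp add: LIMSEQ_const_iff)
  then have "AE w in M. \<not> ennreal (1 / real (Suc n)) < ennreal \<bar>Z w\<bar>" for n
    by (subst AE_iff_measurable[OF _ refl]) (auto simp: emeasure_eq_measure)
  then have "AE w in M. \<forall>n. \<not> ennreal (1 / real (Suc n)) < ennreal \<bar>Z w\<bar>"
    by (simp add: AE_all_countable)
  then show ?thesis
    using Z(2) AE_space
  proof eventually_elim
    case (elim w)
    have "Z w = 0"
    proof (rule ccontr)
      assume "Z w \<noteq> 0"
      then obtain n where "inverse (real (Suc n)) < \<bar>Z w\<bar>"
        using reals_Archimedean[of "\<bar>Z w\<bar>"] by auto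
      with elim(1) show False by (auto simp: ennreal_less_iff inverse_eq_divide)
    qed
    then show ?case using elim by (simp add: Zt_def drift_int_def)
  qed
qed

end


section \<open>Truncated exponentials and limits of exponential means\<close>

lemma min_exp_Lipschitz:
  fixes u v N :: real
  assumes N: "N > 0"
  shows "\<bar>min (exp u) N - min (exp v) N\<bar> \<le> N * \<bar>u - v\<bar>"
proof -
  have *: "\<bar>min (exp u) N - min (exp v) N\<bar> \<le> N * \<bar>u - v\<bar>" if "v \<le> u" for u v
  proof -
    \<comment> \<open>Truncating exp at N amounts to truncating its argument at ln N, and up to
      there the slope of exp is at most N.\<close>
    define u' v' where "u' = min u (ln N)" and "v' = min v (ln N)"
    have "min (exp w) (exp (ln N)) = exp (min w (ln N))" for w
      by (simp add: min_def)
    then have m: "min (exp w) N = exp (min w (ln N))" for w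
      using N by simp
    have "exp v' \<le> exp u'" using that by (auto simp: u'_def v'_def)
    moreover have "exp u' * (1 - (u' - v')) \<le> exp u' * exp (v' - u')"
    proof (rule mult_left_mono)
      show "1 - (u' - v') \<le> exp (v' - u')" using exp_ge_add_one_self[of "v' - u'"] by linarith
    qed simp
    then have "exp u' - exp v' \<le> exp u' * (u' - v')"
      by (simp add: exp_diff algebra_simps)
    moreover have "exp u' * (u' - v') \<le> N * (u - v)"
    proof (rule mult_mono)
      show "exp u' \<le> N" unfolding u'_def m[symmetric] by simp
    qed (use that N in \<open>auto simp: u'_def v'_def\<close>)
    ultimately show ?thesis using that unfolding m u'_def[symmetric] v'_def[symmetric] by simp
  qed
  show ?thesis
    using *[of v u] *[of u v] by (cases "v \<le> u") (auto simp: abs_minus_commute)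
qed

text \<open>Above the level N one has \<open>exp x \<le> exp (2 * x) / N\<close>, which is how a
  second moment controls the truncation error.\<close>

lemma exp_le_min_plus:
  fixes x N :: real
  assumes "N > 0"
  shows "exp x \<le> min (exp x) N + 1 / N * exp (2 * x)"
proof (cases "exp x \<le> N")
  case True
  then show ?thesis using assms by simp
next
  case False
  then have "N * exp x \<le> exp x * exp x" by (intro mult_right_mono) auto
  then have "exp x \<le> exp x * exp x / N" using assms by (subst pos_le_divide_eq) (simp_all only: mult.commute)
  then show ?thesis using False assms by (simp add: exp_double power2_eq_square)
qed

context prob_space
begin

lemma integrable_min_exp:
  fixes f :: "'a \<Rightarrow> real"
  assumes [measurable]: "f \<in> borel_measurable M" and "0 < N"
  shows "integrable M (\<lambda>w. min (exp (f w)) N)"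
  using assms(2) by (intro integrable_const_bound[where B=N]) auto

lemma expectation_min_exp_tendsto:
  fixes f :: "nat \<Rightarrow> 'a \<Rightarrow> real"
  assumes f [measurable]: "\<And>k. f k \<in> borel_measurable M" and g [measurable]: "g \<in> borel_measurable M"
    and conv: "\<And>\<epsilon>. 0 < \<epsilon> \<Longrightarrow> small_in_prob (\<lambda>k w. f k w - g w) \<epsilon>"
    and N: "0 < N"
  shows "(\<lambda>k. expectation (\<lambda>w. min (exp (f k w)) N)) \<longlonglongrightarrow> expectation (\<lambda>w. min (exp (g w)) N)"
  unfolding tendsto_iff
proof (intro allI impI)
  fix e :: real assume e: "e > 0"
  \<comment> \<open>The error will be at most 2 N e', which is below e.\<close>
  define e' where "e' = e / (3 * N)"
  have e': "e' > 0" using e N by (simp add: e'_def)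
  from conv[OF e'] show "\<forall>\<^sub>F k in sequentially.
    dist (expectation (\<lambda>w. min (exp (f k w)) N)) (expectation (\<lambda>w. min (exp (g w)) N)) < e"
  proof eventually_elim
    case (elim k)
    then obtain B where B [measurable]: "B \<in> sets M" and Bp: "prob B \<le> e'"
      and Bf: "\<And>w. w \<in> space M - B \<Longrightarrow> \<bar>f k w - g w\<bar> \<le> e'" by blast
    have "dist (expectation (\<lambda>w. min (exp (f k w)) N)) (expectation (\<lambda>w. min (exp (g w)) N))
      = norm (expectation (\<lambda>w. min (exp (f k w)) N - min (exp (g w)) N))"
      by (simp add: dist_norm integrable_min_exp N)
    also have "\<dots> \<le> expectation (\<lambda>w. norm (min (exp (f k w)) N - min (exp (g w)) N))"
      by (rule integral_norm_bound)
    also have "\<dots> \<le> expectation (\<lambda>w. N * e' + N * indicator B w)"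
    proof (rule integral_mono)
      show "integrable M (\<lambda>w. norm (min (exp (f k w)) N - min (exp (g w)) N))"
        by (intro integrable_norm Bochner_Integration.integrable_diff integrable_min_exp N) auto
      show "integrable M (\<lambda>w. N * e' + N * indicator B w)"
        by (intro Bochner_Integration.integrable_add integrable_const integrable_mult_right integrable_real_indicator)
          (auto simp: emeasure_eq_measure)
      fix w assume w: "w \<in> space M"
      show "norm (min (exp (f k w)) N - min (exp (g w)) N) \<le> N * e' + N * indicator B w"
      proof (cases "w \<in> B")
        case True
        have "\<bar>min (exp (f k w)) N - min (exp (g w)) N\<bar> \<le> N"
          using N exp_gt_zero[of "f k w"] exp_gt_zero[of "g w"] by linarith
        then show ?thesis using True N e' by (simp add: add_increasing)
      next
        case False
        have "\<bar>min (exp (f k w)) N - min (exp (g w)) N\<bar> \<le> N * \<bar>f k w - g w\<bar>"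
          by (rule min_exp_Lipschitz[OF N])
        also have "\<dots> \<le> N * e'" using Bf[of w] w False N by (intro mult_left_mono) auto
        finally show ?thesis using False by simp
      qed
    qed
    also have "\<dots> = N * e' + N * prob B"
    proof -
      have "integrable M (\<lambda>w. N * indicator B w)"
        by (intro integrable_mult_right integrable_real_indicator) (auto simp: emeasure_eq_measure)
      then show ?thesis
        by (subst Bochner_Integration.integral_add) (auto simp: prob_space Int_absorb1 sets.sets_into_space)
    qed
    also have "\<dots> \<le> N * e' + N * e'" using Bp N by simp
    also have "\<dots> < e" using e N by (simp add: e'_def field_simps)
    finally show ?case .
  qed
qed

lemma nn_integral_min_exp:
  fixes f :: "'a \<Rightarrow> real"
  assumes [measurable]: "f \<in> borel_measurable M" and N: "0 < N"
  shows "(\<integral>\<^sup>+w. ennreal (min (exp (f w)) N) \<partial>M) = ennreal (expectation (\<lambda>w. min (exp (f w)) N))"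
  using N by (intro nn_integral_eq_integral integrable_min_exp) auto

text \<open>Fatou's lemma for convergence in probability, in two stages: at a fixed truncation level
  the means converge; then the level is sent to infinity.\<close>

lemma nn_integral_exp_le_1:
  fixes f :: "nat \<Rightarrow> 'a \<Rightarrow> real"
  assumes f [measurable]: "\<And>k. f k \<in> borel_measurable M" and g [measurable]: "g \<in> borel_measurable M"
    and conv: "\<And>\<epsilon>. 0 < \<epsilon> \<Longrightarrow> small_in_prob (\<lambda>k w. f k w - g w) \<epsilon>"
    and one: "\<And>k. (\<integral>\<^sup>+w. ennreal (exp (f k w)) \<partial>M) = 1"
  shows "(\<integral>\<^sup>+w. ennreal (exp (g w)) \<partial>M) \<le> 1"
proof -
  have le: "(\<integral>\<^sup>+w. ennreal (min (exp (g w)) (real (Suc n))) \<partial>M) \<le> 1" for n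
  proof -
    have "expectation (\<lambda>w. min (exp (f k w)) (real (Suc n))) \<le> 1" for k
    proof -
      have "ennreal (expectation (\<lambda>w. min (exp (f k w)) (real (Suc n)))) \<le> (\<integral>\<^sup>+w. ennreal (exp (f k w)) \<partial>M)"
        by (subst nn_integral_min_exp[symmetric]) (auto intro!: nn_integral_mono ennreal_leI)
      then show ?thesis using one by simp
    qed
    then have "expectation (\<lambda>w. min (exp (g w)) (real (Suc n))) \<le> 1"
      by (intro LIMSEQ_le_const2[OF expectation_min_exp_tendsto[OF f g conv]]) auto
    then show ?thesis by (subst nn_integral_min_exp) auto
  qed
  have "(\<integral>\<^sup>+w. ennreal (exp (g w)) \<partial>M) = (\<integral>\<^sup>+w. liminf (\<lambda>n. ennreal (min (exp (g w)) (real (Suc n)))) \<partial>M)"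
  proof (rule nn_integral_cong)
    fix w
    obtain m where m: "exp (g w) \<le> real m" using real_arch_simple by blast
    have "\<forall>\<^sub>F n in sequentially. ennreal (min (exp (g w)) (real (Suc n))) = ennreal (exp (g w))"
      using eventually_ge_at_top[of m]
    proof eventually_elim
      case (elim n)
      then have "exp (g w) \<le> real (Suc n)" using m by linarith
      then show ?case by (simp only: min_absorb1)
    qed
    then have "(\<lambda>n. ennreal (min (exp (g w)) (real (Suc n)))) \<longlonglongrightarrow> ennreal (exp (g w))"
      by (rule tendsto_eventually)
    then show "ennreal (exp (g w)) = liminf (\<lambda>n. ennreal (min (exp (g w)) (real (Suc n))))"
      using lim_imp_Liminf[OF sequentially_bot] by metis
  qed
  also have "\<dots> \<le> liminf (\<lambda>n. \<integral>\<^sup>+w. ennreal (min (exp (g w)) (real (Suc n))) \<partial>M)"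
    by (rule nn_integral_liminf) measurable
  also have "\<dots> \<le> liminf (\<lambda>n. 1 :: ennreal)"
    by (rule Liminf_mono) (use le in \<open>auto intro: always_eventually\<close>)
  also have "\<dots> = 1" by (simp add: Liminf_const)
  finally show ?thesis .
qed

text \<open>The second moment bound is uniform integrability in quantitative form: truncation at n +
  1 loses at most C / (n + 1), uniformly in k.\<close>

lemma nn_integral_exp_ge_1:
  fixes f :: "nat \<Rightarrow> 'a \<Rightarrow> real"
  assumes f [measurable]: "\<And>k. f k \<in> borel_measurable M" and g [measurable]: "g \<in> borel_measurable M"
    and conv: "\<And>\<epsilon>. 0 < \<epsilon> \<Longrightarrow> small_in_prob (\<lambda>k w. f k w - g w) \<epsilon>"
    and one: "\<And>k. (\<integral>\<^sup>+w. ennreal (exp (f k w)) \<partial>M) = 1"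
    and two: "\<And>k. (\<integral>\<^sup>+w. ennreal (exp (2 * f k w)) \<partial>M) \<le> ennreal C" and C: "0 \<le> C"
  shows "1 \<le> (\<integral>\<^sup>+w. ennreal (exp (g w)) \<partial>M)"
proof -
  have *: "ennreal (1 - C / real (Suc n)) \<le> (\<integral>\<^sup>+w. ennreal (exp (g w)) \<partial>M)" for n
  proof -
    let ?N = "real (Suc n)"
    have "1 - C / ?N \<le> expectation (\<lambda>w. min (exp (f k w)) ?N)" for k
    proof -
      have "1 = (\<integral>\<^sup>+w. ennreal (exp (f k w)) \<partial>M)" using one by simp
      also have "\<dots> \<le> (\<integral>\<^sup>+w. ennreal (min (exp (f k w)) ?N) + ennreal (1 / ?N) * ennreal (exp (2 * f k w)) \<partial>M)"
      proof (rule nn_integral_mono)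
        fix w
        have "exp (f k w) \<le> min (exp (f k w)) ?N + 1 / ?N * exp (2 * f k w)"
          by (rule exp_le_min_plus) simp
        then have "ennreal (exp (f k w)) \<le> ennreal (min (exp (f k w)) ?N + 1 / ?N * exp (2 * f k w))"
          by (rule ennreal_leI)
        also have "\<dots> = ennreal (min (exp (f k w)) ?N) + ennreal (1 / ?N) * ennreal (exp (2 * f k w))"
          by (subst ennreal_plus) (auto simp: ennreal_mult[symmetric] simp del: of_nat_Suc)
        finally show "ennreal (exp (f k w)) \<le> ennreal (min (exp (f k w)) ?N) + ennreal (1 / ?N) * ennreal (exp (2 * f k w))" .
      qed
      also have "\<dots> = ennreal (expectation (\<lambda>w. min (exp (f k w)) ?N)) + ennreal (1 / ?N) * (\<integral>\<^sup>+w. ennreal (exp (2 * f k w)) \<partial>M)"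
        by (simp add: nn_integral_add nn_integral_cmult nn_integral_min_exp del: of_nat_Suc)
      also have "\<dots> \<le> ennreal (expectation (\<lambda>w. min (exp (f k w)) ?N)) + ennreal (1 / ?N) * ennreal C"
        by (intro add_mono mult_left_mono two) auto
      also have "\<dots> = ennreal (expectation (\<lambda>w. min (exp (f k w)) ?N) + 1 / ?N * C)"
      proof -
        have "0 \<le> expectation (\<lambda>w. min (exp (f k w)) ?N)" by (intro Bochner_Integration.integral_nonneg) auto
        then show ?thesis using C by (subst ennreal_plus) (auto simp: ennreal_mult[symmetric] simp del: of_nat_Suc)
      qed
      finally have "1 \<le> expectation (\<lambda>w. min (exp (f k w)) ?N) + 1 / ?N * C"
        by (simp add: ennreal_1[symmetric] ennreal_le_iff2 del: ennreal_1 of_nat_Suc)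
      then show ?thesis by simp
    qed
    then have "1 - C / ?N \<le> expectation (\<lambda>w. min (exp (g w)) ?N)"
      by (intro LIMSEQ_le_const[OF expectation_min_exp_tendsto[OF f g conv]]) auto
    then have "ennreal (1 - C / ?N) \<le> (\<integral>\<^sup>+w. ennreal (min (exp (g w)) ?N) \<partial>M)"
      by (subst nn_integral_min_exp) (auto intro: ennreal_leI)
    also have "\<dots> \<le> (\<integral>\<^sup>+w. ennreal (exp (g w)) \<partial>M)"
      by (intro nn_integral_mono ennreal_leI) auto
    finally show ?thesis .
  qed
  have "(\<lambda>n. 1 - C / real (Suc n)) \<longlonglongrightarrow> 1" by real_asymp
  from tendsto_ennrealI[OF this] have "(\<lambda>n. ennreal (1 - C / real (Suc n))) \<longlonglongrightarrow> 1"
    by simp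
  then show ?thesis by (rule LIMSEQ_le_const2) (use * in auto)
qed

end


text \<open>Here \<psi> runs forward in time with plus signs; the solution with prescribed value at
  t is \<open>riccati_sol\<close> read backwards, see \<open>riccati_locale\<close>.\<close>

locale cir_riccati = cir M F W a b \<sigma> y Y for M :: "'w measure" and F W a b \<sigma> y Y +
  fixes t :: real and \<psi> :: "real \<Rightarrow> real"
  assumes t: "0 < t"
    and riccati: "\<And>s. s \<in> {0..t} \<Longrightarrow>
      (\<psi> has_real_derivative b * \<psi> s + \<sigma>\<^sup>2 / 2 * (\<psi> s)\<^sup>2) (at s within {0..t})"
begin

text \<open>\<open>exp (xk k)\<close> is the exponential, of mean \<open>1\<close>, of the simple integral \<open>- Ik k\<close> approximating
  \<open>- \<integral> \<psi> \<sigma> \<surd>Y dW\<close>, and \<open>Sk k\<close> is the same integral with exact increments; \<open>x_lim\<close> is the limit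
  of \<open>xk\<close> in probability.\<close>

abbreviation p :: "nat \<Rightarrow> nat \<Rightarrow> real" where
  "p k i \<equiv> upt_grid t k i"

abbreviation z :: "nat \<Rightarrow> nat \<Rightarrow> 'w \<Rightarrow> real" where
  "z k i w \<equiv> \<psi> (p k i) * (\<sigma> * sqrt (X (p k i) w))"

definition d\<psi> :: "real \<Rightarrow> real" where
  "d\<psi> s = b * \<psi> s + \<sigma>\<^sup>2 / 2 * (\<psi> s)\<^sup>2"

definition Sk :: "nat \<Rightarrow> 'w \<Rightarrow> real" where
  "Sk k w = (\<Sum>i<Suc k. \<psi> (p k i) * (Zt (p k (Suc i)) w - Zt (p k i) w))"

definition Ik :: "nat \<Rightarrow> 'w \<Rightarrow> real" where
  "Ik k w = (\<Sum>i<Suc k. z k i w * (W (p k (Suc i)) w - W (p k i) w))"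

definition Qk :: "nat \<Rightarrow> 'w \<Rightarrow> real" where
  "Qk k w = (\<Sum>i<Suc k. (z k i w)\<^sup>2 * (p k (Suc i) - p k i))"

definition xk :: "nat \<Rightarrow> 'w \<Rightarrow> real" where
  "xk k w = - Ik k w - Qk k w / 2"

definition x_lim :: "'w \<Rightarrow> real" where
  "x_lim w = - \<psi> t * X t w + \<psi> 0 * X 0 w + a * integral {0..t} \<psi>"

lemma \<psi>_cont: "continuous_on {0..t} \<psi>"
  using riccati by (intro DERIV_continuous_on) auto

lemma d\<psi>_cont: "continuous_on {0..t} d\<psi>"
  unfolding d\<psi>_def using \<psi>_cont by (intro continuous_intros)

lemma p_range: "i \<le> Suc k \<Longrightarrow> 0 \<le> p k i \<and> p k i \<le> t"
  using upt_grid_range[OF t] by auto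

lemma p_less: "p k i < p k (Suc i)"
  using upt_grid_less[OF t] .

lemma z_adapted: "i < Suc k \<Longrightarrow> z k i \<in> borel_measurable (F (p k i))"
  using X_adapted[of "p k i"] p_range[of i k]
  by (intro borel_measurable_times borel_measurable_const measurable_compose[OF _ borel_measurable_sqrt]) auto

text \<open>Used with c = 1 for the mean of \<open>exp (xk k)\<close> and with c = 4 for its second
  moment.\<close>

lemma exp_grid: "(\<integral>\<^sup>+w. ennreal (exp (- c * Ik k w - c\<^sup>2 * Qk k w / 2)) \<partial>M) = 1"
proof -
  let ?z = "\<lambda>i w. - c * z k i w"
  have "(\<integral>\<^sup>+w. ennreal (exp ((\<Sum>l<Suc k. ?z l w * (W (p k (Suc l)) w - W (p k l) w))
      - (\<Sum>l<Suc k. (?z l w)\<^sup>2 * (p k (Suc l) - p k l)) / 2)) \<partial>M) = 1"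
    by (rule grid_exp) (use p_less in \<open>auto intro!: borel_measurable_times z_adapted\<close>)
  then show ?thesis
    unfolding Ik_def Qk_def sum_distrib_left power_mult_distrib[of "- c"] mult.assoc by simp
qed

lemma Ik_measurable [measurable]: "Ik k \<in> borel_measurable M"
  unfolding Ik_def
proof (intro borel_measurable_sum borel_measurable_times[OF _ borel_measurable_diff])
  fix i assume i: "i \<in> {..<Suc k}"
  show "z k i \<in> borel_measurable M" by measurable
  show "W (p k (Suc i)) \<in> borel_measurable M" "W (p k i) \<in> borel_measurable M"
    using i p_range[of i k] p_range[of "Suc i" k] by (auto intro!: W_measurable)
qed

lemma Qk_measurable [measurable]: "Qk k \<in> borel_measurable M"
  unfolding Qk_def by measurable

text \<open>Comes from the Lebesgue form of the integral and the joint measurability of X.\<close>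

lemma drift_int_measurable [measurable]: "drift_int s \<in> borel_measurable M"
proof -
  have "(\<lambda>w. LINT r:{0..s}|lborel. a - b * X r w) \<in> borel_measurable M"
    unfolding set_lebesgue_integral_def by measurable
  moreover have "drift_int s w = (LINT r:{0..s}|lborel. a - b * X r w)" if "w \<in> space M" for w
    unfolding drift_int_def
    by (intro set_borel_integral_eq_integral(2)[symmetric] borel_integrable_atLeastAtMost'
        continuous_intros X_continuous that)
  ultimately show ?thesis by (simp cong: measurable_cong)
qed

lemma Zt_measurable [measurable]: "Zt s \<in> borel_measurable M"
  unfolding Zt_def by measurable

lemma Sk_measurable [measurable]: "Sk k \<in> borel_measurable M"
  unfolding Sk_def by measurable

lemma x_lim_measurable [measurable]: "x_lim \<in> borel_measurable M"
  unfolding x_lim_def by measurable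

text \<open>Summation by parts moves the increments from a rough path to the smooth \<psi>; the
  resulting sums converge for every single path.\<close>

lemma Abel_sum:
  fixes h :: "real \<Rightarrow> real"
  shows "(\<Sum>i<n. \<psi> (p k i) * (h (p k (Suc i)) - h (p k i)))
    = \<psi> (p k n) * h (p k n) - \<psi> (p k 0) * h (p k 0) - (\<Sum>i<n. h (p k (Suc i)) * (\<psi> (p k (Suc i)) - \<psi> (p k i)))"
  by (induction n) (auto simp: algebra_simps)

lemma \<psi>_increment:
  assumes "i < Suc k"
  shows "integral {p k i..p k (Suc i)} d\<psi> = \<psi> (p k (Suc i)) - \<psi> (p k i)"
proof (rule integral_unique, rule fundamental_theorem_of_calculus)
  show "p k i \<le> p k (Suc i)" using p_less less_imp_le by blast
  fix s assume s: "s \<in> {p k i..p k (Suc i)}"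
  have sub: "{p k i..p k (Suc i)} \<subseteq> {0..t}" using p_range[of i k] p_range[of "Suc i" k] assms by auto
  then have "(\<psi> has_real_derivative d\<psi> s) (at s within {p k i..p k (Suc i)})"
    using riccati s unfolding d\<psi>_def by (blast intro: DERIV_subset)
  then show "(\<psi> has_vector_derivative d\<psi> s) (at s within {p k i..p k (Suc i)})"
    by (simp add: has_real_derivative_iff_has_vector_derivative)
qed

lemma Sk_lim:
  assumes w: "w \<in> space M"
  shows "(\<lambda>k. Sk k w) \<longlonglongrightarrow> \<psi> t * Zt t w - \<psi> 0 * Zt 0 w - integral {0..t} (\<lambda>s. Zt s w * d\<psi> s)"
proof -
  have "(\<lambda>k. \<Sum>i<Suc k. Zt (p k (Suc i)) w * integral {p k i..p k (Suc i)} d\<psi>) \<longlonglongrightarrow>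
    integral {0..t} (\<lambda>s. Zt s w * d\<psi> s)"
  proof (rule Riemann_sum_tendsto[OF Zt_continuous[OF w] d\<psi>_cont t])
    fix \<epsilon> :: real assume "\<epsilon> > 0"
    from upt_grid_uniform[OF Zt_continuous[OF w] t this]
    show "\<forall>\<^sub>F k in sequentially. \<forall>i\<le>k. \<forall>s\<in>{p k i..p k (Suc i)}. \<bar>Zt (p k (Suc i)) w - Zt s w\<bar> \<le> \<epsilon>"
      by eventually_elim blast
  qed
  moreover have "Sk k w = \<psi> t * Zt t w - \<psi> 0 * Zt 0 w
      - (\<Sum>i<Suc k. Zt (p k (Suc i)) w * integral {p k i..p k (Suc i)} d\<psi>)" for k
    unfolding Sk_def Abel_sum[where h="\<lambda>s. Zt s w"]
    by (simp add: \<psi>_increment del: sum.lessThan_Suc)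
  ultimately show ?thesis by (simp add: tendsto_diff del: sum.lessThan_Suc)
qed

lemma Qk_lim:
  assumes w: "w \<in> space M"
  shows "(\<lambda>k. Qk k w) \<longlonglongrightarrow> integral {0..t} (\<lambda>s. (\<psi> s)\<^sup>2 * \<sigma>\<^sup>2 * X s w)"
proof -
  let ?g = "\<lambda>s. (\<psi> s)\<^sup>2 * \<sigma>\<^sup>2 * X s w"
  have g: "continuous_on {0..t} ?g"
    using \<psi>_cont X_continuous[OF w] by (intro continuous_intros)
  have "(\<lambda>k. \<Sum>i<Suc k. ?g (p k i) * integral {p k i..p k (Suc i)} (\<lambda>s. 1)) \<longlonglongrightarrow>
    integral {0..t} (\<lambda>s. ?g s * 1)"
  proof (rule Riemann_sum_tendsto[OF g continuous_on_const t])
    fix \<epsilon> :: real assume "\<epsilon> > 0"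
    from upt_grid_uniform[OF g t this]
    show "\<forall>\<^sub>F k in sequentially. \<forall>i\<le>k. \<forall>s\<in>{p k i..p k (Suc i)}. \<bar>?g (p k i) - ?g s\<bar> \<le> \<epsilon>"
      by eventually_elim blast
  qed
  moreover have "Qk k w = (\<Sum>i<Suc k. ?g (p k i) * integral {p k i..p k (Suc i)} (\<lambda>s. 1))" for k
    unfolding Qk_def
    using X_nonneg[OF w] less_imp_le[OF p_less]
    by (intro sum.cong refl) (simp add: power_mult_distrib)
  ultimately show ?thesis by simp
qed

text \<open>Integration by parts for \<open>\<psi> (Y - y - drift)\<close>; the Riccati equation cancels all terms
  containing an integral of \<open>Y\<close>.\<close>

lemma x_lim_identity:
  assumes w: "w \<in> space M"
  shows "x_lim w = - (\<psi> t * Zt t w - \<psi> 0 * Zt 0 w - integral {0..t} (\<lambda>s. Zt s w * d\<psi> s))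
    - integral {0..t} (\<lambda>s. (\<psi> s)\<^sup>2 * \<sigma>\<^sup>2 * X s w) / 2"
proof -
  note c = \<psi>_cont d\<psi>_cont X_continuous[OF w] drift_int_continuous[OF w]
  define D where "D = (\<lambda>s. drift_int s w)"
  have Dc: "continuous_on {0..t} D" unfolding D_def using c by simp
  have "((\<lambda>s. d\<psi> s * D s + \<psi> s * (a - b * X s w)) has_integral \<psi> t * D t - \<psi> 0 * D 0) {0..t}"
  proof (rule fundamental_theorem_of_calculus)
    fix s assume s: "s \<in> {0..t}"
    have "((\<lambda>s. \<psi> s * D s) has_real_derivative d\<psi> s * D s + (a - b * X s w) * \<psi> s) (at s within {0..t})"
      unfolding d\<psi>_def D_def by (intro DERIV_mult riccati drift_int_deriv s w)
    then show "((\<lambda>s. \<psi> s * D s) has_vector_derivative d\<psi> s * D s + \<psi> s * (a - b * X s w)) (at s within {0..t})"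
      by (simp add: has_real_derivative_iff_has_vector_derivative mult.commute)
  qed (use t in simp)
  moreover have "D 0 = 0" by (simp add: D_def drift_int_def)
  ultimately have 1: "((\<lambda>s. d\<psi> s * D s + \<psi> s * (a - b * X s w)) has_integral \<psi> t * D t) {0..t}" by simp
  have 2: "(d\<psi> has_integral \<psi> t - \<psi> 0) {0..t}"
  proof (rule fundamental_theorem_of_calculus)
    fix s assume s: "s \<in> {0..t}"
    show "(\<psi> has_vector_derivative d\<psi> s) (at s within {0..t})"
      using riccati[OF s] by (simp add: has_real_derivative_iff_has_vector_derivative d\<psi>_def)
  qed (use t in simp)
  have 3: "((\<lambda>s. Zt s w * d\<psi> s) has_integral integral {0..t} (\<lambda>s. Zt s w * d\<psi> s)) {0..t}"
    by (intro integrable_integral integrable_continuous_interval continuous_intros d\<psi>_cont Zt_continuous[OF w])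
  have 4: "((\<lambda>s. (\<psi> s)\<^sup>2 * \<sigma>\<^sup>2 * X s w) has_integral integral {0..t} (\<lambda>s. (\<psi> s)\<^sup>2 * \<sigma>\<^sup>2 * X s w)) {0..t}"
    by (intro integrable_integral integrable_continuous_interval continuous_intros c)
  have 5: "(\<psi> has_integral integral {0..t} \<psi>) {0..t}"
    by (intro integrable_integral integrable_continuous_interval c)
  let ?J = "integral {0..t} (\<lambda>s. Zt s w * d\<psi> s)"
  let ?K = "integral {0..t} (\<lambda>s. (\<psi> s)\<^sup>2 * \<sigma>\<^sup>2 * X s w)"
  \<comment> \<open>With \<open>Zt = X - y - D\<close> the terms containing \<open>d\<psi>\<close>
    combine to \<open>X * d\<psi>\<close>, and the whole integrand is identically 0. So no integral
    of X has to be evaluated.\<close>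
  have "((\<lambda>s. Zt s w * d\<psi> s + y * d\<psi> s + (d\<psi> s * D s + \<psi> s * (a - b * X s w)) - (\<psi> s)\<^sup>2 * \<sigma>\<^sup>2 * X s w / 2 - a * \<psi> s)
    has_integral ?J + y * (\<psi> t - \<psi> 0) + \<psi> t * D t - ?K / 2 - a * integral {0..t} \<psi>) {0..t}"
    by (intro has_integral_add has_integral_diff has_integral_mult_right has_integral_divide 1 2 3 4 5)
  moreover have "Zt s w * d\<psi> s + y * d\<psi> s + (d\<psi> s * D s + \<psi> s * (a - b * X s w)) - (\<psi> s)\<^sup>2 * \<sigma>\<^sup>2 * X s w / 2 - a * \<psi> s = 0" for s
    by (simp add: Zt_def D_def d\<psi>_def field_simps power2_eq_square)
  ultimately have "?J + y * (\<psi> t - \<psi> 0) + \<psi> t * D t - ?K / 2 - a * integral {0..t} \<psi> = 0"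
    by simp
  then show ?thesis
    using \<open>D 0 = 0\<close> by (simp add: x_lim_def Zt_def D_def algebra_simps)
qed

text \<open>An increment of \<open>Zt\<close> is a difference of two integrals from 0, so the
  difference is the Ito integral of the freezing error. As \<open>elem\<close> does not ask for
  bounded coefficients, the unbounded \<open>z k i\<close> are admissible.\<close>

lemma Sk_Ik_itl:
  "itl t (\<lambda>s w. \<Sum>i<Suc k. (\<psi> (p k i) * (\<sigma> * sqrt (X s w) - \<sigma> * sqrt (X (p k i) w))) * indicator {p k i<..p k (Suc i)} s)
    (\<lambda>w. Sk k w - Ik k w)"
proof -
  have 1: "itl t (\<lambda>s w. \<Sum>i<Suc k. \<psi> (p k i) * (\<sigma> * sqrt (X s w) * indicator {0<..p k (Suc i)} s - \<sigma> * sqrt (X s w) * indicator {0<..p k i} s))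
    (\<lambda>w. \<Sum>i<Suc k. \<psi> (p k i) * (Zt (p k (Suc i)) w - Zt (p k i) w))"
  proof (intro itl_sum itl_scale itl_minus Zt_itl)
  qed (use p_range in auto)
  have 2: "elem t (\<lambda>s w. \<Sum>i<Suc k. z k i w * indicator {p k i<..p k (Suc i)} s)
    (\<lambda>w. \<Sum>i<Suc k. z k i w * (W (p k (Suc i)) w - W (p k i) w))"
    by (intro elem_sum elem_single z_adapted) (use p_range p_less in \<open>auto intro: less_imp_le\<close>)
  have eq: "(\<Sum>i<Suc k. \<psi> (p k i) * (\<sigma> * sqrt (X s w) * indicator {0<..p k (Suc i)} s - \<sigma> * sqrt (X s w) * indicator {0<..p k i} s))
     - (\<Sum>i<Suc k. z k i w * indicator {p k i<..p k (Suc i)} s)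
    = (\<Sum>i<Suc k. (\<psi> (p k i) * (\<sigma> * sqrt (X s w) - \<sigma> * sqrt (X (p k i) w))) * indicator {p k i<..p k (Suc i)} s)" for s w
    unfolding sum_subtractf[symmetric]
  proof (intro sum.cong refl)
    fix i assume "i \<in> {..<Suc k}"
    then have "indicator {0<..p k (Suc i)} s - indicator {0<..p k i} s = (indicator {p k i<..p k (Suc i)} s :: real)"
      using p_range[of i k] p_less[of k i] by (auto simp: indicator_def)
    then show "\<psi> (p k i) * (\<sigma> * sqrt (X s w) * indicator {0<..p k (Suc i)} s - \<sigma> * sqrt (X s w) * indicator {0<..p k i} s)
      - z k i w * indicator {p k i<..p k (Suc i)} s
      = (\<psi> (p k i) * (\<sigma> * sqrt (X s w) - \<sigma> * sqrt (X (p k i) w))) * indicator {p k i<..p k (Suc i)} s"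
      unfolding right_diff_distrib[symmetric] by (simp add: algebra_simps)
  qed
  show ?thesis
    using itl_minus[OF 1 itl_elem[OF 2]] unfolding eq Sk_def Ik_def .
qed

text \<open>Path continuity makes the freezing error uniformly small on fine grids, path by path,
  and \<open>itl_tendsto_0\<close> turns this into smallness in probability.\<close>

lemma Sk_Ik_small:
  assumes e: "\<epsilon> > 0"
  shows "small_in_prob (\<lambda>k w. Sk k w - Ik k w) \<epsilon>"
proof (rule itl_tendsto_0[OF Sk_Ik_itl _ _ _ e])
  show "(\<lambda>w. sq_int t (\<lambda>s. \<Sum>i<Suc k. (\<psi> (p k i) * (\<sigma> * sqrt (X s w) - \<sigma> * sqrt (X (p k i) w))) * indicator {p k i<..p k (Suc i)} s)) \<in> borel_measurable M" for k
    by measurable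
  fix w assume w: "w \<in> space M"
  let ?h = "\<lambda>k s. \<Sum>i<Suc k. (\<psi> (p k i) * (\<sigma> * sqrt (X s w) - \<sigma> * sqrt (X (p k i) w))) * indicator {p k i<..p k (Suc i)} s"
  have "bounded (\<psi> ` {0..t})" using \<psi>_cont by (intro compact_imp_bounded compact_continuous_image) auto
  then obtain B where B: "B > 0" "\<And>s. s \<in> {0..t} \<Longrightarrow> \<bar>\<psi> s\<bar> \<le> B"
    by (auto simp: bounded_pos)
  have gc: "continuous_on {0..t} (\<lambda>s. \<sigma> * sqrt (X s w))"
    using X_continuous[OF w] by (intro continuous_intros)
  have main: "\<forall>\<^sub>F k in sequentially. sq_int t (?h k) \<le> ennreal r" if r: "r > 0" for r
  proof -
    \<comment> \<open>With the bound B for \<psi>, the squared error is at most (B e')^2 = r / t,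
      whose integral over [0,t] is r.\<close>
    define e' where "e' = sqrt (r / t) / B"
    have e': "e' > 0" using r t B by (simp add: e'_def)
    from upt_grid_uniform[OF gc t e'] show ?thesis
    proof eventually_elim
      case (elim k)
      have bnd: "(?h k s)\<^sup>2 \<le> r / t" for s
      proof -
        have *: "(\<psi> (p k i) * (\<sigma> * sqrt (X s w) - \<sigma> * sqrt (X (p k i) w)))\<^sup>2 \<le> r / t"
          if i: "i < Suc k" and s: "s \<in> {p k i<..p k (Suc i)}" for i
        proof -
          have "\<bar>\<psi> (p k i) * (\<sigma> * sqrt (X s w) - \<sigma> * sqrt (X (p k i) w))\<bar> \<le> B * e'"
            unfolding abs_mult
          proof (rule mult_mono)
            show "\<bar>\<psi> (p k i)\<bar> \<le> B" using B(2) p_range[of i k] i by simp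
            show "\<bar>\<sigma> * sqrt (X s w) - \<sigma> * sqrt (X (p k i) w)\<bar> \<le> e'"
              using elim i s by (auto simp: abs_minus_commute)
          qed (use B in auto)
          also have "\<dots> = sqrt (r / t)" using B by (simp add: e'_def)
          finally have "\<bar>\<psi> (p k i) * (\<sigma> * sqrt (X s w) - \<sigma> * sqrt (X (p k i) w))\<bar>\<^sup>2 \<le> (sqrt (r / t))\<^sup>2"
            by (intro power_mono) auto
          then show ?thesis using r t by simp
        qed
        have "(?h k s)\<^sup>2 = (\<Sum>i<Suc k. (\<psi> (p k i) * (\<sigma> * sqrt (X s w) - \<sigma> * sqrt (X (p k i) w)))\<^sup>2 * indicator {p k i<..p k (Suc i)} s)"
          by (rule step_function_square) (rule p_less)
        also have "\<dots> \<le> (\<Sum>i<Suc k. r / t * indicator {p k i<..p k (Suc i)} s)"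
          using * by (intro sum_mono) (auto simp: indicator_def)
        \<comment> \<open>The indicators of the cells add up to at most 1, again by
          telescoping.\<close>
        also have "\<dots> = r / t * (\<Sum>i<Suc k. indicator {..p k (Suc i)} s - indicator {..p k i} s)"
          unfolding sum_distrib_left using less_imp_le[OF p_less] by (intro sum.cong refl) (simp add: indicator_Ioc_diff)
        also have "\<dots> = r / t * (indicator {..p k (Suc k)} s - indicator {..p k 0} s)"
          by (subst sum_lessThan_telescope) simp
        also have "\<dots> \<le> r / t" using r t by (auto simp: indicator_def)
        finally show ?thesis .
      qed
      have "sq_int t (?h k) \<le> (\<integral>\<^sup>+s. ennreal (r / t) * indicator {0..t} s \<partial>lborel)"
        by (intro nn_integral_mono mult_right_mono ennreal_leI bnd) auto
      also have "\<dots> = ennreal r" using r t by (simp add: nn_integral_cmult_indicator ennreal_mult[symmetric])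
      finally show ?case .
    qed
  qed
  show "(\<lambda>k. sq_int t (?h k)) \<longlonglongrightarrow> 0"
  proof (rule order_tendstoI)
    fix r :: ennreal assume "0 < r"
    \<comment> \<open>r may be infinite, whereas \<open>main\<close> needs a positive real
      bound.\<close>
    then obtain q where q: "0 < q" "q < r" using dense by blast
    have "q < top" using less_le_trans[OF q(2) top_greatest] .
    then obtain r' where "q = ennreal r'" "0 \<le> r'" by (auto simp: less_top_ennreal)
    then have r': "0 < r'" "ennreal r' < r" using q by (auto simp: order.order_iff_strict)
    from main[OF r'(1)] show "\<forall>\<^sub>F k in sequentially. sq_int t (?h k) < r"
      by eventually_elim (use r'(2) in order)
  qed simp
qed (use t in simp)

text \<open>Exchanging \<open>Ik\<close> for \<open>Sk\<close> costs an error that is small in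
  probability; after that the convergence is pathwise.\<close>

lemma xk_lim:
  assumes e: "\<epsilon> > 0"
  shows "small_in_prob (\<lambda>k w. xk k w - x_lim w) \<epsilon>"
proof -
  have lim: "(\<lambda>k. - Sk k w - Qk k w / 2) \<longlonglongrightarrow> x_lim w" if w: "w \<in> space M" for w
    unfolding x_lim_identity[OF w] by (intro tendsto_diff tendsto_minus tendsto_divide Sk_lim[OF w] Qk_lim[OF w] tendsto_const) simp
  have 1: "\<epsilon>' > 0 \<Longrightarrow> small_in_prob (\<lambda>k w. (- Sk k w - Qk k w / 2) - x_lim w) \<epsilon>'" for \<epsilon>'
    by (rule eventually_prob_le[OF _ lim]) auto
  have eq: "(Sk k w - Ik k w) + ((- Sk k w - Qk k w / 2) - x_lim w) = xk k w - x_lim w" for k w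
    by (simp add: xk_def)
  from eventually_prob_add[OF Sk_Ik_small 1 e] show ?thesis unfolding eq .
qed

lemma xk_measurable [measurable]: "xk k \<in> borel_measurable M"
  unfolding xk_def by measurable

lemma exp_xk: "(\<integral>\<^sup>+w. ennreal (exp (xk k w)) \<partial>M) = 1"
  using exp_grid[of 1 k] by (simp add: xk_def)

lemma exp_x_le: "(\<integral>\<^sup>+w. ennreal (exp (x_lim w)) \<partial>M) \<le> 1"
  by (rule nn_integral_exp_le_1[OF xk_measurable x_lim_measurable xk_lim exp_xk])

text \<open>The square of the first factor has to be the mean-one exponential of
  \<open>exp_grid\<close> with c = 4, whose bracket coefficient is 8. This forces 4 Q in that
  factor, leaves 3 Q for the other and 6 Q on the right.\<close>

lemma exp_2xk:
  "(\<integral>\<^sup>+w. ennreal (exp (2 * xk k w)) \<partial>M) \<le> 1 + (\<integral>\<^sup>+w. ennreal (exp (6 * Qk k w)) \<partial>M)"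
proof -
  have "(\<integral>\<^sup>+w. ennreal (exp (2 * xk k w)) \<partial>M)
    \<le> (\<integral>\<^sup>+w. ennreal (exp (- 4 * Ik k w - 4\<^sup>2 * Qk k w / 2)) + ennreal (exp (6 * Qk k w)) \<partial>M)"
  proof (rule nn_integral_mono)
    fix w
    \<comment> \<open>AM-GM after splitting \<open>exp (- 2 I - Q) = exp (- 2 I - 4 Q) exp (3 Q)\<close>\<close>
    define u v where "u = - 2 * Ik k w - 4 * Qk k w" and "v = 3 * Qk k w"
    have "2 * (exp u * exp v) \<le> (exp u)\<^sup>2 + (exp v)\<^sup>2"
      using sum_squares_bound[of "exp u" "exp v"] by simp
    moreover have "(exp u)\<^sup>2 = exp (- 4 * Ik k w - 4\<^sup>2 * Qk k w / 2)" "(exp v)\<^sup>2 = exp (6 * Qk k w)"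
      by (simp_all add: u_def v_def exp_double[symmetric])
    moreover have "exp u * exp v = exp (2 * xk k w)"
      by (simp add: u_def v_def xk_def mult_exp_exp algebra_simps)
    ultimately have "exp (2 * xk k w) \<le> exp (- 4 * Ik k w - 4\<^sup>2 * Qk k w / 2) + exp (6 * Qk k w)"
      using exp_gt_zero[of "2 * xk k w"] by linarith
    then show "ennreal (exp (2 * xk k w)) \<le> ennreal (exp (- 4 * Ik k w - 4\<^sup>2 * Qk k w / 2)) + ennreal (exp (6 * Qk k w))"
      by (subst ennreal_plus[symmetric]) (auto intro: ennreal_leI simp del: ennreal_plus)
  qed
  also have "\<dots> = 1 + (\<integral>\<^sup>+w. ennreal (exp (6 * Qk k w)) \<partial>M)"
    using exp_grid[of 4 k] by (subst nn_integral_add) auto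
  finally show ?thesis .
qed

lemma exp_x_eq:
  assumes "\<And>k. (\<integral>\<^sup>+w. ennreal (exp (6 * Qk k w)) \<partial>M) \<le> ennreal C" and C: "0 \<le> C"
  shows "(\<integral>\<^sup>+w. ennreal (exp (x_lim w)) \<partial>M) = 1"
proof (rule antisym[OF exp_x_le])
  have "(\<integral>\<^sup>+w. ennreal (exp (2 * xk k w)) \<partial>M) \<le> ennreal (1 + C)" for k
  proof -
    have "(\<integral>\<^sup>+w. ennreal (exp (2 * xk k w)) \<partial>M) \<le> 1 + ennreal C"
      using exp_2xk[of k] assms(1)[of k] by (meson add_left_mono order_trans)
    then show ?thesis using C by simp
  qed
  then show "1 \<le> (\<integral>\<^sup>+w. ennreal (exp (x_lim w)) \<partial>M)"
    using C by (intro nn_integral_exp_ge_1[OF xk_measurable x_lim_measurable xk_lim exp_xk, where C="1 + C"]) auto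
qed

end


section \<open>Exponential moments and the Laplace transform\<close>

text \<open>\<open>tau b t\<close> is the integral of \<open>exp (- b u)\<close> over \<open>[0,t]\<close>.\<close>

definition tau :: "real \<Rightarrow> real \<Rightarrow> real" where
  "tau b t = (if b = 0 then t else (1 - exp (- (b * t))) / b)"

lemma tau_0 [simp]: "tau b 0 = 0"
  by (simp add: tau_def)

lemma tau_deriv: "(tau b has_real_derivative exp (- (b * t))) (at t within S)"
proof (cases "b = 0")
  case True
  then have "tau b = (\<lambda>t. t)" by (auto simp: tau_def)
  then show ?thesis using True by simp
next
  case False
  then have "tau b = (\<lambda>t. (1 - exp (- (b * t))) / b)" by (auto simp: tau_def)
  then show ?thesis using False by (auto intro!: derivative_eq_intros)
qed

lemma tau_mono: "s \<le> t \<Longrightarrow> tau b s \<le> tau b t"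
  by (rule DERIV_nonneg_imp_nondecreasing) (auto intro!: exI[of _ "exp (- (b * _))"] tau_deriv)

lemma tau_pos: "0 < t \<Longrightarrow> 0 < tau b t"
  using DERIV_pos_imp_increasing[of 0 t "tau b"] tau_deriv[of b _ UNIV]
  by (metis exp_gt_zero tau_0)

text \<open>Solution with value l at u = 0 of a Bernoulli equation: its reciprocal solves a linear
  equation, whence \<open>tau\<close> in the denominator. For negative l the denominator may reach
  0, so its positivity has to be carried along.\<close>

definition riccati_sol :: "real \<Rightarrow> real \<Rightarrow> real \<Rightarrow> real \<Rightarrow> real" where
  "riccati_sol b \<kappa> l u = l * exp (- (b * u)) / (1 + l * \<kappa> * tau b u)"

lemma riccati_sol_deriv:
  assumes "1 + l * \<kappa> * tau b u > 0"
  shows "(riccati_sol b \<kappa> l has_real_derivative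
    - (b * riccati_sol b \<kappa> l u) - \<kappa> * (riccati_sol b \<kappa> l u)\<^sup>2) (at u within S)"
proof -
  let ?d = "1 + l * \<kappa> * tau b u"
  have "((\<lambda>u. l * exp (- (b * u)) / (1 + l * \<kappa> * tau b u)) has_real_derivative
    ((l * (exp (- (b * u)) * - b)) * ?d - l * exp (- (b * u)) * (l * \<kappa> * exp (- (b * u)))) / (?d * ?d)) (at u within S)"
    using assms by (auto intro!: derivative_eq_intros tau_deriv)
  also have "((l * (exp (- (b * u)) * - b)) * ?d - l * exp (- (b * u)) * (l * \<kappa> * exp (- (b * u)))) / (?d * ?d)
     = - (b * riccati_sol b \<kappa> l u) - \<kappa> * (riccati_sol b \<kappa> l u)\<^sup>2"
    using assms unfolding riccati_sol_def by (simp add: diff_divide_distrib power2_eq_square mult_ac)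
  finally show ?thesis unfolding riccati_sol_def .
qed

text \<open>\<open>riccati_sol\<close> is the logarithmic derivative of its own denominator, divided
  by \<kappa>.\<close>

lemma riccati_sol_integral:
  assumes pos: "\<And>u. u \<in> {0..t} \<Longrightarrow> 1 + l * \<kappa> * tau b u > 0" and \<kappa>: "\<kappa> \<noteq> 0" and t: "0 \<le> t"
  shows "integral {0..t} (\<lambda>s. riccati_sol b \<kappa> l (t - s)) = ln (1 + l * \<kappa> * tau b t) / \<kappa>"
proof (rule integral_unique)
  have "((\<lambda>s. riccati_sol b \<kappa> l (t - s)) has_integral
    - ln (1 + l * \<kappa> * tau b (t - t)) / \<kappa> - (- ln (1 + l * \<kappa> * tau b (t - 0)) / \<kappa>)) {0..t}"
  proof (rule fundamental_theorem_of_calculus[OF t])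
    fix s assume s: "s \<in> {0..t}"
    then have p: "1 + l * \<kappa> * tau b (t - s) > 0" using pos[of "t - s"] by auto
    have tt: "((\<lambda>s. tau b (t - s)) has_real_derivative - exp (- (b * (t - s)))) (at s within {0..t})"
    proof -
      have "((\<lambda>s. tau b (t - s)) has_real_derivative exp (- (b * (t - s))) * - 1) (at s within {0..t})"
        by (rule DERIV_chain2[where f="tau b" and g="\<lambda>s. t - s", OF tau_deriv])
          (auto intro!: derivative_eq_intros)
      then show ?thesis by simp
    qed
    have "((\<lambda>s. - ln (1 + l * \<kappa> * tau b (t - s)) / \<kappa>) has_real_derivative
        - (inverse (1 + l * \<kappa> * tau b (t - s)) * (l * \<kappa> * - exp (- (b * (t - s))))) / \<kappa>) (at s within {0..t})"
      using p by (auto intro!: derivative_eq_intros tt simp: divide_inverse mult_ac)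
    also have "- (inverse (1 + l * \<kappa> * tau b (t - s)) * (l * \<kappa> * - exp (- (b * (t - s))))) / \<kappa> = riccati_sol b \<kappa> l (t - s)"
      using \<kappa> by (simp add: riccati_sol_def inverse_eq_divide)
    finally show "((\<lambda>s. - ln (1 + l * \<kappa> * tau b (t - s)) / \<kappa>) has_vector_derivative riccati_sol b \<kappa> l (t - s)) (at s within {0..t})"
      by (simp add: has_real_derivative_iff_has_vector_derivative)
  qed
  then show "((\<lambda>s. riccati_sol b \<kappa> l (t - s)) has_integral ln (1 + l * \<kappa> * tau b t) / \<kappa>) {0..t}"
    by simp
qed

text \<open>The margin 1/2 keeps the denominator away from 0 for either sign of l, and on the whole
  interval because \<open>tau\<close> is increasing.\<close>

lemma abs_riccati_sol_le:
  assumes "\<bar>l\<bar> * \<kappa> * tau b t \<le> 1 / 2" and \<kappa>: "0 < \<kappa>" and u: "u \<in> {0..t}"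
  shows "1 / 2 \<le> 1 + l * \<kappa> * tau b u" and "\<bar>riccati_sol b \<kappa> l u\<bar> \<le> 2 * \<bar>l\<bar> * exp (\<bar>b\<bar> * t)"
proof -
  have n: "0 \<le> tau b u" using tau_mono[of 0 u b] u by simp
  have "\<bar>l * \<kappa> * tau b u\<bar> = \<bar>l\<bar> * \<kappa> * tau b u" using n \<kappa> by (simp add: abs_mult)
  also have "\<dots> \<le> \<bar>l\<bar> * \<kappa> * tau b t" using u \<kappa> by (intro mult_left_mono tau_mono) auto
  finally show 1: "1 / 2 \<le> 1 + l * \<kappa> * tau b u" using assms(1) by linarith
  have "- (b * u) \<le> \<bar>b\<bar> * u" using u by (simp add: abs_if mult_nonneg_nonneg)
  also have "\<dots> \<le> \<bar>b\<bar> * t" using u by (intro mult_left_mono) auto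
  finally have e: "exp (- (b * u)) \<le> exp (\<bar>b\<bar> * t)" by simp
  have "\<bar>riccati_sol b \<kappa> l u\<bar> = \<bar>l\<bar> * exp (- (b * u)) / (1 + l * \<kappa> * tau b u)"
    using 1 by (simp add: riccati_sol_def abs_mult)
  also have "\<dots> \<le> \<bar>l\<bar> * exp (\<bar>b\<bar> * t) / (1 / 2)"
    using 1 e by (intro frac_le mult_left_mono mult_nonneg_nonneg) auto
  finally show "\<bar>riccati_sol b \<kappa> l u\<bar> \<le> 2 * \<bar>l\<bar> * exp (\<bar>b\<bar> * t)" by simp
qed

text \<open>Jensen's inequality. It reduces exponential moments of the time average in
  \<open>Qk\<close> to exponential moments at single times.\<close>

lemma exp_average_le:
  fixes f :: "nat \<Rightarrow> real"
  shows "exp ((\<Sum>i<Suc k. f i) / real (Suc k)) \<le> (\<Sum>i<Suc k. exp (f i)) / real (Suc k)"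
  using convex_on_sum[of "{..<Suc k}" UNIV exp "\<lambda>_. 1 / real (Suc k)" f] exp_convex
    lessThan_empty_iff[of "Suc k"]
  by (simp add: sum_divide_distrib del: of_nat_Suc sum.lessThan_Suc)

context cir
begin

lemma riccati_locale:
  assumes "0 < t" and "\<And>u. u \<in> {0..t} \<Longrightarrow> 1 + l * (\<sigma>\<^sup>2 / 2) * tau b u > 0"
  shows "cir_riccati M F W a b \<sigma> y Y t (\<lambda>s. riccati_sol b (\<sigma>\<^sup>2 / 2) l (t - s))"
proof
  fix s assume s: "s \<in> {0..t}"
  have "((\<lambda>s. riccati_sol b (\<sigma>\<^sup>2 / 2) l (t - s)) has_real_derivative
    (- (b * riccati_sol b (\<sigma>\<^sup>2 / 2) l (t - s)) - \<sigma>\<^sup>2 / 2 * (riccati_sol b (\<sigma>\<^sup>2 / 2) l (t - s))\<^sup>2) * (- 1)) (at s within {0..t})"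
    by (rule DERIV_chain2[OF riccati_sol_deriv[where S=UNIV]])
      (use assms(2)[of "t - s"] s in \<open>auto intro!: derivative_eq_intros\<close>)
  then show "((\<lambda>s. riccati_sol b (\<sigma>\<^sup>2 / 2) l (t - s)) has_real_derivative
      b * riccati_sol b (\<sigma>\<^sup>2 / 2) l (t - s) + \<sigma>\<^sup>2 / 2 * (riccati_sol b (\<sigma>\<^sup>2 / 2) l (t - s))\<^sup>2) (at s within {0..t})"
    by (simp add: algebra_simps)
qed (use assms in auto)

text \<open>Taking l = - \<eta> puts + \<eta> X s into \<open>x_lim\<close>, so the inequality
  \<open>exp_x_le\<close> already suffices. The exponent collects lower bounds for the initial value
  of the Riccati solution and for its integral; the latter is at least - ln 2 / (\<sigma>^2 / 2)
  because the denominator is at least 1/2.\<close>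

lemma exp_moment_bound:
  assumes a: "0 \<le> a" and \<sigma>: "0 < \<sigma>" and y: "0 \<le> y" and t: "0 < t"
    and \<eta>: "0 \<le> \<eta>" "\<eta> * (\<sigma>\<^sup>2 / 2) * tau b t \<le> 1 / 2"
    and s: "s \<in> {0..t}"
  shows "(\<integral>\<^sup>+w. ennreal (exp (\<eta> * X s w)) \<partial>M)
    \<le> ennreal (exp (2 * \<eta> * exp (\<bar>b\<bar> * t) * y + a * ln 2 / (\<sigma>\<^sup>2 / 2)))"
\<comment> \<open>The Riccati locale requires a positive horizon.\<close>
proof (cases "s = 0")
  case True
  have "(\<integral>\<^sup>+w. ennreal (exp (\<eta> * X s w)) \<partial>M) = (\<integral>\<^sup>+w. ennreal (exp (\<eta> * y)) \<partial>M)"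
    using X_0 True by (intro nn_integral_cong_AE) auto
  also have "\<dots> = ennreal (exp (\<eta> * y))" by (simp add: emeasure_space_1)
  also have "\<dots> \<le> ennreal (exp (2 * \<eta> * exp (\<bar>b\<bar> * t) * y + a * ln 2 / (\<sigma>\<^sup>2 / 2)))"
  proof -
    have "1 \<le> 2 * exp (\<bar>b\<bar> * t)" using t one_le_exp_iff[of "\<bar>b\<bar> * t"] by (simp del: one_le_exp_iff)
    then have "\<eta> * y * 1 \<le> \<eta> * y * (2 * exp (\<bar>b\<bar> * t))" using \<eta> y by (intro mult_left_mono) auto
    moreover have "0 \<le> a * ln 2 / (\<sigma>\<^sup>2 / 2)" using a by auto
    ultimately show ?thesis by (simp add: algebra_simps)
  qed
  finally show ?thesis .
next
  case False
  then have s0: "0 < s" "s \<le> t" using s by auto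
  let ?\<kappa> = "\<sigma>\<^sup>2 / 2"
  let ?\<psi> = "\<lambda>r. riccati_sol b ?\<kappa> (- \<eta>) (s - r)"
  have \<kappa>: "0 < ?\<kappa>" using \<sigma> by simp
  have le: "\<bar>- \<eta>\<bar> * ?\<kappa> * tau b t \<le> 1 / 2" using \<eta> by simp
  have half: "1 / 2 \<le> 1 + (- \<eta>) * ?\<kappa> * tau b u" if "u \<in> {0..s}" for u
    using abs_riccati_sol_le(1)[OF le \<kappa>, of u] that s0 by auto
  then have pos: "0 < 1 + (- \<eta>) * ?\<kappa> * tau b u" if "u \<in> {0..s}" for u
    using that by fastforce
  interpret R: cir_riccati M F W a b \<sigma> y Y s ?\<psi>
    by (rule riccati_locale[OF s0(1) pos])
  have \<psi>0: "- (2 * \<eta> * exp (\<bar>b\<bar> * t)) \<le> ?\<psi> 0"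
    using abs_riccati_sol_le(2)[OF le \<kappa>, of s] s0 \<eta> by auto
  have \<psi>s: "?\<psi> s = - \<eta>" by (simp add: riccati_sol_def)
  have "integral {0..s} ?\<psi> = ln (1 + (- \<eta>) * ?\<kappa> * tau b s) / ?\<kappa>"
    by (rule riccati_sol_integral) (use pos \<kappa> s0 in auto)
  also have "\<dots> \<ge> ln (1 / 2) / ?\<kappa>"
    using half[of s] s0 \<kappa> by (intro divide_right_mono ln_mono) auto
  finally have J: "- (ln 2 / ?\<kappa>) \<le> integral {0..s} ?\<psi>" by (simp add: ln_div)
  let ?K = "2 * \<eta> * exp (\<bar>b\<bar> * t) * y + a * ln 2 / ?\<kappa>"
  have "(\<integral>\<^sup>+w. ennreal (exp (\<eta> * X s w)) \<partial>M) \<le> (\<integral>\<^sup>+w. ennreal (exp ?K) * ennreal (exp (R.x_lim w)) \<partial>M)"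
  proof (rule nn_integral_mono_AE)
    show "AE w in M. ennreal (exp (\<eta> * X s w)) \<le> ennreal (exp ?K) * ennreal (exp (R.x_lim w))"
      using X_0
    proof eventually_elim
      case (elim w)
      have "R.x_lim w = \<eta> * X s w + ?\<psi> 0 * y + a * integral {0..s} ?\<psi>"
        unfolding R.x_lim_def \<psi>s elim by simp
      moreover have "- (2 * \<eta> * exp (\<bar>b\<bar> * t)) * y \<le> ?\<psi> 0 * y" by (rule mult_right_mono[OF \<psi>0 y])
      moreover have "a * - (ln 2 / ?\<kappa>) \<le> a * integral {0..s} ?\<psi>" by (rule mult_left_mono[OF J a])
      ultimately have "\<eta> * X s w \<le> ?K + R.x_lim w" by simp
      then show ?case by (simp add: ennreal_mult[symmetric] mult_exp_exp)
    qed
  qed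
  also have "\<dots> = ennreal (exp ?K) * (\<integral>\<^sup>+w. ennreal (exp (R.x_lim w)) \<partial>M)"
    by (rule nn_integral_cmult) measurable
  also have "\<dots> \<le> ennreal (exp ?K) * 1"
    by (intro mult_left_mono R.exp_x_le) auto
  finally show ?thesis by simp
qed

text \<open>The third condition on l makes 6 Qk at most the grid average of \<eta> X: the Riccati
  solution is bounded by 2 l exp (|b| t), and 6 times the square of this bound gives the 24. Then
  \<open>exp_moment_bound\<close> supplies the constant for \<open>exp_x_eq\<close>.\<close>

lemma laplace:
  assumes a: "0 \<le> a" and \<sigma>: "0 < \<sigma>" and y: "0 \<le> y" and t: "0 < t"
    and \<eta>: "0 < \<eta>" "\<eta> * (\<sigma>\<^sup>2 / 2) * tau b t \<le> 1 / 2"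
    and l: "0 \<le> l" "l \<le> \<eta>" "24 * l\<^sup>2 * exp (2 * \<bar>b\<bar> * t) * \<sigma>\<^sup>2 * t \<le> \<eta>"
  shows "(\<integral>\<^sup>+w. ennreal (exp (- l * X t w)) \<partial>M)
    = ennreal (exp (- (y * (l * exp (- (b * t)) / (1 + l * (\<sigma>\<^sup>2 / 2) * tau b t))))
      * (1 + l * (\<sigma>\<^sup>2 / 2) * tau b t) powr (- (a / (\<sigma>\<^sup>2 / 2))))"
proof -
  let ?\<kappa> = "\<sigma>\<^sup>2 / 2"
  let ?\<psi> = "\<lambda>r. riccati_sol b ?\<kappa> l (t - r)"
  have \<kappa>: "0 < ?\<kappa>" using \<sigma> by simp
  have "l * ?\<kappa> * tau b t \<le> \<eta> * ?\<kappa> * tau b t"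
    using l \<kappa> tau_pos[OF t, of b] by (intro mult_right_mono) auto
  then have le: "\<bar>l\<bar> * ?\<kappa> * tau b t \<le> 1 / 2" using \<eta> l by simp
  have half: "1 / 2 \<le> 1 + l * ?\<kappa> * tau b u" if "u \<in> {0..t}" for u
    using abs_riccati_sol_le(1)[OF le \<kappa> that] .
  then have pos: "0 < 1 + l * ?\<kappa> * tau b u" if "u \<in> {0..t}" for u
    using that by fastforce
  interpret R: cir_riccati M F W a b \<sigma> y Y t ?\<psi>
    by (rule riccati_locale[OF t pos])
  let ?K = "exp (2 * \<eta> * exp (\<bar>b\<bar> * t) * y + a * ln 2 / ?\<kappa>)"
  have Q: "(\<integral>\<^sup>+w. ennreal (exp (6 * R.Qk k w)) \<partial>M) \<le> ennreal ?K" for k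
  proof -
    let ?p = "upt_grid t k"
    have n: "0 < real (Suc k)" by simp
    have "(\<integral>\<^sup>+w. ennreal (exp (6 * R.Qk k w)) \<partial>M)
      \<le> (\<integral>\<^sup>+w. ennreal (1 / real (Suc k)) * (\<Sum>i<Suc k. ennreal (exp (\<eta> * X (?p i) w))) \<partial>M)"
    proof (rule nn_integral_mono)
      fix w assume w: "w \<in> space M"
      \<comment> \<open>Every cell has length t / (k + 1), so \<open>Qk\<close> is t times an
        average.\<close>
      have "6 * R.Qk k w \<le> (\<Sum>i<Suc k. \<eta> * X (?p i) w) / real (Suc k)"
        unfolding R.Qk_def sum_distrib_left sum_divide_distrib
      proof (rule sum_mono)
        fix i assume i: "i \<in> {..<Suc k}"
        have r: "?p i \<in> {0..t}" using upt_grid_range[OF t, of i k] i by auto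
        have "(?\<psi> (?p i))\<^sup>2 \<le> (2 * \<bar>l\<bar> * exp (\<bar>b\<bar> * t))\<^sup>2"
          using abs_riccati_sol_le(2)[OF le \<kappa>, of "t - ?p i"] r by (intro power2_le_iff_abs_le[THEN iffD2]) auto
        also have "\<dots> = 4 * l\<^sup>2 * exp (2 * \<bar>b\<bar> * t)"
          by (simp add: power_mult_distrib exp_double[symmetric] mult.assoc)
        finally have "6 * (?\<psi> (?p i))\<^sup>2 * \<sigma>\<^sup>2 * t \<le> 6 * (4 * l\<^sup>2 * exp (2 * \<bar>b\<bar> * t)) * \<sigma>\<^sup>2 * t"
          using t by (intro mult_right_mono mult_left_mono) auto
        also have "\<dots> \<le> \<eta>" using l(3) by simp
        finally have *: "6 * (?\<psi> (?p i))\<^sup>2 * \<sigma>\<^sup>2 * t \<le> \<eta>" .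
        have "6 * ((?\<psi> (?p i) * (\<sigma> * sqrt (X (?p i) w)))\<^sup>2 * (?p (Suc i) - ?p i))
          = (6 * (?\<psi> (?p i))\<^sup>2 * \<sigma>\<^sup>2 * t) * X (?p i) w / real (Suc k)"
          unfolding upt_grid_step using X_nonneg[OF w, of "?p i"] by (simp add: power_mult_distrib)
        also have "\<dots> \<le> \<eta> * X (?p i) w / real (Suc k)"
          using * X_nonneg[OF w, of "?p i"] by (intro divide_right_mono mult_right_mono) auto
        finally show "6 * ((?\<psi> (?p i) * (\<sigma> * sqrt (X (?p i) w)))\<^sup>2 * (?p (Suc i) - ?p i))
          \<le> \<eta> * X (?p i) w / real (Suc k)" .
      qed
      then have "exp (6 * R.Qk k w) \<le> exp ((\<Sum>i<Suc k. \<eta> * X (?p i) w) / real (Suc k))"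
        by (simp only: exp_le_cancel_iff)
      also have "\<dots> \<le> (\<Sum>i<Suc k. exp (\<eta> * X (?p i) w)) / real (Suc k)"
        by (rule exp_average_le)
      finally have "ennreal (exp (6 * R.Qk k w)) \<le> ennreal (1 / real (Suc k) * (\<Sum>i<Suc k. exp (\<eta> * X (?p i) w)))"
        by (intro ennreal_leI) simp
      also have "\<dots> = ennreal (1 / real (Suc k)) * (\<Sum>i<Suc k. ennreal (exp (\<eta> * X (?p i) w)))"
        by (subst ennreal_mult) (auto intro!: sum_nonneg simp: sum_ennreal simp del: of_nat_Suc sum.lessThan_Suc)
      finally show "ennreal (exp (6 * R.Qk k w)) \<le> ennreal (1 / real (Suc k)) * (\<Sum>i<Suc k. ennreal (exp (\<eta> * X (?p i) w)))" .
    qed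
    also have "\<dots> = ennreal (1 / real (Suc k)) * (\<Sum>i<Suc k. (\<integral>\<^sup>+w. ennreal (exp (\<eta> * X (?p i) w)) \<partial>M))"
      by (subst nn_integral_cmult, measurable, subst nn_integral_sum) (auto simp del: of_nat_Suc sum.lessThan_Suc)
    also have "\<dots> \<le> ennreal (1 / real (Suc k)) * (\<Sum>i<Suc k. ennreal ?K)"
    proof (intro mult_left_mono sum_mono)
      fix i assume i: "i \<in> {..<Suc k}"
      have "?p i \<in> {0..t}" using upt_grid_range[OF t, of i k] i by auto
      then show "(\<integral>\<^sup>+w. ennreal (exp (\<eta> * X (?p i) w)) \<partial>M) \<le> ennreal ?K"
        using \<eta> by (intro exp_moment_bound a \<sigma> y t) auto
    qed simp
    also have "\<dots> = ennreal (1 / real (Suc k)) * ennreal (real (Suc k) * ?K)"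
      by (subst sum_ennreal) (simp_all del: of_nat_Suc)
    also have "\<dots> = ennreal ?K"
      by (subst ennreal_mult[symmetric]) (simp_all del: of_nat_Suc)
    finally show ?thesis .
  qed
  have x1: "(\<integral>\<^sup>+w. ennreal (exp (R.x_lim w)) \<partial>M) = 1"
    by (rule R.exp_x_eq[OF Q]) simp
  have \<psi>t: "?\<psi> t = l" by (simp add: riccati_sol_def)
  have \<psi>0: "?\<psi> 0 = l * exp (- (b * t)) / (1 + l * ?\<kappa> * tau b t)" by (simp add: riccati_sol_def)
  have J: "integral {0..t} ?\<psi> = ln (1 + l * ?\<kappa> * tau b t) / ?\<kappa>"
    by (rule riccati_sol_integral) (use pos \<kappa> t in auto)
  let ?G = "exp (- (y * (l * exp (- (b * t)) / (1 + l * ?\<kappa> * tau b t)))) * (1 + l * ?\<kappa> * tau b t) powr (- (a / ?\<kappa>))"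
  have G: "?G = exp (- (?\<psi> 0 * y) - a * integral {0..t} ?\<psi>)"
    unfolding \<psi>0 J using pos[of t] t by (simp add: powr_def mult_exp_exp mult.commute)
  have "(\<integral>\<^sup>+w. ennreal (exp (- l * X t w)) \<partial>M) = (\<integral>\<^sup>+w. ennreal ?G * ennreal (exp (R.x_lim w)) \<partial>M)"
  proof (rule nn_integral_cong_AE)
    show "AE w in M. ennreal (exp (- l * X t w)) = ennreal ?G * ennreal (exp (R.x_lim w))"
      using X_0
    proof eventually_elim
      case (elim w)
      have "exp (- l * X t w) = ?G * exp (R.x_lim w)"
        unfolding G R.x_lim_def \<psi>t elim mult_exp_exp by simp
      then show ?case by (metis ennreal_mult'' exp_ge_zero)
    qed
  qed
  also have "\<dots> = ennreal ?G * (\<integral>\<^sup>+w. ennreal (exp (R.x_lim w)) \<partial>M)"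
    by (rule nn_integral_cmult) measurable
  also have "\<dots> = ennreal ?G" using x1 by simp
  finally show ?thesis .
qed

end


section \<open>Uniqueness of laws with exponential moments\<close>

lemma norm_exp_minus_1_le:
  fixes u :: complex
  shows "norm (exp u - 1) \<le> norm u * exp (norm u)"
proof -
  have "norm (exp u - exp 0) \<le> exp (norm u) * norm (u - 0)"
  proof (rule field_differentiable_bound[where S="cball 0 (norm u)"])
    fix z :: complex assume z: "z \<in> cball 0 (norm u)"
    show "(exp has_field_derivative exp z) (at z within cball 0 (norm u))"
      by (auto intro!: derivative_eq_intros)
    show "norm (exp z) \<le> exp (norm u)" using z norm_exp[of z] by (auto intro: order_trans)
  qed auto
  then show ?thesis by (simp add: mult.commute)
qed

definition cmgf :: "real measure \<Rightarrow> complex \<Rightarrow> complex" where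
  "cmgf \<mu> z = (CLINT x|\<mu>. exp (z * of_real x))"

context real_distribution
begin

lemma cmgf_integrable:
  assumes "integrable M (\<lambda>x. exp (\<epsilon> * \<bar>x\<bar>))" and "\<bar>Re z\<bar> \<le> \<epsilon>"
  shows "complex_integrable M (\<lambda>x. exp (z * of_real x))"
proof (rule Bochner_Integration.integrable_bound[OF assms(1)])
  show "AE x in M. norm (exp (z * of_real x)) \<le> norm (exp (\<epsilon> * \<bar>x\<bar>))"
  proof (rule AE_I2)
    fix x
    have "Re z * x \<le> \<bar>Re z\<bar> * \<bar>x\<bar>" using abs_ge_self[of "Re z * x"] by (simp add: abs_mult)
    also have "\<dots> \<le> \<epsilon> * \<bar>x\<bar>" using assms(2) by (intro mult_right_mono) auto
    finally show "norm (exp (z * of_real x)) \<le> norm (exp (\<epsilon> * \<bar>x\<bar>))" by simp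
  qed
qed measurable

text \<open>Differentiation under the integral, by dominated convergence along sequences.\<close>

lemma cmgf_holomorphic:
  assumes int: "integrable M (\<lambda>x. exp (\<epsilon> * \<bar>x\<bar>))"
  shows "cmgf M holomorphic_on {z. \<bar>Re z\<bar> < \<epsilon>}"
proof -
  have "(cmgf M has_field_derivative (CLINT x|M. of_real x * exp (z * of_real x))) (at z)" if z: "\<bar>Re z\<bar> < \<epsilon>" for z
    unfolding has_field_derivative_iff tendsto_at_iff_sequentially comp_def
  proof (intro allI impI)
    fix X :: "nat \<Rightarrow> complex" assume X: "\<forall>i. X i \<in> UNIV - {z}" "X \<longlonglongrightarrow> z"
    \<comment> \<open>Two reserves of width r fit between |Re z| and \<epsilon>: one for the
      increment of z, one to absorb a factor |x| through |x| \<le> exp (r |x|) / r.\<close>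
    define r where "r = (\<epsilon> - \<bar>Re z\<bar>) / 2"
    have r: "r > 0" using z by (simp add: r_def)
    from X(2) r obtain N where N: "\<And>n. n \<ge> N \<Longrightarrow> dist (X n) z < r"
      by (meson metric_LIMSEQ_D)
    define Y where "Y = (\<lambda>n. X (n + N))"
    have Y: "Y n \<noteq> z" "norm (Y n - z) \<le> r" for n
      using X(1) N[of "n + N"] by (auto simp: Y_def dist_norm less_imp_le)
    have Yz: "Y \<longlonglongrightarrow> z" using LIMSEQ_ignore_initial_segment[OF X(2), of N] by (simp add: Y_def)
    have YE: "\<bar>Re (Y n)\<bar> \<le> \<epsilon>" for n
    proof -
      have "\<bar>Re (Y n - z)\<bar> \<le> r" using abs_Re_le_cmod[of "Y n - z"] Y(2)[of n] by linarith
      then have "\<bar>Re (Y n)\<bar> \<le> \<bar>Re z\<bar> + r" by simp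
      also have "\<dots> \<le> \<epsilon>" using z by (simp add: r_def field_simps)
      finally show ?thesis .
    qed
    have "(\<lambda>n. CLINT x|M. (exp (Y n * of_real x) - exp (z * of_real x)) / (Y n - z))
      \<longlonglongrightarrow> (CLINT x|M. of_real x * exp (z * of_real x))"
    proof (rule integral_dominated_convergence[where w="\<lambda>x. 1 / r * exp (\<epsilon> * \<bar>x\<bar>)"])
      show "integrable M (\<lambda>x. 1 / r * exp (\<epsilon> * \<bar>x\<bar>))" using int by simp
      show "AE x in M. (\<lambda>n. (exp (Y n * of_real x) - exp (z * of_real x)) / (Y n - z)) \<longlonglongrightarrow> of_real x * exp (z * of_real x)"
      proof (rule AE_I2)
        fix x :: real
        have "((\<lambda>w. exp (w * of_real x)) has_field_derivative of_real x * exp (z * of_real x)) (at z)"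
          by (auto intro!: derivative_eq_intros simp: mult.commute)
        then have "((\<lambda>w. (exp (w * of_real x) - exp (z * of_real x)) / (w - z)) \<longlongrightarrow> of_real x * exp (z * of_real x)) (at z)"
          by (simp add: has_field_derivative_iff)
        then show "(\<lambda>n. (exp (Y n * of_real x) - exp (z * of_real x)) / (Y n - z)) \<longlonglongrightarrow> of_real x * exp (z * of_real x)"
          unfolding tendsto_at_iff_sequentially comp_def using Y(1) Yz by auto
      qed
      show "AE x in M. norm ((exp (Y n * of_real x) - exp (z * of_real x)) / (Y n - z)) \<le> 1 / r * exp (\<epsilon> * \<bar>x\<bar>)" for n
      proof (rule AE_I2)
        fix x :: real
        let ?h = "Y n - z"
        have h: "norm ?h > 0" using Y(1)[of n] by simp
        have "exp (Y n * of_real x) - exp (z * of_real x) = exp (z * of_real x) * (exp (?h * of_real x) - 1)"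
          by (simp add: algebra_simps mult_exp_exp)
        then have "norm (exp (Y n * of_real x) - exp (z * of_real x)) = norm (exp (z * of_real x)) * norm (exp (?h * of_real x) - 1)"
          by (simp only: norm_mult)
        also have "norm (exp (z * of_real x)) = exp (Re z * x)" by simp
        also have "exp (Re z * x) * norm (exp (?h * of_real x) - 1) \<le> exp (Re z * x) * (norm (?h * of_real x) * exp (norm (?h * of_real x)))"
          by (intro mult_left_mono norm_exp_minus_1_le) simp
        also have "\<dots> \<le> exp (\<bar>Re z\<bar> * \<bar>x\<bar>) * (norm ?h * \<bar>x\<bar> * exp (r * \<bar>x\<bar>))"
        proof (intro mult_mono)
          have "Re z * x \<le> \<bar>Re z\<bar> * \<bar>x\<bar>" using abs_ge_self[of "Re z * x"] by (simp add: abs_mult)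
          then show "exp (Re z * x) \<le> exp (\<bar>Re z\<bar> * \<bar>x\<bar>)" by simp
          show "exp (norm (?h * of_real x)) \<le> exp (r * \<bar>x\<bar>)" using Y(2)[of n] by (simp add: norm_mult mult_right_mono)
        qed (auto simp: norm_mult)
        also have "\<dots> \<le> exp (\<bar>Re z\<bar> * \<bar>x\<bar>) * (norm ?h * (1 / r * exp (r * \<bar>x\<bar>)) * exp (r * \<bar>x\<bar>))"
        proof -
          have "r * \<bar>x\<bar> \<le> exp (r * \<bar>x\<bar>)" using exp_ge_add_one_self[of "r * \<bar>x\<bar>"] by linarith
          then have "\<bar>x\<bar> \<le> 1 / r * exp (r * \<bar>x\<bar>)" using r by (simp add: field_simps)
          then show ?thesis by (intro mult_left_mono mult_right_mono) auto
        qed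
        also have "\<dots> = norm ?h * (1 / r * exp (\<bar>Re z\<bar> * \<bar>x\<bar> + r * \<bar>x\<bar> + r * \<bar>x\<bar>))"
          by (simp add: exp_add exp_double power2_eq_square)
        also have "\<bar>Re z\<bar> * \<bar>x\<bar> + r * \<bar>x\<bar> + r * \<bar>x\<bar> = \<epsilon> * \<bar>x\<bar>"
          by (simp add: r_def field_simps)
        finally show "norm ((exp (Y n * of_real x) - exp (z * of_real x)) / (Y n - z)) \<le> 1 / r * exp (\<epsilon> * \<bar>x\<bar>)"
          using h by (simp add: norm_divide pos_divide_le_eq mult.commute)
      qed
    qed auto
    moreover have "(CLINT x|M. (exp (Y n * of_real x) - exp (z * of_real x)) / (Y n - z)) = (cmgf M (Y n) - cmgf M z) / (Y n - z)" for n
      unfolding cmgf_def using cmgf_integrable[OF int YE[of n]] cmgf_integrable[OF int, of z] z by simp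
    ultimately have "(\<lambda>n. (cmgf M (Y n) - cmgf M z) / (Y n - z)) \<longlonglongrightarrow> (CLINT x|M. of_real x * exp (z * of_real x))"
      by (simp only:)
    then show "(\<lambda>n. (cmgf M (X n) - cmgf M z) / (X n - z)) \<longlonglongrightarrow> (CLINT x|M. of_real x * exp (z * of_real x))"
      unfolding Y_def by (rule LIMSEQ_offset)
  qed
  then show ?thesis
    by (auto simp: holomorphic_on_def field_differentiable_def intro: has_field_derivative_at_within)
qed

end

text \<open>Both transforms are holomorphic on the strip |Re z| < \<epsilon>, which contains the
  imaginary axis. Agreement on a segment accumulating at 0 therefore extends to the characteristic
  functions.\<close>

lemma mgf_unique:
  assumes \<mu>: "real_distribution \<mu>" and \<nu>: "real_distribution \<nu>" and e: "0 < \<epsilon>" and l0: "0 < l0"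
    and int: "integrable \<mu> (\<lambda>x. exp (\<epsilon> * \<bar>x\<bar>))" "integrable \<nu> (\<lambda>x. exp (\<epsilon> * \<bar>x\<bar>))"
    and eq: "\<And>l. 0 < l \<Longrightarrow> l < l0 \<Longrightarrow> (LINT x|\<mu>. exp (- l * x)) = (LINT x|\<nu>. exp (- l * x))"
  shows "\<mu> = \<nu>"
proof (rule Levy_uniqueness[OF \<mu> \<nu>], rule ext)
  fix t :: real
  let ?S = "{z. \<bar>Re z\<bar> < \<epsilon>}"
  let ?U = "(\<lambda>l. - complex_of_real l) ` {0<..<min l0 \<epsilon>}"
  have S: "?S = {z. Re z < \<epsilon>} \<inter> {z. Re z > - \<epsilon>}" by auto
  have "cmgf \<mu> (\<i> * of_real t) - cmgf \<nu> (\<i> * of_real t) = 0"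
  proof (rule analytic_continuation[where f="\<lambda>z. cmgf \<mu> z - cmgf \<nu> z" and S="?S" and U="?U" and \<xi>=0])
    show "(\<lambda>z. cmgf \<mu> z - cmgf \<nu> z) holomorphic_on ?S"
      by (intro holomorphic_on_diff real_distribution.cmgf_holomorphic \<mu> \<nu> int)
    show "open ?S" unfolding S by (intro open_Int open_halfspace_Re_lt open_halfspace_Re_gt)
    show "connected ?S" unfolding S
      by (intro convex_connected convex_Int convex_halfspace_Re_lt convex_halfspace_Re_gt)
    show "?U \<subseteq> ?S" by auto
    show "0 islimpt ?U"
      unfolding islimpt_approachable
    proof (intro allI impI)
      fix d :: real assume d: "0 < d"
      let ?l = "min (min l0 \<epsilon>) d / 2"
      have "?l \<in> {0<..<min l0 \<epsilon>}" "?l < d" "0 < ?l" using d l0 e by auto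
      then show "\<exists>x'\<in>?U. x' \<noteq> 0 \<and> dist x' 0 < d"
        by (intro bexI[of _ "- complex_of_real ?l"]) (auto simp del: of_real_divide)
    qed
    fix z assume "z \<in> ?U"
    then obtain l where l: "0 < l" "l < l0" "z = - complex_of_real l" by auto
    have "cmgf m z = of_real (LINT x|m. exp (- l * x))" for m
      unfolding cmgf_def l(3) by (subst integral_complex_of_real[symmetric]) (simp flip: exp_of_real)
    then show "cmgf \<mu> z - cmgf \<nu> z = 0" using eq[OF l(1,2)] by simp
  qed (use e in auto)
  moreover have "char m t = cmgf m (\<i> * of_real t)" for m
    unfolding char_def cmgf_def by (simp add: mult.assoc)
  ultimately show "char \<mu> t = char \<nu> t" by simp
qed


section \<open>Gamma laws\<close>

lemma power_le_fact_exp: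
  fixes y :: real
  assumes "0 \<le> y"
  shows "y ^ k \<le> fact k * exp y"
proof -
  have "(\<Sum>n\<in>{k}. inverse (fact n) * y ^ n) \<le> (\<Sum>n. inverse (fact n) * y ^ n)"
    using assms by (intro sum_le_suminf summable_exp) auto
  then have "y ^ k / fact k \<le> exp y" by (simp add: exp_def divide_inverse mult.commute)
  then show ?thesis by (simp add: field_simps)
qed

definition gamma_dens :: "real \<Rightarrow> real \<Rightarrow> real" where
  "gamma_dens p x = indicator {0..} x * x powr (p - 1) / exp x / Gamma p"

text \<open>The case \<open>p = 0\<close> is the weak limit \<open>p \<rightarrow> 0\<close>; it occurs for \<open>a = 0\<close>.\<close>

definition gamma_law :: "real \<Rightarrow> real measure" where
  "gamma_law p = (if p = 0 then return borel 0 else density lborel (gamma_dens p))"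

lemma gamma_dens_measurable [measurable]: "gamma_dens p \<in> borel_measurable borel"
  unfolding gamma_dens_def by measurable

lemma gamma_dens_nonneg: "0 < p \<Longrightarrow> 0 \<le> gamma_dens p x"
  by (auto simp: gamma_dens_def less_imp_le)

lemma sets_gamma_law [simp, measurable_cong]: "sets (gamma_law p) = sets borel"
  by (simp add: gamma_law_def)

lemma space_gamma_law [simp]: "space (gamma_law p) = UNIV"
  by (simp add: gamma_law_def)

text \<open>The substitution x -> (1 - s) x in Euler's integral; s = 0 gives total mass 1 and s =
  1/2 the constant in \<open>gamma_mean_integrable_aux\<close>.\<close>

lemma nn_integral_gamma_exp:
  assumes p: "0 \<le> p" and s: "s < 1"
  shows "(\<integral>\<^sup>+x. ennreal (exp (s * x)) \<partial>gamma_law p) = ennreal ((1 - s) powr (- p))"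
proof (cases "p = 0")
  case True
  then show ?thesis using s by (simp add: gamma_law_def nn_integral_return)
next
  case False
  then have p: "0 < p" using p by simp
  let ?h = "\<lambda>x::real. indicator {0..} x * x powr (p - 1) / exp x"
  have "ennreal (Gamma p) = (\<integral>\<^sup>+x. ennreal (?h x) \<partial>lborel)"
    by (rule Gamma_conv_nn_integral_real[OF p])
  also have "\<dots> = ennreal (1 - s) * (\<integral>\<^sup>+x. ennreal (?h ((1 - s) * x)) \<partial>lborel)"
    using s by (subst nn_integral_real_affine[where c="1 - s" and t=0]) auto
  also have "\<dots> = ennreal (1 - s) * (\<integral>\<^sup>+x. ennreal ((1 - s) powr (p - 1) * Gamma p) * ennreal (gamma_dens p x * exp (s * x)) \<partial>lborel)"
  proof (intro arg_cong2[where f="(*)"] refl nn_integral_cong)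
    fix x :: real
    have "?h ((1 - s) * x) = ((1 - s) powr (p - 1) * Gamma p) * (gamma_dens p x * exp (s * x))"
    proof (cases "0 \<le> x")
      case True
      then have "((1 - s) * x) powr (p - 1) = (1 - s) powr (p - 1) * x powr (p - 1)"
        using s by (intro powr_mult)
      moreover have "exp ((1 - s) * x) = exp x / exp (s * x)" by (simp add: exp_diff left_diff_distrib)
      ultimately show ?thesis using True s Gamma_real_pos[OF p] by (simp add: gamma_dens_def)
    next
      case False
      then have "\<not> 0 \<le> (1 - s) * x" using s by (simp add: zero_le_mult_iff)
      then show ?thesis using False by (simp add: gamma_dens_def)
    qed
    then show "ennreal (?h ((1 - s) * x)) = ennreal ((1 - s) powr (p - 1) * Gamma p) * ennreal (gamma_dens p x * exp (s * x))"
      using Gamma_real_pos[OF p] gamma_dens_nonneg[OF p] by (simp add: ennreal_mult)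
  qed
  also have "\<dots> = ennreal (1 - s) * (ennreal ((1 - s) powr (p - 1) * Gamma p) * (\<integral>\<^sup>+x. ennreal (gamma_dens p x * exp (s * x)) \<partial>lborel))"
    by (subst nn_integral_cmult) auto
  also have "(\<integral>\<^sup>+x. ennreal (gamma_dens p x * exp (s * x)) \<partial>lborel) = (\<integral>\<^sup>+x. ennreal (exp (s * x)) \<partial>gamma_law p)"
    using False gamma_dens_nonneg[OF p] by (simp add: gamma_law_def nn_integral_density ennreal_mult)
  also have "ennreal (1 - s) * (ennreal ((1 - s) powr (p - 1) * Gamma p) * (\<integral>\<^sup>+x. ennreal (exp (s * x)) \<partial>gamma_law p))
    = ennreal (Gamma p) * (ennreal ((1 - s) powr p) * (\<integral>\<^sup>+x. ennreal (exp (s * x)) \<partial>gamma_law p))"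
  proof -
    have "(1 - s) * ((1 - s) powr (p - 1) * Gamma p) = Gamma p * (1 - s) powr p"
      using s by (simp add: powr_mult_base)
    then have "ennreal (1 - s) * ennreal ((1 - s) powr (p - 1) * Gamma p) = ennreal (Gamma p) * ennreal ((1 - s) powr p)"
      using s Gamma_real_pos[OF p] by (simp add: ennreal_mult[symmetric])
    then show ?thesis by (simp add: mult.assoc[symmetric])
  qed
  finally have eq: "ennreal (Gamma p) * 1 = ennreal (Gamma p) * (ennreal ((1 - s) powr p) * (\<integral>\<^sup>+x. ennreal (exp (s * x)) \<partial>gamma_law p))"
    by simp
  have "ennreal ((1 - s) powr p) * (\<integral>\<^sup>+x. ennreal (exp (s * x)) \<partial>gamma_law p) = 1"
    using eq Gamma_real_pos[OF p] by (subst (asm) ennreal_mult_cancel_left) auto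
  then have "ennreal ((1 - s) powr (- p)) * (ennreal ((1 - s) powr p) * (\<integral>\<^sup>+x. ennreal (exp (s * x)) \<partial>gamma_law p)) = ennreal ((1 - s) powr (- p))"
    by simp
  moreover have "ennreal ((1 - s) powr (- p)) * ennreal ((1 - s) powr p) = 1"
    using s by (simp add: ennreal_mult[symmetric] powr_add[symmetric])
  ultimately show ?thesis by (simp add: mult.assoc[symmetric])
qed

lemma prob_space_gamma_law: "0 \<le> p \<Longrightarrow> prob_space (gamma_law p)"
  using nn_integral_gamma_exp[of p 0] by (intro prob_spaceI) simp

lemma AE_gamma_law_nonneg:
  assumes "0 \<le> p"
  shows "AE x in gamma_law p. 0 \<le> x"
proof (cases "p = 0")
  case True
  have "AE x in return borel (0::real). 0 \<le> x" by (subst AE_return) auto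
  then show ?thesis using True unfolding gamma_law_def by (simp only: if_True simp_thms)
next
  case False
  have "AE x in density lborel (gamma_dens p). 0 \<le> x"
    by (subst AE_density) (auto simp: gamma_dens_def indicator_def)
  then show ?thesis using False unfolding gamma_law_def by (simp only: if_False simp_thms)
qed

text \<open>The growth condition under which everything below converges: \<open>c\<close> times a Gamma variable
  has exponential moments of all orders below \<open>1 / c\<close>.\<close>

definition adm :: "real \<Rightarrow> (real \<Rightarrow> real) \<Rightarrow> bool" where
  "adm c f \<longleftrightarrow> continuous_on {0..} f \<and> (\<exists>K. \<forall>y\<ge>0. \<bar>f y\<bar> \<le> K * exp (y / (2 * c)))"

lemma admE:
  assumes "adm c f"
  obtains K where "0 \<le> K" "\<And>y. 0 \<le> y \<Longrightarrow> \<bar>f y\<bar> \<le> K * exp (y / (2 * c))"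
proof -
  from assms obtain K where K: "\<And>y. 0 \<le> y \<Longrightarrow> \<bar>f y\<bar> \<le> K * exp (y / (2 * c))"
    by (auto simp: adm_def)
  moreover have "0 \<le> K" using K[of 0] by simp
  ultimately show thesis using that by blast
qed

lemma adm_cont_max:
  assumes "adm c f" and "0 \<le> c"
  shows "continuous_on UNIV (\<lambda>x. f (c * max 0 x))"
proof -
  have "continuous_on {0..} f" using assms(1) by (simp add: adm_def)
  then show ?thesis
    by (rule continuous_on_compose2) (use assms(2) in \<open>auto intro!: continuous_intros\<close>)
qed

lemma adm_measurable [measurable]:
  "adm c f \<Longrightarrow> 0 \<le> c \<Longrightarrow> (\<lambda>x. f (c * max 0 x)) \<in> borel_measurable borel"
  using adm_cont_max by (rule borel_measurable_continuous_onI)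

lemma adm_add: assumes "adm c f" "adm c g" shows "adm c (\<lambda>x. f x + g x)"
proof -
  from admE[OF assms(1)] obtain K where K: "\<And>y. 0 \<le> y \<Longrightarrow> \<bar>f y\<bar> \<le> K * exp (y / (2 * c))" by blast
  from admE[OF assms(2)] obtain K' where K': "\<And>y. 0 \<le> y \<Longrightarrow> \<bar>g y\<bar> \<le> K' * exp (y / (2 * c))" by blast
  have "\<bar>f y + g y\<bar> \<le> (K + K') * exp (y / (2 * c))" if "0 \<le> y" for y
    using K[OF that] K'[OF that] unfolding distrib_right by linarith
  then show ?thesis
    unfolding adm_def using assms by (auto simp: adm_def intro!: continuous_intros exI[of _ "K + K'"])
qed

lemma adm_cmult: assumes "adm c f" shows "adm c (\<lambda>x. k * f x)"
proof -
  from admE[OF assms(1)] obtain K where K: "\<And>y. 0 \<le> y \<Longrightarrow> \<bar>f y\<bar> \<le> K * exp (y / (2 * c))" by blast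
  have "\<bar>k * f y\<bar> \<le> (\<bar>k\<bar> * K) * exp (y / (2 * c))" if "0 \<le> y" for y
    using mult_left_mono[OF K[OF that], of "\<bar>k\<bar>"] by (simp add: abs_mult mult.assoc)
  then show ?thesis
    unfolding adm_def using assms by (auto simp: adm_def intro!: continuous_intros exI[of _ "\<bar>k\<bar> * K"])
qed

text \<open>Polynomial growth is admissible for every positive scale c, hence at every time t >
  0.\<close>

lemma adm_poly:
  assumes c: "0 < c" and f: "continuous_on {0..} f" and K: "\<And>y. 0 \<le> y \<Longrightarrow> \<bar>f y\<bar> \<le> K * (1 + y ^ L)"
  shows "adm c f"
proof -
  have "\<bar>f y\<bar> \<le> (K * (1 + fact L * (2 * c) ^ L)) * exp (y / (2 * c))" if y: "0 \<le> y" for y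
  proof -
    have K0: "0 \<le> K"
    proof -
      have "0 \<le> K * (1 + 0 ^ L)" using K[of 0] by linarith
      then show ?thesis by (cases "L = 0") (auto simp: zero_power)
    qed
    have "(y / (2 * c)) ^ L \<le> fact L * exp (y / (2 * c))" using y c by (intro power_le_fact_exp) auto
    then have "y ^ L \<le> fact L * (2 * c) ^ L * exp (y / (2 * c))"
      using c by (simp add: power_divide pos_divide_le_eq mult_ac)
    moreover have "1 \<le> exp (y / (2 * c))" using y c by simp
    ultimately have "1 + y ^ L \<le> (1 + fact L * (2 * c) ^ L) * exp (y / (2 * c))"
      unfolding distrib_right by linarith
    then have "K * (1 + y ^ L) \<le> K * ((1 + fact L * (2 * c) ^ L) * exp (y / (2 * c)))"
      using K0 by (rule mult_left_mono)
    then show ?thesis using K[OF y] by (simp add: mult.assoc)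
  qed
  then show ?thesis using f by (auto simp: adm_def)
qed

text \<open>f is controlled on [0,\<infinity>) only. Under the law \<open>max 0\<close> changes
  nothing almost surely, but it makes the integrand continuous for admissible f.\<close>

definition gamma_mean :: "real \<Rightarrow> real \<Rightarrow> (real \<Rightarrow> real) \<Rightarrow> real" where
  "gamma_mean p c f = (LINT x|gamma_law p. f (c * max 0 x))"

text \<open>At y = c x the growth bound becomes K exp (x / 2), whose Gamma mean is
  \<open>K * 2 powr p\<close>. The dependence on K and p is kept explicit for the summation over
  shapes.\<close>

lemma gamma_mean_integrable_aux:
  assumes f: "adm c f" and c: "0 < c" and p: "0 \<le> p"
    and K: "0 \<le> K" "\<And>y. 0 \<le> y \<Longrightarrow> \<bar>f y\<bar> \<le> K * exp (y / (2 * c))"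
  shows "integrable (gamma_law p) (\<lambda>x. f (c * max 0 x))" and "\<bar>gamma_mean p c f\<bar> \<le> K * 2 powr p"
proof -
  have ei: "(\<integral>\<^sup>+x. ennreal (exp (1 / 2 * x)) \<partial>gamma_law p) = ennreal (2 powr p)"
    using nn_integral_gamma_exp[of p "1/2"] p by (simp add: powr_minus powr_divide)
  have intE: "integrable (gamma_law p) (\<lambda>x. K * exp (1 / 2 * x))"
    using ei by (intro integrable_mult_right integrableI_nonneg) auto
  have E: "(LINT x|gamma_law p. exp (1 / 2 * x)) = 2 powr p"
    using ei by (subst integral_eq_nn_integral) auto
  have le: "AE x in gamma_law p. norm (f (c * max 0 x)) \<le> K * exp (1 / 2 * x)"
    using AE_gamma_law_nonneg[OF p]
  proof eventually_elim
    case (elim x)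
    then show ?case using K(2)[of "c * x"] c by (simp add: max_def)
  qed
  have m: "(\<lambda>x. f (c * max 0 x)) \<in> borel_measurable (gamma_law p)"
    using adm_measurable[OF f] c by (simp cong: measurable_cong_sets)
  show int: "integrable (gamma_law p) (\<lambda>x. f (c * max 0 x))"
    by (rule Bochner_Integration.integrable_bound[OF intE m]) (use le K(1) in auto)
  have "\<bar>gamma_mean p c f\<bar> \<le> (LINT x|gamma_law p. norm (f (c * max 0 x)))"
    unfolding gamma_mean_def using integral_norm_bound[of "gamma_law p" "\<lambda>x. f (c * max 0 x)"] by simp
  also have "\<dots> \<le> (LINT x|gamma_law p. K * exp (1 / 2 * x))"
    using le by (intro integral_mono_AE integrable_norm int intE)
  also have "\<dots> = K * 2 powr p" using E by simp
  finally show "\<bar>gamma_mean p c f\<bar> \<le> K * 2 powr p" .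
qed

lemma gamma_mean_integrable: "adm c f \<Longrightarrow> 0 < c \<Longrightarrow> 0 \<le> p \<Longrightarrow> integrable (gamma_law p) (\<lambda>x. f (c * max 0 x))"
  using gamma_mean_integrable_aux(1) admE by metis

lemma gamma_mean_mono:
  assumes "adm c f" "adm c g" "0 < c" "0 \<le> p" "\<And>x. 0 \<le> x \<Longrightarrow> f x \<le> g x"
  shows "gamma_mean p c f \<le> gamma_mean p c g"
  unfolding gamma_mean_def using assms by (intro integral_mono gamma_mean_integrable) auto

lemma gamma_mean_add:
  assumes "adm c f" "adm c g" "0 < c" "0 \<le> p"
  shows "gamma_mean p c (\<lambda>x. f x + g x) = gamma_mean p c f + gamma_mean p c g"
  unfolding gamma_mean_def using assms by (intro Bochner_Integration.integral_add gamma_mean_integrable)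

lemma gamma_mean_cmult: "gamma_mean p c (\<lambda>x. k * f x) = k * gamma_mean p c f"
  unfolding gamma_mean_def by simp

lemma gamma_mean_0: "adm c f \<Longrightarrow> 0 \<le> c \<Longrightarrow> gamma_mean 0 c f = f 0"
  unfolding gamma_mean_def gamma_law_def using adm_measurable[of c f] by (simp add: integral_return)

lemma gamma_mean_pos:
  assumes f: "adm c f" and c: "0 < c" and p: "0 < p"
  shows "integrable lborel (\<lambda>x. gamma_dens p x * f (c * max 0 x))"
    and "gamma_mean p c f = (LINT x|lborel. gamma_dens p x * f (c * max 0 x))"
proof -
  have m: "(\<lambda>x. f (c * max 0 x)) \<in> borel_measurable lborel"
    using adm_measurable[OF f] c by simp
  have d: "gamma_law p = density lborel (\<lambda>x. ennreal (gamma_dens p x))" using p by (simp add: gamma_law_def)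
  have nn: "AE x in lborel. 0 \<le> gamma_dens p x" using gamma_dens_nonneg[OF p] by simp
  have gm: "gamma_dens p \<in> borel_measurable lborel" by measurable
  show "integrable lborel (\<lambda>x. gamma_dens p x * f (c * max 0 x))"
    using gamma_mean_integrable[OF f c less_imp_le[OF p]] unfolding d integrable_density[OF m gm nn] by simp
  show "gamma_mean p c f = (LINT x|lborel. gamma_dens p x * f (c * max 0 x))"
    unfolding gamma_mean_def d integral_density[OF m gm nn] by simp
qed

text \<open>Integration by parts: the derivative of the density of shape p + 1 is the density of
  shape p minus that of shape p + 1. For p = 0 the missing density of shape 0 is replaced by the
  boundary term f 0, the mean under the point mass at 0.\<close>

lemma gamma_mean_step:
  assumes f: "adm c f" and f': "adm c f'" and c: "0 < c" and p: "0 \<le> p"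
    and deriv: "\<And>y. 0 \<le> y \<Longrightarrow> (f has_real_derivative f' y) (at y within {0..})"
  shows "gamma_mean (p + 1) c f - gamma_mean p c f = c * gamma_mean (p + 1) c f'"
proof -
  have p1: "0 < p + 1" using p by simp
  have Gp: "0 < Gamma (p + 1)" using Gamma_real_pos[OF p1] .
  define h where "h = (\<lambda>x::real. x powr p * exp (- x) / Gamma (p + 1))"
  define h' where "h' = (\<lambda>x::real. (p * x powr (p - 1) - x powr p) * exp (- x) / Gamma (p + 1))"
  \<comment> \<open>Boundary term at 0 and bulk term: one of the two vanishes, and A + B is the mean
    of shape p in either case.\<close>
  define A where "A = (if p = 0 then f 0 else 0)"
  define B where "B = (if p = 0 then 0 else gamma_mean p c f)"
  \<comment> \<open>At x = 0 both sides are 0, because \<open>0 powr p = 0\<close> also for p =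
    0.\<close>
  have dens1: "indicator {0<..} x * h x = gamma_dens (p + 1) x" for x
    by (cases "x = 0") (auto simp: h_def gamma_dens_def indicator_def exp_minus divide_inverse)
  have densp: "indicator {0<..} x * h' x = (if p = 0 then 0 else gamma_dens p x) - gamma_dens (p + 1) x" for x
  proof (cases "p = 0")
    case True
    then show ?thesis by (cases "x = 0") (auto simp: h'_def gamma_dens_def indicator_def exp_minus divide_inverse)
  next
    case False
    have "Gamma (p + 1) = p * Gamma p" using p False Gamma_plus1[of p] by (auto simp: nonpos_Ints_def)
    moreover have "Gamma p > 0" using False p by (intro Gamma_real_pos) auto
    ultimately show ?thesis using False p
      by (cases "x = 0") (auto simp: h'_def gamma_dens_def indicator_def exp_minus inverse_eq_divide left_diff_distrib diff_divide_distrib)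
  qed
  let ?F = "\<lambda>x. f (c * x) * h x"
  let ?f = "\<lambda>x. c * f' (c * x) * h x + f (c * x) * h' x"
  have at: "at y within {0..} = at y" if "0 < y" for y :: real
    using that by (intro at_within_interior) (auto simp: interior_real_atLeast)
  have fd: "((\<lambda>x. f (c * x)) has_real_derivative f' (c * x) * c) (at x)" if x: "0 < x" for x
  proof (rule DERIV_chain2[where f=f and g="\<lambda>x. c * x"])
    show "(f has_real_derivative f' (c * x)) (at (c * x))"
      using deriv[of "c * x"] at[of "c * x"] x c by simp
  qed (auto intro!: derivative_eq_intros)
  have hd: "(h has_real_derivative h' x) (at x)" if "0 < x" for x
    unfolding h_def h'_def using that Gp
    by (auto intro!: derivative_eq_intros simp: field_simps powr_diff)
  have contf: "isCont (\<lambda>x. k (c * x)) x" if "adm c k" "0 < x" for k x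
  proof -
    have "continuous_on {0<..} (\<lambda>x. k (c * x))"
      by (rule continuous_on_compose2[of "{0..}" k]) (use that c in \<open>auto simp: adm_def intro!: continuous_intros\<close>)
    then show ?thesis using that by (simp add: continuous_on_eq_continuous_at)
  qed
  have eq: "indicator {0<..} x * ?f x = c * (gamma_dens (p + 1) x * f' (c * max 0 x))
     + ((if p = 0 then 0 else gamma_dens p x * f (c * max 0 x)) - gamma_dens (p + 1) x * f (c * max 0 x))" for x
  proof -
    have "indicator {0<..} x * ?f x = c * f' (c * x) * (indicator {0<..} x * h x) + f (c * x) * (indicator {0<..} x * h' x)"
      by (simp add: algebra_simps)
    also have "\<dots> = c * f' (c * max 0 x) * (indicator {0<..} x * h x) + f (c * max 0 x) * (indicator {0<..} x * h' x)"
      by (auto simp: indicator_def max_def)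
    finally show ?thesis unfolding dens1 densp by (auto simp: algebra_simps)
  qed
  have "(LBINT x=0..\<infinity>. ?f x) = 0 - A"
  proof (rule interval_integral_FTC_integrable)
    show "(0::ereal) < \<infinity>" by simp
    fix x :: real assume "(0::ereal) < ereal x"
    then have x: "0 < x" by simp
    have "(?F has_real_derivative ?f x) (at x)"
      using DERIV_mult[OF fd[OF x] hd[OF x]] by (simp add: mult_ac add.commute)
    then show "(?F has_vector_derivative ?f x) (at x)"
      by (simp add: has_real_derivative_iff_has_vector_derivative)
    have "isCont h x" using hd[OF x] by (rule DERIV_isCont)
    moreover have "isCont h' x" unfolding h'_def using x Gp by (auto intro!: continuous_intros)
    ultimately show "isCont ?f x"
      using contf[OF f x] contf[OF f' x] by (intro continuous_intros) auto
  next
    have e: "einterval 0 \<infinity> = {0<..}" by (auto simp: einterval_def)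
    have "integrable lborel (\<lambda>x. c * (gamma_dens (p + 1) x * f' (c * max 0 x))
       + ((if p = 0 then 0 else gamma_dens p x * f (c * max 0 x)) - gamma_dens (p + 1) x * f (c * max 0 x)))"
      using gamma_mean_pos(1)[OF f' c p1] gamma_mean_pos(1)[OF f c p1] gamma_mean_pos(1)[OF f c, of p] p
      by (cases "p = 0") (auto intro!: Bochner_Integration.integrable_add Bochner_Integration.integrable_diff)
    then show "set_integrable lborel (einterval 0 \<infinity>) ?f"
      unfolding set_integrable_def e by (simp add: eq)
    show "((?F \<circ> real_of_ereal) \<longlongrightarrow> A) (at_right 0)"
    proof -
      have 1: "((\<lambda>x. f (c * x)) \<longlongrightarrow> f 0) (at_right 0)"
      proof -
        have "continuous_on {0..} (\<lambda>x. f (c * x))"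
          by (rule continuous_on_compose2[of "{0..}" f]) (use f c in \<open>auto simp: adm_def intro!: continuous_intros\<close>)
        then have "((\<lambda>x. f (c * x)) \<longlongrightarrow> f (c * 0)) (at 0 within {0..})"
          unfolding continuous_on_def by (rule bspec) simp
        then have "((\<lambda>x. f (c * x)) \<longlongrightarrow> f 0) (at 0 within {0..})" by simp
        then show ?thesis by (rule tendsto_within_subset[where S="{0..}" and T="{0<..}", simplified]) auto
      qed
      have 2: "(h \<longlongrightarrow> (if p = 0 then 1 else 0)) (at_right 0)"
      proof (cases "p = 0")
        case True
        have "((\<lambda>x::real. exp (- x)) \<longlongrightarrow> 1) (at_right 0)" by real_asymp
        moreover have "\<forall>\<^sub>F x in at_right 0. exp (- x) = h x"
          unfolding eventually_at_right_field h_def using True by (auto intro!: exI[of _ 1])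
        ultimately show ?thesis using True by (auto intro: Lim_transform_eventually)
      next
        case False
        then have "0 < p" using p by simp
        then have "((\<lambda>x. x powr p * exp (- x)) \<longlongrightarrow> 0) (at_right 0)" by real_asymp
        from tendsto_divide[OF this tendsto_const[of "Gamma (p + 1)"]] show ?thesis using False Gp by (simp add: h_def)
      qed
      have "(?F \<longlongrightarrow> A) (at_right 0)" using tendsto_mult[OF 1 2] by (auto simp: A_def split: if_splits)
      then show ?thesis unfolding zero_ereal_def ereal_tendsto_simps1 .
    qed
    show "((?F \<circ> real_of_ereal) \<longlongrightarrow> 0) (at_left \<infinity>)"
    proof -
      \<comment> \<open>After scaling, f grows at most like exp (x / 2), against the factor exp (-
        x) in h.\<close>
      from admE[OF f] obtain K where K: "0 \<le> K" "\<And>y. 0 \<le> y \<Longrightarrow> \<bar>f y\<bar> \<le> K * exp (y / (2 * c))" by blast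
      have "((\<lambda>x::real. x powr p * exp (- x / 2)) \<longlongrightarrow> 0) at_top" by real_asymp
      then have "((\<lambda>x. K / Gamma (p + 1) * (x powr p * exp (- x / 2))) \<longlongrightarrow> K / Gamma (p + 1) * 0) at_top"
        by (intro tendsto_intros)
      then have lim: "((\<lambda>x. K / Gamma (p + 1) * (x powr p * exp (- x / 2))) \<longlongrightarrow> 0) at_top" by simp
      have "(?F \<longlongrightarrow> 0) at_top"
      proof (rule Lim_null_comparison[OF _ lim])
        show "\<forall>\<^sub>F x in at_top. norm (?F x) \<le> K / Gamma (p + 1) * (x powr p * exp (- x / 2))"
          using eventually_ge_at_top[of 0]
        proof eventually_elim
          case (elim x)
          have "norm (?F x) = \<bar>f (c * x)\<bar> * h x" using Gp by (simp add: h_def abs_mult)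
          also have "\<dots> \<le> K * exp (x / 2) * h x"
            using K(2)[of "c * x"] elim c Gp by (intro mult_right_mono) (auto simp: h_def)
          also have "\<dots> = K / Gamma (p + 1) * (x powr p * (exp (x / 2) * exp (- x)))" by (simp add: h_def)
          also have "exp (x / 2) * exp (- x) = exp (- x / 2)" by (simp add: mult_exp_exp)
          finally show ?case .
        qed
      qed
      then show ?thesis unfolding ereal_tendsto_simps1 .
    qed
  qed
  moreover have "(LBINT x=0..\<infinity>. ?f x) = c * gamma_mean (p + 1) c f' + (B - gamma_mean (p + 1) c f)"
  proof -
    have e: "einterval 0 \<infinity> = {0<..}" by (auto simp: einterval_def)
    have "(LBINT x=0..\<infinity>. ?f x) = (LINT x|lborel. indicator {0<..} x * ?f x)"
      by (simp add: interval_lebesgue_integral_def set_lebesgue_integral_def e)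
    also have "\<dots> = (LINT x|lborel. c * (gamma_dens (p + 1) x * f' (c * max 0 x))
       + ((if p = 0 then 0 else gamma_dens p x * f (c * max 0 x)) - gamma_dens (p + 1) x * f (c * max 0 x)))"
      by (simp only: eq)
    also have "\<dots> = c * gamma_mean (p + 1) c f' + (B - gamma_mean (p + 1) c f)"
    proof (cases "p = 0")
      case True
      then show ?thesis
        using gamma_mean_pos[OF f' c p1] gamma_mean_pos[OF f c p1] by (simp add: B_def)
    next
      case False
      then show ?thesis
        using gamma_mean_pos[OF f' c p1] gamma_mean_pos[OF f c p1] gamma_mean_pos[OF f c, of p] p by (simp add: B_def)
    qed
    finally show ?thesis .
  qed
  moreover have "A + B = gamma_mean p c f"
    using gamma_mean_0[OF f] c by (simp add: A_def B_def)
  ultimately show ?thesis by simp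
qed


section \<open>Poisson mixtures of Gamma laws\<close>

text \<open>The mean of \<open>f\<close> under the law of \<open>Y\<^sub>t\<close> started at \<open>y\<close> (see \<open>expectation_eq_nc_mean\<close>).\<close>

definition nc_mean :: "real \<Rightarrow> real \<Rightarrow> real \<Rightarrow> (real \<Rightarrow> real) \<Rightarrow> real \<Rightarrow> real" where
  "nc_mean c d \<alpha> f y = exp (- (y * d)) * (\<Sum>n. gamma_mean (\<alpha> + real n) c f / fact n * (y * d) ^ n)"

text \<open>The Gamma means grow at most like \<open>2 ^ n\<close>, against the factorial.\<close>

lemma nc_mean_summable:
  assumes f: "adm c f" and c: "0 < c" and \<alpha>: "0 \<le> \<alpha>"
  shows "summable (\<lambda>n. gamma_mean (\<alpha> + real n) c f / fact n * z ^ n)"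
proof -
  from admE[OF f] obtain K where K: "0 \<le> K" "\<And>y. 0 \<le> y \<Longrightarrow> \<bar>f y\<bar> \<le> K * exp (y / (2 * c))" by blast
  show ?thesis
  proof (rule summable_comparison_test')
    show "summable (\<lambda>n. (K * 2 powr \<alpha>) * (inverse (fact n) * (2 * \<bar>z\<bar>) ^ n))"
      by (intro summable_mult summable_exp)
    fix n :: nat
    have "\<bar>gamma_mean (\<alpha> + real n) c f\<bar> \<le> K * 2 powr (\<alpha> + real n)"
      using \<alpha> by (intro gamma_mean_integrable_aux(2)[OF f c _ K]) auto
    also have "\<dots> = K * 2 powr \<alpha> * 2 ^ n" by (simp add: powr_add powr_realpow)
    finally have "norm (gamma_mean (\<alpha> + real n) c f / fact n * z ^ n) \<le> K * 2 powr \<alpha> * 2 ^ n / fact n * \<bar>z\<bar> ^ n"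
      by (auto simp: abs_mult power_abs intro!: mult_right_mono divide_right_mono)
    then show "norm (gamma_mean (\<alpha> + real n) c f / fact n * z ^ n) \<le> (K * 2 powr \<alpha>) * (inverse (fact n) * (2 * \<bar>z\<bar>) ^ n)"
      by (simp add: power_mult_distrib divide_inverse mult_ac)
  qed
qed

lemma nc_mean_add:
  assumes "adm c f" "adm c g" "0 < c" "0 \<le> \<alpha>"
  shows "nc_mean c d \<alpha> (\<lambda>x. f x + g x) y = nc_mean c d \<alpha> f y + nc_mean c d \<alpha> g y"
proof -
  have "gamma_mean (\<alpha> + real n) c (\<lambda>x. f x + g x) / fact n * (y * d) ^ n
    = gamma_mean (\<alpha> + real n) c f / fact n * (y * d) ^ n + gamma_mean (\<alpha> + real n) c g / fact n * (y * d) ^ n" for n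
    using assms by (subst gamma_mean_add) (auto simp: add_divide_distrib distrib_right)
  then show ?thesis
    unfolding nc_mean_def distrib_left[symmetric] suminf_add[OF nc_mean_summable[OF assms(1,3,4)] nc_mean_summable[OF assms(2,3,4)]]
    by (simp only:)
qed

lemma nc_mean_cmult:
  assumes "adm c f" "0 < c" "0 \<le> \<alpha>"
  shows "nc_mean c d \<alpha> (\<lambda>x. k * f x) y = k * nc_mean c d \<alpha> f y"
  unfolding nc_mean_def gamma_mean_cmult
  using suminf_mult[OF nc_mean_summable[OF assms, of "y * d"], of k] by (simp add: mult_ac)

lemma nc_mean_mono:
  assumes "adm c f" "adm c g" "0 < c" "0 \<le> \<alpha>" "0 \<le> d" "0 \<le> y" "\<And>x. 0 \<le> x \<Longrightarrow> f x \<le> g x"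
  shows "nc_mean c d \<alpha> f y \<le> nc_mean c d \<alpha> g y"
  unfolding nc_mean_def using assms
  by (intro mult_left_mono suminf_le nc_mean_summable mult_right_mono divide_right_mono gamma_mean_mono) auto

lemma nc_mean_const: 
  assumes "0 \<le> \<alpha>"
  shows "nc_mean c d \<alpha> (\<lambda>_. k) y = k"
proof -
  have "gamma_mean (\<alpha> + real n) c (\<lambda>_. k) = k" for n
    unfolding gamma_mean_def using prob_space.prob_space[OF prob_space_gamma_law[of "\<alpha> + real n"]] assms by simp
  then have "nc_mean c d \<alpha> (\<lambda>_. k) y = exp (- (y * d)) * (\<Sum>n. k * (inverse (fact n) * (y * d) ^ n))"
    unfolding nc_mean_def by (simp add: divide_inverse mult_ac)
  also have "\<dots> = exp (- (y * d)) * (k * exp (y * d))"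
    by (subst suminf_mult[OF summable_exp]) (simp add: exp_def)
  also have "\<dots> = k" by (simp add: exp_minus)
  finally show ?thesis .
qed

lemma nc_mean_0: "nc_mean c d \<alpha> f 0 = gamma_mean \<alpha> c f"
  unfolding nc_mean_def mult_zero_left powser_zero by simp

lemma nc_mean_abs_le:
  assumes "adm c f" "adm c g" "0 < c" "0 \<le> \<alpha>" "0 \<le> d" "0 \<le> y" "\<And>x. 0 \<le> x \<Longrightarrow> \<bar>f x\<bar> \<le> g x"
  shows "\<bar>nc_mean c d \<alpha> f y\<bar> \<le> nc_mean c d \<alpha> g y"
proof (rule abs_leI)
  show "nc_mean c d \<alpha> f y \<le> nc_mean c d \<alpha> g y"
    by (rule nc_mean_mono[OF assms(1-6)]) (use assms(7) in \<open>auto intro: order_trans[OF abs_ge_self]\<close>)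
  have "- nc_mean c d \<alpha> f y = nc_mean c d \<alpha> (\<lambda>x. - 1 * f x) y"
    using nc_mean_cmult[OF assms(1,3,4), of d "- 1"] by simp
  also have "\<dots> \<le> nc_mean c d \<alpha> g y"
    by (rule nc_mean_mono[OF adm_cmult[OF assms(1)] assms(2-6)])
      (use assms(7) in \<open>auto intro: order_trans[OF abs_ge_minus_self]\<close>)
  finally show "- nc_mean c d \<alpha> f y \<le> nc_mean c d \<alpha> g y" .
qed

text \<open>Differentiating the exponential and the power series yields d times the mixture of
  differences of consecutive Gamma means; \<open>gamma_mean_step\<close> makes each difference c
  times a mean of f' with the higher shape.\<close>

lemma nc_mean_deriv:
  assumes f: "adm c f" and f': "adm c f'" and c: "0 < c" and \<alpha>: "0 \<le> \<alpha>"
    and deriv: "\<And>y. 0 \<le> y \<Longrightarrow> (f has_real_derivative f' y) (at y within {0..})"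
  shows "(nc_mean c d \<alpha> f has_real_derivative c * d * nc_mean c d (\<alpha> + 1) f' y) (at y within S)"
proof -
  define g where "g = (\<lambda>n. gamma_mean (\<alpha> + real n) c f / fact n)"
  \<comment> \<open>The factor n + 1 in \<open>diffs\<close> cancels against the factorial, so
    differentiating the series shifts the shape by one.\<close>
  have dg: "diffs g n = gamma_mean (\<alpha> + 1 + real n) c f / fact n" for n
    by (simp add: g_def diffs_def add_ac del: of_nat_Suc) (simp add: add_ac)
  have s: "summable (\<lambda>n. g n * z ^ n)" for z
    unfolding g_def by (rule nc_mean_summable[OF f c \<alpha>])
  have s1: "summable (\<lambda>n. diffs g n * z ^ n)" for z
    unfolding dg by (rule nc_mean_summable[OF f c]) (use \<alpha> in simp)
  have P: "((\<lambda>z. \<Sum>n. g n * z ^ n) has_real_derivative (\<Sum>n. diffs g n * z ^ n)) (at z)" for z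
    by (rule termdiffs_strong_converges_everywhere[OF s])
  have "((\<lambda>y. \<Sum>n. g n * (y * d) ^ n) has_real_derivative (\<Sum>n. diffs g n * (y * d) ^ n) * d) (at y within S)"
    by (rule DERIV_chain2[OF P]) (auto intro!: derivative_eq_intros)
  then have "((\<lambda>y. exp (- (y * d)) * (\<Sum>n. g n * (y * d) ^ n)) has_real_derivative
    exp (- (y * d)) * d * ((\<Sum>n. diffs g n * (y * d) ^ n) - (\<Sum>n. g n * (y * d) ^ n))) (at y within S)"
    by (auto intro!: derivative_eq_intros simp: algebra_simps)
  also have "(\<Sum>n. diffs g n * (y * d) ^ n) - (\<Sum>n. g n * (y * d) ^ n)
    = (\<Sum>n. diffs g n * (y * d) ^ n - g n * (y * d) ^ n)"
    by (rule suminf_diff[OF s1 s])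
  also have "\<dots> = (\<Sum>n. c * (gamma_mean (\<alpha> + 1 + real n) c f' / fact n * (y * d) ^ n))"
  proof (intro suminf_cong)
    fix n
    have "gamma_mean (\<alpha> + real n + 1) c f - gamma_mean (\<alpha> + real n) c f = c * gamma_mean (\<alpha> + real n + 1) c f'"
      using \<alpha> by (intro gamma_mean_step[OF f f' c _ deriv]) auto
    moreover have "\<alpha> + real n + 1 = \<alpha> + 1 + real n" by simp
    ultimately have "gamma_mean (\<alpha> + 1 + real n) c f - gamma_mean (\<alpha> + real n) c f = c * gamma_mean (\<alpha> + 1 + real n) c f'" by (simp only:)
    then show "diffs g n * (y * d) ^ n - g n * (y * d) ^ n = c * (gamma_mean (\<alpha> + 1 + real n) c f' / fact n * (y * d) ^ n)"
      unfolding dg unfolding g_def left_diff_distrib[symmetric] diff_divide_distrib[symmetric] by simp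
  qed
  also have "\<dots> = c * (\<Sum>n. gamma_mean (\<alpha> + 1 + real n) c f' / fact n * (y * d) ^ n)"
    by (rule suminf_mult, rule nc_mean_summable[OF f' c]) (use \<alpha> in simp)
  finally have "((\<lambda>y. exp (- (y * d)) * (\<Sum>n. g n * (y * d) ^ n)) has_real_derivative
     c * d * nc_mean c d (\<alpha> + 1) f' y) (at y within S)"
    by (simp add: nc_mean_def mult_ac)
  then show ?thesis by (simp add: nc_mean_def[abs_def] g_def)
qed

text \<open>Serves the derivative of order m, for which f supplies no further derivative.\<close>

lemma nc_mean_continuous:
  assumes f: "adm c f" and c: "0 < c" and \<alpha>: "0 \<le> \<alpha>"
  shows "continuous_on S (nc_mean c d \<alpha> f)"
proof -
  have "isCont (\<lambda>z. \<Sum>n. gamma_mean (\<alpha> + real n) c f / fact n * z ^ n) z" for z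
    by (rule isCont_powser_converges_everywhere[OF nc_mean_summable[OF f c \<alpha>]])
  then have "continuous_on UNIV (\<lambda>z. \<Sum>n. gamma_mean (\<alpha> + real n) c f / fact n * z ^ n)"
    by (simp add: continuous_on_eq_continuous_at)
  then have "continuous_on S (\<lambda>y. \<Sum>n. gamma_mean (\<alpha> + real n) c f / fact n * (y * d) ^ n)"
    by (rule continuous_on_compose2) (auto intro!: continuous_intros)
  then show ?thesis unfolding nc_mean_def[abs_def] by (intro continuous_intros)
qed

lemma adm_power: "0 < c \<Longrightarrow> adm c (\<lambda>x. x ^ L)"
  by (rule adm_poly[where K=1 and L=L]) (auto intro!: continuous_intros)

lemma adm_const: "0 < c \<Longrightarrow> adm c (\<lambda>_. k)"
  using adm_cmult[OF adm_power[of c 0], of k] by simp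

lemma power_mult_le:
  fixes y :: real
  assumes "0 \<le> y"
  shows "y * (1 + y ^ L) \<le> 2 * (1 + y ^ Suc L)"
proof (cases "y \<le> 1")
  case True
  then have "y * (1 + y ^ L) \<le> 1 + y ^ Suc L" by (simp add: distrib_left)
  also have "\<dots> \<le> 2 * (1 + y ^ Suc L)" using assms by simp
  finally show ?thesis .
next
  case False
  then have "y ^ 1 \<le> y ^ Suc L" by (intro power_increasing) auto
  then show ?thesis by (simp add: distrib_left)
qed

text \<open>Moment bound, uniform in the parameters: since the derivative in \<open>y\<close> of the \<open>L\<close>-th moment is
  \<open>c d L\<close> times the \<open>(L-1)\<close>-st moment of the law with shape \<open>\<alpha> + 1\<close>, induction on \<open>L\<close> and the mean
  value theorem suffice.\<close>

lemma nc_mean_moment_bound: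
  assumes C: "0 \<le> C" and D: "0 \<le> D" and "0 \<le> \<alpha>"
  shows "\<exists>B\<ge>0. \<forall>c d y. 0 < c \<longrightarrow> c \<le> C \<longrightarrow> 0 \<le> d \<longrightarrow> c * d \<le> D \<longrightarrow> 0 \<le> y \<longrightarrow>
    nc_mean c d \<alpha> (\<lambda>x. x ^ L) y \<le> B * (1 + y ^ L)"
  using assms(3)
proof (induction L arbitrary: \<alpha>)
  case 0
  show ?case by (rule exI[of _ 1]) (use 0 in \<open>auto simp: nc_mean_const\<close>)
next
  case (Suc L)
  have \<alpha>1: "0 \<le> \<alpha> + 1" using Suc.prems by simp
  from Suc.IH[OF \<alpha>1] obtain B where B: "0 \<le> B"
    "\<And>c d y. 0 < c \<Longrightarrow> c \<le> C \<Longrightarrow> 0 \<le> d \<Longrightarrow> c * d \<le> D \<Longrightarrow> 0 \<le> y \<Longrightarrow>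
      nc_mean c d (\<alpha> + 1) (\<lambda>x. x ^ L) y \<le> B * (1 + y ^ L)" by blast
  \<comment> \<open>\<open>?E\<close> bounds the value at y = 0, a pure Gamma moment; the last 2 in
    \<open>?B\<close> comes from \<open>power_mult_le\<close>.\<close>
  let ?E = "fact (Suc L) * (2 * C) ^ Suc L * 2 powr \<alpha>"
  let ?B = "?E + D * real (Suc L) * B * 2"
  show ?case
  proof (intro exI[of _ ?B] conjI allI impI)
    show "0 \<le> ?B" using C D B by (intro add_nonneg_nonneg mult_nonneg_nonneg) auto
    fix c d y :: real
    assume c: "0 < c" "c \<le> C" and d: "0 \<le> d" "c * d \<le> D" and y: "0 \<le> y"
    let ?u = "nc_mean c d \<alpha> (\<lambda>x. x ^ Suc L)"
    have der: "(?u has_real_derivative c * d * (real (Suc L) * nc_mean c d (\<alpha> + 1) (\<lambda>x. x ^ L) z)) (at z within S)" for z S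
    proof -
      have "(?u has_real_derivative c * d * nc_mean c d (\<alpha> + 1) (\<lambda>x. real (Suc L) * x ^ L) z) (at z within S)"
        by (rule nc_mean_deriv[OF adm_power adm_cmult[OF adm_power]])
          (use c Suc.prems in \<open>auto intro!: derivative_eq_intros simp del: of_nat_Suc power_Suc\<close>)
      then show ?thesis by (simp only: nc_mean_cmult[OF adm_power[OF c(1)] c(1) \<alpha>1])
    qed
    have u0: "?u 0 \<le> ?E"
    proof -
      have K: "\<bar>x ^ Suc L\<bar> \<le> (fact (Suc L) * (2 * c) ^ Suc L) * exp (x / (2 * c))" if "0 \<le> x" for x
      proof -
        have "(x / (2 * c)) ^ Suc L \<le> fact (Suc L) * exp (x / (2 * c))"
          using that c by (intro power_le_fact_exp) auto
        then have "x ^ Suc L \<le> (fact (Suc L) * exp (x / (2 * c))) * (2 * c) ^ Suc L"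
          using c by (simp only: power_divide pos_divide_le_eq zero_less_power mult_pos_pos zero_less_numeral)
        then show ?thesis using that by (simp add: abs_of_nonneg mult_ac del: power_Suc fact_Suc)
      qed
      have "?u 0 \<le> fact (Suc L) * (2 * c) ^ Suc L * 2 powr \<alpha>"
        unfolding nc_mean_0
        by (rule order_trans[OF abs_ge_self gamma_mean_integrable_aux(2)[OF adm_power[OF c(1)] c(1) Suc.prems _ K]])
          (use c in auto)
      also have "\<dots> \<le> ?E"
        using c by (intro mult_right_mono mult_left_mono power_mono) auto
      finally show ?thesis .
    qed
    show "?u y \<le> ?B * (1 + y ^ Suc L)"
    proof (cases "y = 0")
      case True
      have "?u 0 \<le> ?B" using u0 D B(1) by (meson add_increasing2 mult_nonneg_nonneg of_nat_0_le_iff zero_le_numeral)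
      then show ?thesis using True by simp
    next
      case False
      then have y0: "0 < y" using y by simp
      from MVT2[OF y0, of ?u, OF der] obtain z where z: "0 < z" "z < y"
        "?u y - ?u 0 = (y - 0) * (c * d * (real (Suc L) * nc_mean c d (\<alpha> + 1) (\<lambda>x. x ^ L) z))" by blast
      have "nc_mean c d (\<alpha> + 1) (\<lambda>x. x ^ L) z \<le> B * (1 + z ^ L)"
        using z c d by (intro B(2)) auto
      also have "\<dots> \<le> B * (1 + y ^ L)" using z B(1) by (intro mult_left_mono add_left_mono power_mono) auto
      finally have Uz: "nc_mean c d (\<alpha> + 1) (\<lambda>x. x ^ L) z \<le> B * (1 + y ^ L)" .
      have "0 \<le> B * (1 + y ^ L)" using B(1) y by simp
      have "?u y = ?u 0 + y * (c * d * (real (Suc L) * nc_mean c d (\<alpha> + 1) (\<lambda>x. x ^ L) z))" using z(3) by simp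
      also have "\<dots> \<le> ?E + y * (c * d * (real (Suc L) * (B * (1 + y ^ L))))"
        using y c d by (intro add_mono u0 mult_left_mono Uz) auto
      also have "\<dots> \<le> ?E + y * (D * (real (Suc L) * (B * (1 + y ^ L))))"
        using y d \<open>0 \<le> B * (1 + y ^ L)\<close> by (intro add_left_mono mult_left_mono mult_right_mono) auto
      also have "\<dots> = ?E + D * real (Suc L) * B * (y * (1 + y ^ L))" by (simp only: mult_ac)
      also have "\<dots> \<le> ?E * (1 + y ^ Suc L) + D * real (Suc L) * B * (2 * (1 + y ^ Suc L))"
      proof (rule add_mono)
        have "0 \<le> ?E" using C by (intro mult_nonneg_nonneg) auto
        then have "?E * 1 \<le> ?E * (1 + y ^ Suc L)" using y by (intro mult_left_mono) auto
        then show "?E \<le> ?E * (1 + y ^ Suc L)" by simp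
        show "D * real (Suc L) * B * (y * (1 + y ^ L)) \<le> D * real (Suc L) * B * (2 * (1 + y ^ Suc L))"
          using D B(1) power_mult_le[OF y, of L] by (intro mult_left_mono) auto
      qed
      also have "\<dots> = ?B * (1 + y ^ Suc L)" by (subst distrib_right) (simp only: mult.assoc)
      finally show ?thesis .
    qed
  qed
qed


section \<open>The Poisson mixture as a probability measure\<close>

definition poisson0 :: "real \<Rightarrow> nat pmf" where
  "poisson0 \<mu> = (if \<mu> = 0 then return_pmf 0 else poisson_pmf \<mu>)"

text \<open>At rate 0, which the starting point 0 requires, \<open>0 ^ 0 = 1\<close> makes the
  formula the point mass at 0.\<close>

lemma pmf_poisson0: "0 \<le> \<mu> \<Longrightarrow> pmf (poisson0 \<mu>) n = exp (- \<mu>) * (\<mu> ^ n / fact n)"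
  by (cases "\<mu> = 0"; cases n) (auto simp: poisson0_def)

text \<open>The law of c / 2 times a noncentral chi-square variable with 2 \<alpha> degrees of
  freedom and noncentrality 2 \<mu>. The uniqueness theorem compares measures, whereas
  \<open>nc_mean\<close> is only a functional.\<close>

definition nc_law :: "real \<Rightarrow> real \<Rightarrow> real \<Rightarrow> real measure" where
  "nc_law c \<alpha> \<mu> = measure_pmf (poisson0 \<mu>) \<bind> (\<lambda>n. distr (gamma_law (\<alpha> + real n)) borel (\<lambda>x. c * max 0 x))"

context
  fixes c \<alpha> \<mu> :: real
  assumes c: "0 < c" and \<alpha>: "0 \<le> \<alpha>" and \<mu>: "0 \<le> \<mu>"
begin

lemma kernel: "(\<lambda>n. distr (gamma_law (\<alpha> + real n)) borel (\<lambda>x. c * max 0 x)) \<in> measure_pmf (poisson0 \<mu>) \<rightarrow>\<^sub>M prob_algebra borel"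
proof -
  have "prob_space (distr (gamma_law (\<alpha> + real n)) borel (\<lambda>x. c * max 0 x))" for n
    using \<alpha> by (intro prob_space.prob_space_distr prob_space_gamma_law) auto
  then show ?thesis by (auto simp: space_prob_algebra)
qed

lemma real_distribution_nc_law: "real_distribution (nc_law c \<alpha> \<mu>)"
proof -
  have p: "measure_pmf (poisson0 \<mu>) \<in> space (prob_algebra (measure_pmf (poisson0 \<mu>)))"
    by (simp add: space_prob_algebra measure_pmf.prob_space_axioms)
  have "prob_space (nc_law c \<alpha> \<mu>)" "sets (nc_law c \<alpha> \<mu>) = sets borel"
    unfolding nc_law_def using prob_space_bind'[OF p kernel] sets_bind'[OF p kernel] by auto
  then show ?thesis by (auto simp: real_distribution_def real_distribution_axioms_def)
qed

lemma nn_integral_nc_law: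
  assumes f: "f \<in> borel_measurable borel"
  shows "(\<integral>\<^sup>+x. f x \<partial>nc_law c \<alpha> \<mu>)
    = (\<Sum>n. ennreal (exp (- \<mu>) * (\<mu> ^ n / fact n)) * (\<integral>\<^sup>+x. f (c * max 0 x) \<partial>gamma_law (\<alpha> + real n)))"
proof -
  have "(\<integral>\<^sup>+x. f x \<partial>nc_law c \<alpha> \<mu>) = (\<integral>\<^sup>+n. (\<integral>\<^sup>+x. f x \<partial>distr (gamma_law (\<alpha> + real n)) borel (\<lambda>x. c * max 0 x)) \<partial>measure_pmf (poisson0 \<mu>))"
    unfolding nc_law_def by (rule nn_integral_bind[OF f measurable_prob_algebraD[OF kernel]])
  also have "\<dots> = (\<integral>\<^sup>+n. (\<integral>\<^sup>+x. f (c * max 0 x) \<partial>gamma_law (\<alpha> + real n)) \<partial>measure_pmf (poisson0 \<mu>))"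
    using f by (intro nn_integral_cong nn_integral_distr) auto
  also have "\<dots> = (\<integral>\<^sup>+n. ennreal (pmf (poisson0 \<mu>) n) * (\<integral>\<^sup>+x. f (c * max 0 x) \<partial>gamma_law (\<alpha> + real n)) \<partial>count_space UNIV)"
    by (rule nn_integral_measure_pmf)
  finally show ?thesis by (simp add: nn_integral_count_space_nat pmf_poisson0[OF \<mu>])
qed

lemma nonneg_integral_nc_law:
  assumes f: "adm c f" "\<And>x. 0 \<le> x \<Longrightarrow> 0 \<le> f x" and m: "(\<lambda>x. f (max 0 x)) \<in> borel_measurable borel"
  shows "integrable (nc_law c \<alpha> \<mu>) (\<lambda>x. f (max 0 x))"
    and "(LINT x|nc_law c \<alpha> \<mu>. f (max 0 x)) = exp (- \<mu>) * (\<Sum>n. gamma_mean (\<alpha> + real n) c f / fact n * \<mu> ^ n)"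
proof -
  interpret real_distribution "nc_law c \<alpha> \<mu>" by (rule real_distribution_nc_law)
  let ?w = "\<lambda>n. exp (- \<mu>) * (\<mu> ^ n / fact n)"
  have Gn: "0 \<le> gamma_mean (\<alpha> + real n) c f" for n
    unfolding gamma_mean_def using f(2) c by (intro Bochner_Integration.integral_nonneg) auto
  have s: "summable (\<lambda>n. ?w n * gamma_mean (\<alpha> + real n) c f)"
    using summable_mult[OF nc_mean_summable[OF f(1) c \<alpha>, of \<mu>], of "exp (- \<mu>)"] by (simp add: mult_ac)
  have "(\<integral>\<^sup>+x. ennreal (f (max 0 x)) \<partial>nc_law c \<alpha> \<mu>)
    = (\<Sum>n. ennreal (?w n) * (\<integral>\<^sup>+x. ennreal (f (max 0 (c * max 0 x))) \<partial>gamma_law (\<alpha> + real n)))"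
    using m by (intro nn_integral_nc_law) auto
  also have "\<dots> = (\<Sum>n. ennreal (?w n * gamma_mean (\<alpha> + real n) c f))"
  proof (intro suminf_cong)
    fix n
    have "(\<integral>\<^sup>+x. ennreal (f (max 0 (c * max 0 x))) \<partial>gamma_law (\<alpha> + real n)) = (\<integral>\<^sup>+x. ennreal (f (c * max 0 x)) \<partial>gamma_law (\<alpha> + real n))"
      using c by (simp add: max_absorb2)
    also have "\<dots> = ennreal (gamma_mean (\<alpha> + real n) c f)"
      unfolding gamma_mean_def using \<alpha> f(2) c by (intro nn_integral_eq_integral gamma_mean_integrable[OF f(1) c]) auto
    finally have e: "(\<integral>\<^sup>+x. ennreal (f (max 0 (c * max 0 x))) \<partial>gamma_law (\<alpha> + real n)) = ennreal (gamma_mean (\<alpha> + real n) c f)" .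
    show "ennreal (?w n) * (\<integral>\<^sup>+x. ennreal (f (max 0 (c * max 0 x))) \<partial>gamma_law (\<alpha> + real n)) = ennreal (?w n * gamma_mean (\<alpha> + real n) c f)"
      unfolding e by (rule ennreal_mult[symmetric]) (use \<mu> Gn in auto)
  qed
  also have "\<dots> = ennreal (\<Sum>n. ?w n * gamma_mean (\<alpha> + real n) c f)"
    using \<mu> Gn s by (intro suminf_ennreal2) auto
  finally have nn: "(\<integral>\<^sup>+x. ennreal (f (max 0 x)) \<partial>nc_law c \<alpha> \<mu>) = ennreal (\<Sum>n. ?w n * gamma_mean (\<alpha> + real n) c f)" .
  have pos: "0 \<le> (\<Sum>n. ?w n * gamma_mean (\<alpha> + real n) c f)"
    using s \<mu> Gn by (intro suminf_nonneg) auto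
  have m': "(\<lambda>x. f (max 0 x)) \<in> borel_measurable (nc_law c \<alpha> \<mu>)" using m by simp
  show "integrable (nc_law c \<alpha> \<mu>) (\<lambda>x. f (max 0 x))"
    using nn f(2) m' by (intro integrableI_nonneg) auto
  have "(LINT x|nc_law c \<alpha> \<mu>. f (max 0 x)) = (\<Sum>n. ?w n * gamma_mean (\<alpha> + real n) c f)"
    using nn f(2) m' pos by (subst integral_eq_nn_integral) auto
  also have "\<dots> = (\<Sum>n. exp (- \<mu>) * (gamma_mean (\<alpha> + real n) c f / fact n * \<mu> ^ n))" by (simp add: mult_ac)
  also have "\<dots> = exp (- \<mu>) * (\<Sum>n. gamma_mean (\<alpha> + real n) c f / fact n * \<mu> ^ n)"
    by (rule suminf_mult[OF nc_mean_summable[OF f(1) c \<alpha>]])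
  finally show "(LINT x|nc_law c \<alpha> \<mu>. f (max 0 x)) = exp (- \<mu>) * (\<Sum>n. gamma_mean (\<alpha> + real n) c f / fact n * \<mu> ^ n)" .
qed

lemma AE_nc_law_nonneg: "AE x in nc_law c \<alpha> \<mu>. 0 \<le> x"
proof -
  interpret real_distribution "nc_law c \<alpha> \<mu>" by (rule real_distribution_nc_law)
  have "(\<integral>\<^sup>+x. indicator {..<0} x \<partial>nc_law c \<alpha> \<mu>)
    = (\<Sum>n. ennreal (exp (- \<mu>) * (\<mu> ^ n / fact n)) * (\<integral>\<^sup>+x. indicator {..<0} (c * max 0 x) \<partial>gamma_law (\<alpha> + real n)))"
    by (rule nn_integral_nc_law) auto
  also have "\<dots> = 0"
  proof -
    have "indicator {..<0} (c * max 0 x) = (0::ennreal)" for x using c by (auto simp: indicator_def not_less)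
    then show ?thesis by simp
  qed
  finally have "emeasure (nc_law c \<alpha> \<mu>) {..<0} = 0" by simp
  then show ?thesis by (intro AE_I[where N="{..<0}"]) auto
qed

end

text \<open>A signed f is written as (f + h) - h with its exponential majorant h; both parts are
  nonnegative and admissible.\<close>

lemma integral_nc_law:
  assumes c: "0 < c" and \<alpha>: "0 \<le> \<alpha>" and d: "0 \<le> d" and y: "0 \<le> y" and f: "adm c f"
  shows "integrable (nc_law c \<alpha> (y * d)) (\<lambda>x. f (max 0 x))"
    and "(LINT x|nc_law c \<alpha> (y * d). f (max 0 x)) = nc_mean c d \<alpha> f y"
proof -
  have yd: "0 \<le> y * d" using y d by simp
  from admE[OF f] obtain K where K: "0 \<le> K" "\<And>y. 0 \<le> y \<Longrightarrow> \<bar>f y\<bar> \<le> K * exp (y / (2 * c))" by blast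
  define h where "h = (\<lambda>y. K * exp (y / (2 * c)))"
  have h: "adm c h" unfolding adm_def h_def
    using c K(1) by (auto intro!: continuous_intros exI[of _ K])
  have fh: "adm c (\<lambda>x. f x + h x)" by (rule adm_add[OF f h])
  have m: "(\<lambda>x. g (max 0 x)) \<in> borel_measurable borel" if "adm c g" for g
  proof (rule borel_measurable_continuous_onI)
    have "continuous_on {0..} g" using that by (simp add: adm_def)
    then show "continuous_on UNIV (\<lambda>x. g (max 0 x))"
      by (rule continuous_on_compose2) (auto intro!: continuous_intros)
  qed
  have h0: "\<And>x. 0 \<le> x \<Longrightarrow> 0 \<le> h x" using K(1) by (simp add: h_def)
  have fh0: "\<And>x. 0 \<le> x \<Longrightarrow> 0 \<le> f x + h x" using K(2) unfolding h_def by (smt (verit))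
  note 1 = nonneg_integral_nc_law[OF c \<alpha> yd h h0 m[OF h]]
  note 2 = nonneg_integral_nc_law[OF c \<alpha> yd fh fh0 m[OF fh]]
  have h_eq: "(LINT x|nc_law c \<alpha> (y * d). h (max 0 x)) = nc_mean c d \<alpha> h y"
    unfolding nc_mean_def by (rule 1(2))
  have fh_eq: "(LINT x|nc_law c \<alpha> (y * d). f (max 0 x) + h (max 0 x)) = nc_mean c d \<alpha> (\<lambda>x. f x + h x) y"
    unfolding nc_mean_def by (rule 2(2))
  have eq: "f (max 0 x) = (f (max 0 x) + h (max 0 x)) - h (max 0 x)" for x by simp
  show "integrable (nc_law c \<alpha> (y * d)) (\<lambda>x. f (max 0 x))"
    by (subst eq, rule Bochner_Integration.integrable_diff[OF 2(1) 1(1)])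
  have "(LINT x|nc_law c \<alpha> (y * d). f (max 0 x))
    = (LINT x|nc_law c \<alpha> (y * d). (f (max 0 x) + h (max 0 x)) - h (max 0 x))" by simp
  also have "\<dots> = (LINT x|nc_law c \<alpha> (y * d). f (max 0 x) + h (max 0 x)) - (LINT x|nc_law c \<alpha> (y * d). h (max 0 x))"
    by (rule Bochner_Integration.integral_diff[OF 2(1) 1(1)])
  also have "\<dots> = nc_mean c d \<alpha> (\<lambda>x. f x + h x) y - nc_mean c d \<alpha> h y"
    by (rule arg_cong2[where f="(-)", OF fh_eq h_eq])
  finally have "(LINT x|nc_law c \<alpha> (y * d). f (max 0 x)) = nc_mean c d \<alpha> (\<lambda>x. f x + h x) y - nc_mean c d \<alpha> h y" .
  then show "(LINT x|nc_law c \<alpha> (y * d). f (max 0 x)) = nc_mean c d \<alpha> f y"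
    using nc_mean_add[OF f h c \<alpha>] by simp
qed

lemma gamma_mean_exp:
  assumes c: "0 < c" and p: "0 \<le> p" and l: "0 \<le> l"
  shows "gamma_mean p c (\<lambda>x. exp (- l * x)) = (1 + l * c) powr (- p)"
proof -
  have "gamma_mean p c (\<lambda>x. exp (- l * x)) = (LINT x|gamma_law p. exp (- (l * c) * x))"
    unfolding gamma_mean_def
  proof (rule integral_cong_AE)
    show "AE x in gamma_law p. exp (- l * (c * max 0 x)) = exp (- (l * c) * x)"
      using AE_gamma_law_nonneg[OF p] by eventually_elim (simp add: mult.assoc)
  qed measurable
  also have "\<dots> = (1 + l * c) powr (- p)"
  proof -
    have "- (l * c) < 1" using mult_nonneg_nonneg[of l c] c l by linarith
    from nn_integral_gamma_exp[OF p this] show ?thesis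
      by (subst integral_eq_nn_integral) auto
  qed
  finally show ?thesis .
qed

text \<open>The n-th Gamma mean carries the factor (1 + l c)^(- n), so the sum is again an
  exponential series. For c d = exp (- b t) the result has the form of the right-hand side of
  \<open>laplace\<close>.\<close>

lemma nc_mean_exp:
  assumes c: "0 < c" and \<alpha>: "0 \<le> \<alpha>" and l: "0 \<le> l"
  shows "nc_mean c d \<alpha> (\<lambda>x. exp (- l * x)) y = exp (- (y * (l * (c * d) / (1 + l * c)))) * (1 + l * c) powr (- \<alpha>)"
proof -
  have lc: "0 < 1 + l * c" using c l by (simp add: add_pos_nonneg)
  have "gamma_mean (\<alpha> + real n) c (\<lambda>x. exp (- l * x)) / fact n * (y * d) ^ n
    = (1 + l * c) powr (- \<alpha>) * (inverse (fact n) * (y * d / (1 + l * c)) ^ n)" for n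
    using \<alpha> lc by (subst gamma_mean_exp[OF c _ l])
      (auto simp: powr_diff powr_minus powr_realpow power_divide power_mult_distrib divide_inverse power_inverse mult_ac)
  then have "nc_mean c d \<alpha> (\<lambda>x. exp (- l * x)) y
    = exp (- (y * d)) * (\<Sum>n. (1 + l * c) powr (- \<alpha>) * (inverse (fact n) * (y * d / (1 + l * c)) ^ n))"
    by (simp only: nc_mean_def)
  also have "\<dots> = exp (- (y * d)) * ((1 + l * c) powr (- \<alpha>) * exp (y * d / (1 + l * c)))"
    by (subst suminf_mult[OF summable_exp]) (simp add: exp_def)
  also have "\<dots> = exp (- (y * d) + y * d / (1 + l * c)) * (1 + l * c) powr (- \<alpha>)"
    by (simp add: mult_exp_exp)
  also have "- (y * d) + y * d / (1 + l * c) = - (y * (l * (c * d) / (1 + l * c)))"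
    using lc by (simp add: field_simps)
  finally show ?thesis .
qed


section \<open>The transition law and its derivatives in the starting point\<close>

text \<open>Every point of the half-line, 0 included, is a limit point of it, so derivatives within
  it are unique.\<close>

lemma deriv_Rplus_eq:
  assumes "0 \<le> y" and "(f has_real_derivative D) (at y within {0..})"
  shows "deriv_Rplus f y = D"
proof -
  have "y islimpt {0..}"
    by (rule islimpt_subset[OF islimpt_greaterThanLessThan1[of y "y + 1"]]) (use assms(1) in auto)
  then have nb: "at y within {0..} \<noteq> bot" by (simp add: trivial_limit_within)
  have v: "(f has_vector_derivative D) (at y within {0..})"
    using assms(2) by (simp add: has_real_derivative_iff_has_vector_derivative)
  then have "f differentiable (at y within {0..})"
    by (auto simp: differentiable_def has_vector_derivative_def)
  then have "(f has_vector_derivative deriv_Rplus f y) (at y within {0..})"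
    unfolding deriv_Rplus_def by (simp add: vector_derivative_works)
  from vector_derivative_unique_within[OF nb this v] show ?thesis .
qed

lemma deriv_Rplus_works:
  assumes "f differentiable (at y within {0..})"
  shows "(f has_real_derivative deriv_Rplus f y) (at y within {0..})"
  using assms unfolding deriv_Rplus_def
  by (simp add: has_real_derivative_iff_has_vector_derivative vector_derivative_works)

lemma C_pol_bound:
  assumes f: "f \<in> C_pol m L" and j: "j \<le> m" and y: "0 \<le> y"
  shows "\<bar>(deriv_Rplus ^^ j) f y\<bar> \<le> pol_norm m L f * (1 + y ^ L)"
proof -
  let ?q = "\<lambda>j y. \<bar>(deriv_Rplus ^^ j) f y\<bar> / (1 + y ^ L)"
  have "bdd_above (?q j ` {0..})" using f j by (auto simp: C_pol_def)
  then have "?q j y \<le> (SUP y\<in>{0..}. ?q j y)" using y by (intro cSUP_upper) auto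
  also have "\<dots> \<le> pol_norm m L f"
    unfolding pol_norm_def using j by (intro Max_ge) auto
  finally show ?thesis using y by (simp add: pos_divide_le_eq add_pos_nonneg)
qed

lemma pol_norm_nonneg:
  assumes "f \<in> C_pol m L"
  shows "0 \<le> pol_norm m L f"
proof -
  have "0 \<le> pol_norm m L f * (1 + 0 ^ L)" using C_pol_bound[OF assms, of 0 0] by simp
  moreover have "(0::real) < 1 + 0 ^ L" by (simp add: add_pos_nonneg)
  ultimately show ?thesis by (simp add: zero_le_mult_iff)
qed

lemma C_pol_adm:
  assumes "f \<in> C_pol m L" and "j \<le> m" and "0 < c"
  shows "adm c ((deriv_Rplus ^^ j) f)"
  by (rule adm_poly[OF assms(3) _ C_pol_bound[OF assms(1,2)]])
    (use assms in \<open>auto simp: C_pol_def C_Rplus_def\<close>)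

context
  fixes c d \<alpha> :: real and f u :: "real \<Rightarrow> real" and m L :: nat
  assumes c: "0 < c" and d: "0 \<le> d" and \<alpha>: "0 \<le> \<alpha>" and f: "f \<in> C_pol m L"
    and u: "\<And>y. 0 \<le> y \<Longrightarrow> u y = nc_mean c d \<alpha> f y"
begin

text \<open>v stands for an iterated derivative of u. Agreement is asked on the half-line only,
  because an expectation as a function of y is uncontrolled for negative y.\<close>

lemma deriv_nc_mean_step:
  assumes j: "j < m" and y: "0 \<le> y"
    and v: "\<And>y. 0 \<le> y \<Longrightarrow> v y = (c * d) ^ j * nc_mean c d (\<alpha> + real j) ((deriv_Rplus ^^ j) f) y"
  shows "(v has_real_derivative (c * d) ^ Suc j * nc_mean c d (\<alpha> + real (Suc j)) ((deriv_Rplus ^^ Suc j) f) y)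
    (at y within {0..})"
proof -
  let ?g = "(deriv_Rplus ^^ j) f" and ?g' = "(deriv_Rplus ^^ Suc j) f"
  have "(nc_mean c d (\<alpha> + real j) ?g has_real_derivative c * d * nc_mean c d (\<alpha> + real j + 1) ?g' y) (at y within {0..})"
  proof (rule nc_mean_deriv[OF C_pol_adm[OF f _ c] C_pol_adm[OF f _ c] c])
    fix z :: real assume "0 \<le> z"
    then have "?g differentiable (at z within {0..})" using f j by (auto simp: C_pol_def C_Rplus_def)
    then show "(?g has_real_derivative ?g' z) (at z within {0..})" by (simp add: deriv_Rplus_works)
  qed (use j \<alpha> in auto)
  then have "((\<lambda>z. (c * d) ^ j * nc_mean c d (\<alpha> + real j) ?g z) has_real_derivative
    (c * d) ^ j * (c * d * nc_mean c d (\<alpha> + real j + 1) ?g' y)) (at y within {0..})"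
    by (rule DERIV_cmult)
  moreover have "(c * d) ^ j * (c * d * nc_mean c d (\<alpha> + real j + 1) ?g' y) = (c * d) ^ Suc j * nc_mean c d (\<alpha> + real (Suc j)) ?g' y"
    by (simp add: mult_ac add_ac)
  ultimately have "((\<lambda>z. (c * d) ^ j * nc_mean c d (\<alpha> + real j) ?g z) has_real_derivative
    (c * d) ^ Suc j * nc_mean c d (\<alpha> + real (Suc j)) ?g' y) (at y within {0..})" by (simp only:)
  then show ?thesis
    by (rule has_field_derivative_transform_within[where d=1]) (use y v in auto)
qed

lemma deriv_nc_mean:
  assumes "j \<le> m" and "0 \<le> y"
  shows "(deriv_Rplus ^^ j) u y = (c * d) ^ j * nc_mean c d (\<alpha> + real j) ((deriv_Rplus ^^ j) f) y"
  using assms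
proof (induction j arbitrary: y)
  case 0
  then show ?case using u by simp
next
  case (Suc j)
  have "((deriv_Rplus ^^ j) u has_real_derivative (c * d) ^ Suc j * nc_mean c d (\<alpha> + real (Suc j)) ((deriv_Rplus ^^ Suc j) f) y) (at y within {0..})"
    by (rule deriv_nc_mean_step) (use Suc in auto)
  from deriv_Rplus_eq[OF Suc.prems(2) this] show ?case by simp
qed

text \<open>All derivatives of f are measured against the same weight \<open>1 + y ^ L\<close>, so
  only L-th moments under the shapes \<alpha> + j enter; 1 \<le> D allows replacing
  \<open>D ^ j\<close> by \<open>D ^ m\<close>.\<close>

lemma C_pol_nc_mean:
  assumes D: "1 \<le> D" "c * d \<le> D" and B: "0 \<le> B"
    and mom: "\<And>j y. j \<le> m \<Longrightarrow> 0 \<le> y \<Longrightarrow> nc_mean c d (\<alpha> + real j) (\<lambda>x. x ^ L) y \<le> B * (1 + y ^ L)"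
  shows "u \<in> C_pol m L" and "pol_norm m L u \<le> D ^ m * (1 + B) * pol_norm m L f"
proof -
  let ?N = "pol_norm m L f"
  have N: "0 \<le> ?N" by (rule pol_norm_nonneg[OF f])
  have bound: "\<bar>(deriv_Rplus ^^ j) u y\<bar> / (1 + y ^ L) \<le> D ^ m * (1 + B) * ?N" if j: "j \<le> m" and y: "0 \<le> y" for j y
  proof -
    have \<alpha>j: "0 \<le> \<alpha> + real j" using \<alpha> by simp
    have "\<bar>nc_mean c d (\<alpha> + real j) ((deriv_Rplus ^^ j) f) y\<bar> \<le> nc_mean c d (\<alpha> + real j) (\<lambda>x. ?N * (1 + x ^ L)) y"
      by (rule nc_mean_abs_le[OF C_pol_adm[OF f j c] adm_cmult[OF adm_add[OF adm_const[OF c] adm_power[OF c]]] c \<alpha>j d y])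
        (rule C_pol_bound[OF f j])
    also have "\<dots> = ?N * (1 + nc_mean c d (\<alpha> + real j) (\<lambda>x. x ^ L) y)"
      using nc_mean_cmult[OF adm_add[OF adm_const[OF c] adm_power[OF c]] c \<alpha>j]
        nc_mean_add[OF adm_const[OF c] adm_power[OF c] c \<alpha>j] nc_mean_const[OF \<alpha>j] by simp
    also have "\<dots> \<le> ?N * (1 + B * (1 + y ^ L))"
      using N mom[OF j y] by (intro mult_left_mono) auto
    also have "\<dots> \<le> ?N * ((1 + B) * (1 + y ^ L))"
      using N y by (intro mult_left_mono) (auto simp: distrib_right)
    finally have 1: "\<bar>nc_mean c d (\<alpha> + real j) ((deriv_Rplus ^^ j) f) y\<bar> \<le> ?N * ((1 + B) * (1 + y ^ L))" .
    have "(c * d) ^ j \<le> D ^ j" using c d D by (intro power_mono) auto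
    also have "\<dots> \<le> D ^ m" using D j by (intro power_increasing)
    finally have 2: "(c * d) ^ j \<le> D ^ m" .
    have "\<bar>(deriv_Rplus ^^ j) u y\<bar> = (c * d) ^ j * \<bar>nc_mean c d (\<alpha> + real j) ((deriv_Rplus ^^ j) f) y\<bar>"
      using c d by (simp add: deriv_nc_mean[OF j y] abs_mult)
    also have "\<dots> \<le> D ^ m * (?N * ((1 + B) * (1 + y ^ L)))"
      using 1 2 D by (intro mult_mono) auto
    also have "\<dots> = D ^ m * (1 + B) * ?N * (1 + y ^ L)" by (simp only: mult_ac)
    finally show ?thesis using y by (simp add: pos_divide_le_eq add_pos_nonneg)
  qed
  have diff: "(deriv_Rplus ^^ j) u differentiable (at y within {0..})" if "j < m" "0 \<le> y" for j y
    using deriv_nc_mean_step[OF that deriv_nc_mean] that by (auto simp: real_differentiable_def)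
  have cont: "continuous_on {0..} ((deriv_Rplus ^^ j) u)" if "j \<le> m" for j
  proof -
    have "continuous_on {0..} (\<lambda>y. (c * d) ^ j * nc_mean c d (\<alpha> + real j) ((deriv_Rplus ^^ j) f) y)"
      using \<alpha> by (intro continuous_intros nc_mean_continuous[OF C_pol_adm[OF f that c] c]) auto
    then show ?thesis by (rule continuous_on_eq) (use deriv_nc_mean[OF that] in auto)
  qed
  show "u \<in> C_pol m L"
    unfolding C_pol_def C_Rplus_def
    using diff cont by (auto intro!: bdd_aboveI2[where M="D ^ m * (1 + B) * ?N"] bound)
  have "(SUP y\<in>{0..}. \<bar>(deriv_Rplus ^^ j) u y\<bar> / (1 + y ^ L)) \<le> D ^ m * (1 + B) * ?N" if "j \<le> m" for j
    by (rule cSUP_least) (use bound that in auto)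
  then show "pol_norm m L u \<le> D ^ m * (1 + B) * ?N"
    unfolding pol_norm_def by (subst Max_le_iff) auto
qed

end

context cir
begin

text \<open>\<open>laplace\<close> and \<open>nc_mean_exp\<close> give the same transform on a right
  neighbourhood of 0, and both laws have exponential moments of order \<eta>, so
  \<open>mgf_unique\<close> applies.\<close>

lemma law:
  assumes a: "0 \<le> a" and \<sigma>: "0 < \<sigma>" and y: "0 \<le> y" and t: "0 < t"
  shows "distr M borel (X t) = nc_law (\<sigma>\<^sup>2 / 2 * tau b t) (a / (\<sigma>\<^sup>2 / 2)) (y * (exp (- (b * t)) / (\<sigma>\<^sup>2 / 2 * tau b t)))"
proof -
  define c where "c = \<sigma>\<^sup>2 / 2 * tau b t"
  define d where "d = exp (- (b * t)) / c"
  define \<alpha> where "\<alpha> = a / (\<sigma>\<^sup>2 / 2)"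
  \<comment> \<open>The largest order that \<open>exp_moment_bound\<close> admits; it is also the
    growth rate in \<open>adm\<close>.\<close>
  define \<eta> where "\<eta> = 1 / (2 * c)"
  have c: "0 < c" using \<sigma> tau_pos[OF t] by (simp add: c_def)
  have d: "0 \<le> d" using c by (simp add: d_def)
  have \<alpha>: "0 \<le> \<alpha>" using a by (simp add: \<alpha>_def)
  have \<eta>: "0 < \<eta>" using c by (simp add: \<eta>_def)
  have \<eta>c: "\<eta> * (\<sigma>\<^sup>2 / 2) * tau b t \<le> 1 / 2"
    unfolding mult.assoc c_def[symmetric] using c by (simp add: \<eta>_def)
  define q where "q = 24 * exp (2 * \<bar>b\<bar> * t) * \<sigma>\<^sup>2 * t"
  have q: "0 < q" using \<sigma> t by (simp add: q_def)
  have cd: "c * d = exp (- (b * t))" using c by (simp add: d_def)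
  have yd: "0 \<le> y * d" using y d by simp
  let ?\<nu> = "nc_law c \<alpha> (y * d)"
  have "distr M borel (X t) = ?\<nu>"
  \<comment> \<open>For l < 1 and l < \<eta> / q one has l^2 q \<le> l q \<le> \<eta>, the quadratic
    condition of \<open>laplace\<close>.\<close>
  proof (rule mgf_unique[where \<epsilon>=\<eta> and ?l0.0="min \<eta> (min 1 (\<eta> / q))"])
    show "real_distribution (distr M borel (X t))"
      by (intro real_distribution.intro prob_space_distr) (auto simp: real_distribution_axioms_def)
    show "real_distribution ?\<nu>" by (rule real_distribution_nc_law[OF c \<alpha> yd])
    show "0 < \<eta>" by (rule \<eta>)
    show "0 < min \<eta> (min 1 (\<eta> / q))" using \<eta> q by simp
    have "integrable M (\<lambda>w. exp (\<eta> * \<bar>X t w\<bar>))"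
    proof (rule integrableI_nonneg)
      have "(\<integral>\<^sup>+w. ennreal (exp (\<eta> * \<bar>X t w\<bar>)) \<partial>M) = (\<integral>\<^sup>+w. ennreal (exp (\<eta> * X t w)) \<partial>M)"
        using X_nonneg by (intro nn_integral_cong) auto
      also have "\<dots> \<le> ennreal (exp (2 * \<eta> * exp (\<bar>b\<bar> * t) * y + a * ln 2 / (\<sigma>\<^sup>2 / 2)))"
        using \<eta> \<eta>c t by (intro exp_moment_bound a \<sigma> y) auto
      also have "\<dots> < \<infinity>" by simp
      finally show "(\<integral>\<^sup>+w. ennreal (exp (\<eta> * \<bar>X t w\<bar>)) \<partial>M) < \<infinity>" .
    qed auto
    then show "integrable (distr M borel (X t)) (\<lambda>x. exp (\<eta> * \<bar>x\<bar>))"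
      by (subst integrable_distr_eq) auto
    have ad: "adm c (\<lambda>x. exp (\<eta> * x))"
      unfolding adm_def \<eta>_def using c by (auto intro!: continuous_intros exI[of _ 1])
    show "integrable ?\<nu> (\<lambda>x. exp (\<eta> * \<bar>x\<bar>))"
    proof (rule integrable_cong_AE_imp[OF integral_nc_law(1)[OF c \<alpha> d y ad]])
      interpret N: real_distribution ?\<nu> by (rule real_distribution_nc_law[OF c \<alpha> yd])
      show "(\<lambda>x. exp (\<eta> * \<bar>x\<bar>)) \<in> borel_measurable ?\<nu>" by measurable
      show "AE x in ?\<nu>. exp (\<eta> * max 0 x) = exp (\<eta> * \<bar>x\<bar>)"
        using AE_nc_law_nonneg[OF c \<alpha> yd] by eventually_elim auto
    qed
  next
    fix l :: real assume l: "0 < l" "l < min \<eta> (min 1 (\<eta> / q))"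
    have "l\<^sup>2 * q \<le> l * 1 * q" unfolding power2_eq_square using l q by (intro mult_right_mono mult_left_mono) auto
    also have "\<dots> \<le> \<eta>" using l q by (simp add: pos_less_divide_eq less_imp_le)
    finally have lq: "24 * l\<^sup>2 * exp (2 * \<bar>b\<bar> * t) * \<sigma>\<^sup>2 * t \<le> \<eta>" by (simp add: q_def mult_ac)
    let ?R = "exp (- (y * (l * exp (- (b * t)) / (1 + l * c)))) * (1 + l * c) powr (- \<alpha>)"
    have "(\<integral>\<^sup>+w. ennreal (exp (- l * X t w)) \<partial>M) = ennreal ?R"
      using laplace[OF a \<sigma> y t \<eta> \<eta>c _ _ lq] l unfolding mult.assoc[of l "\<sigma>\<^sup>2 / 2"] c_def[symmetric] \<alpha>_def[symmetric] by simp
    then have "(LINT w|M. exp (- l * X t w)) = ?R"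
      by (subst integral_eq_nn_integral) auto
    then have 1: "(LINT x|distr M borel (X t). exp (- l * x)) = ?R"
      by (subst integral_distr) auto
    have ad: "adm c (\<lambda>x. exp (- l * x))"
    proof (rule adm_poly[OF c, where K=1 and L=0])
      show "\<bar>exp (- l * x)\<bar> \<le> 1 * (1 + x ^ 0)" if "0 \<le> x" for x
      proof -
        have "\<bar>exp (- l * x)\<bar> \<le> 1" using that l by simp
        also have "1 \<le> 1 * (1 + x ^ 0)" by simp
        finally show ?thesis .
      qed
    qed (auto intro!: continuous_intros)
    interpret N: real_distribution ?\<nu> by (rule real_distribution_nc_law[OF c \<alpha> yd])
    have "(LINT x|?\<nu>. exp (- l * x)) = (LINT x|?\<nu>. exp (- l * max 0 x))"
    proof (rule integral_cong_AE)
      show "AE x in ?\<nu>. exp (- l * x) = exp (- l * max 0 x)"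
        using AE_nc_law_nonneg[OF c \<alpha> yd] by eventually_elim auto
    qed measurable
    also have "\<dots> = ?R"
      using integral_nc_law(2)[OF c \<alpha> d y ad] nc_mean_exp[OF c \<alpha>, of l d y] l unfolding cd by simp
    finally show "(LINT x|distr M borel (X t). exp (- l * x)) = (LINT x|?\<nu>. exp (- l * x))"
      using 1 by simp
  qed
  then show ?thesis unfolding c_def[symmetric] d_def[symmetric] \<alpha>_def[symmetric] .
qed

lemma expectation_eq_nc_mean:
  assumes a: "0 \<le> a" and \<sigma>: "0 < \<sigma>" and y: "0 \<le> y" and t: "0 < t"
    and f: "adm (\<sigma>\<^sup>2 / 2 * tau b t) f"
  shows "integrable M (\<lambda>w. f (Y t w))"
    and "expectation (\<lambda>w. f (Y t w))
      = nc_mean (\<sigma>\<^sup>2 / 2 * tau b t) (exp (- (b * t)) / (\<sigma>\<^sup>2 / 2 * tau b t)) (a / (\<sigma>\<^sup>2 / 2)) f y"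
proof -
  let ?c = "\<sigma>\<^sup>2 / 2 * tau b t"
  have c: "0 < ?c" using \<sigma> tau_pos[OF t] by simp
  have d: "0 \<le> exp (- (b * t)) / ?c" using c by simp
  have \<alpha>: "0 \<le> a / (\<sigma>\<^sup>2 / 2)" using a by simp
  have m: "(\<lambda>x. f (max 0 x)) \<in> borel_measurable borel"
  proof (rule borel_measurable_continuous_onI)
    have "continuous_on {0..} f" using f by (simp add: adm_def)
    then show "continuous_on UNIV (\<lambda>x. f (max 0 x))"
      by (rule continuous_on_compose2) (auto intro!: continuous_intros)
  qed
  have eq: "f (Y t w) = f (max 0 (X t w))" if "w \<in> space M" for w
    using X_nonneg[OF that, of t] t by (simp add: X_eq max_absorb2)
  note N = integral_nc_law[OF c \<alpha> d y f, folded law[OF a \<sigma> y t]]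
  have "integrable M (\<lambda>w. f (max 0 (X t w)))"
    using N(1) m by (subst (asm) integrable_distr_eq) auto
  then show "integrable M (\<lambda>w. f (Y t w))"
    using eq by (simp cong: Bochner_Integration.integrable_cong)
  have "expectation (\<lambda>w. f (Y t w)) = expectation (\<lambda>w. f (max 0 (X t w)))"
    using eq by (intro Bochner_Integration.integral_cong) auto
  also have "\<dots> = nc_mean ?c (exp (- (b * t)) / ?c) (a / (\<sigma>\<^sup>2 / 2)) f y"
    using N(2) m by (subst (asm) integral_distr) auto
  finally show "expectation (\<lambda>w. f (Y t w)) = nc_mean ?c (exp (- (b * t)) / ?c) (a / (\<sigma>\<^sup>2 / 2)) f y" .
qed

end

theorem proposition1p2p3:
  fixes a b \<sigma> T :: real and m L :: nat
  assumes "a \<ge> 0" and "\<sigma> > 0" and "m \<le> L" and "T > 0"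
  shows "\<exists>C\<ge>0. \<forall>(M :: 'w measure) F W Y.
    brownian_motion M F W \<longrightarrow> (\<forall>y\<ge>0. cir_process M F W a b \<sigma> y (Y y)) \<longrightarrow>
    (\<forall>f\<in>C_pol m L. \<forall>t\<in>{0<..T}.
       (\<forall>y\<ge>0. integrable M (\<lambda>\<omega>. f (Y y t \<omega>))) \<and>
       (\<lambda>y. prob_space.expectation M (\<lambda>\<omega>. f (Y y t \<omega>))) \<in> C_pol m L \<and>
       pol_norm m L (\<lambda>y. prob_space.expectation M (\<lambda>\<omega>. f (Y y t \<omega>))) \<le> C * pol_norm m L f)"
proof -
  define \<kappa> where "\<kappa> = \<sigma>\<^sup>2 / 2"
  define \<alpha> where "\<alpha> = a / \<kappa>"
  define D where "D = exp (\<bar>b\<bar> * T)"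
  have \<kappa>: "0 < \<kappa>" using assms by (simp add: \<kappa>_def)
  have \<alpha>: "0 \<le> \<alpha>" using assms \<kappa> by (simp add: \<alpha>_def)
  have D: "1 \<le> D" using assms by (simp add: D_def)
  have C: "0 \<le> \<kappa> * tau b T" using \<kappa> tau_pos[OF \<open>T > 0\<close>, of b] by simp
  \<comment> \<open>The constants are fixed before the probability space and t. For t \<le> T the
    scale c is at most its value at T and c d = exp (- b t) is at most D, so the moment bounds are
    uniform in t.\<close>
  have "\<forall>j. \<exists>B\<ge>0. \<forall>c d y. 0 < c \<longrightarrow> c \<le> \<kappa> * tau b T \<longrightarrow> 0 \<le> d \<longrightarrow> c * d \<le> D \<longrightarrow> 0 \<le> y \<longrightarrow>
    nc_mean c d (\<alpha> + real j) (\<lambda>x. x ^ L) y \<le> B * (1 + y ^ L)"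
    using C D \<alpha> by (intro allI nc_mean_moment_bound) auto
  then obtain Bj where Bj: "\<And>j::nat. 0 \<le> Bj j"
    "\<And>j c d y. 0 < c \<Longrightarrow> c \<le> \<kappa> * tau b T \<Longrightarrow> 0 \<le> d \<Longrightarrow> c * d \<le> D \<Longrightarrow> 0 \<le> y \<Longrightarrow>
      nc_mean c d (\<alpha> + real j) (\<lambda>x. x ^ L) y \<le> Bj j * (1 + y ^ L)"
    by metis
  \<comment> \<open>The sum of the nonnegative constants dominates each of them and so serves all
    shapes \<alpha> + j at once.\<close>
  define B where "B = (\<Sum>j\<le>m. Bj j)"
  have B: "0 \<le> B" unfolding B_def using Bj(1) by (intro sum_nonneg)
  show ?thesis
  proof (rule exI[of _ "D ^ m * (1 + B)"], intro conjI allI impI ballI)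
    show "0 \<le> D ^ m * (1 + B)" using D B by simp
    fix M :: "'w measure" and F W Y f t
    assume bm: "brownian_motion M F W" and cir: "\<forall>y\<ge>0. cir_process M F W a b \<sigma> y (Y y)"
      and f: "f \<in> C_pol m L" and "t \<in> {0<..T}"
    then have t: "0 < t" "t \<le> T" by auto
    define c where "c = \<kappa> * tau b t"
    define d where "d = exp (- (b * t)) / c"
    have c: "0 < c" using \<kappa> tau_pos[OF t(1), of b] by (simp add: c_def)
    have cT: "c \<le> \<kappa> * tau b T" using \<kappa> tau_mono[OF t(2), of b] by (simp add: c_def)
    have d: "0 \<le> d" using c by (simp add: d_def)
    have cd: "c * d \<le> D"
    proof -
      have "- (b * t) \<le> \<bar>b\<bar> * t" using t by (simp add: abs_if mult_nonneg_nonneg)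
      also have "\<dots> \<le> \<bar>b\<bar> * T" using t by (intro mult_left_mono) auto
      finally show ?thesis using c by (simp add: d_def D_def)
    qed
    have adm: "adm c f" using C_pol_adm[OF f _ c, of 0] by simp
    \<comment> \<open>Each starting point contributes only the law of its own process; nothing has
      to relate the processes for different y.\<close>
    have E: "integrable M (\<lambda>\<omega>. f (Y y t \<omega>)) \<and>
      prob_space.expectation M (\<lambda>\<omega>. f (Y y t \<omega>)) = nc_mean c d \<alpha> f y" if y: "0 \<le> y" for y
    proof -
      interpret prob_space M using bm by (simp add: brownian_motion_def)
      interpret cir M F W a b \<sigma> y "Y y"
        by unfold_locales (use bm cir y in auto)
      show ?thesis
        using expectation_eq_nc_mean[OF \<open>a \<ge> 0\<close> \<open>\<sigma> > 0\<close> y t(1), of f] adm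
        by (simp add: c_def d_def \<alpha>_def \<kappa>_def)
    qed
    have mom: "nc_mean c d (\<alpha> + real j) (\<lambda>x. x ^ L) y \<le> B * (1 + y ^ L)" if "j \<le> m" "0 \<le> y" for j y
    proof -
      have "Bj j \<le> B" unfolding B_def using that Bj(1) by (intro member_le_sum) auto
      then have "Bj j * (1 + y ^ L) \<le> B * (1 + y ^ L)" using that by (intro mult_right_mono) auto
      then show ?thesis using Bj(2)[OF c cT d cd that(2), of j] by linarith
    qed
    show "0 \<le> y \<Longrightarrow> integrable M (\<lambda>\<omega>. f (Y y t \<omega>))" for y
      using E by blast
    note P = C_pol_nc_mean[OF c d \<alpha> f _ D cd B mom, of "\<lambda>y. prob_space.expectation M (\<lambda>\<omega>. f (Y y t \<omega>))"]
    show "(\<lambda>y. prob_space.expectation M (\<lambda>\<omega>. f (Y y t \<omega>))) \<in> C_pol m L"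
      by (rule P(1)) (use E in auto)
    show "pol_norm m L (\<lambda>y. prob_space.expectation M (\<lambda>\<omega>. f (Y y t \<omega>))) \<le> D ^ m * (1 + B) * pol_norm m L f"
      by (rule P(2)) (use E in auto)
  qed
qed

end
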